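(* Let $(\mathcal E,\mathcal F)$ be a Dirichlet form on $L^2(A,\tau)$. If $\omega\in A^*_+$ is a finite-energy functional, then the linear map $\widetilde\omega:\widetilde{\mathcal B}\to\mathbb C$, $$\widetilde\omega(b):=\langle G(\omega),b\rangle_{\mathcal F},$$ extends to the C*-algebra $\mathcal C$ as a positive linear functional with norm equal to $\|\omega\|_{A^*}$.
   Context: Setting. $A$ is a separable C*-algebra with a densely defined, faithful, semifinite, lower semicontinuous positive trace $\tau$. $L^2(A,\tau)$ is its GNS Hilbert space, with inner product $(\cdot,\cdot)_2$ (linear in the second variable) and norm $\|\cdot\|_2$; $\mathcal M=L^\infty(A,\tau)$ is the von Neumann algebra generated by $A$ on $L^2(A,\tau)$, with norm $\|\cdot\|_{\mathcal M}$ and unit $1_{\mathcal M}$; $\tau$ also denotes the normal extension of the trace to $\mathcal M$. Elements $a\in\mathcal M$ with $\tau(a^*a)<\infty$ are identified with vectors of $L^2(A,\tau)$. $L^2_+(A,\tau)$ is the standard positive cone; $J$ is the antiunitary involution extending $a\mapsto a^*$; $L^2_h(A,\tau)=\{\xi: J\xi=\xi\}$. For $\xi\in L^2_h(A,\tau)$, $\xi\wedge 1$ is the Hilbert projection of $\xi$ onto the $L^2$-closure of $\{a=a^*\in A\cap L^2(A,\tau): a\le 1_{\mathcal M}\}$. Dirichlet form. $(\mathcal E,\mathcal F)$ is a closed, densely defined, nonnegative quadratic form on $L^2(A,\tau)$ such that: (real) $J\xi\in\mathcal F$ and $\mathcal E[J\xi]=\mathcal E[\xi]$ for $\xi\in\mathcal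 F$; (Markovian) $\xi\wedge1\in\mathcal F$ and $\mathcal E[\xi\wedge 1]\le\mathcal E[\xi]$ for $\xi\in\mathcal F\cap L^2_h(A,\tau)$; (complete) for each $n\ge1$ the form $\mathcal E_n[[\xi_{ij}]]=\sum_{i,j}\mathcal E[\xi_{ij}]$ on $\mathbb M_n(\mathcal F)\subset L^2(\mathbb M_n(A),\tau\otimes tr_n)$ ($tr_n$ the normalized trace) is real and Markovian; (regular) $\mathcal B:=A\cap\mathcal F$ is norm dense in $A$ and is a form core. The associated sesquilinear form is also denoted $\mathcal E(\cdot,\cdot)$. $\mathcal F$ is a Hilbert space with $\langle\xi,\eta\rangle_{\mathcal F}=\mathcal E(\xi,\eta)+(\xi,\eta)_2$ and norm $\|\cdot\|_{\mathcal F}$. $\mathcal B$ and $\widetilde{\mathcal B}:=\mathcal F\cap\mathcal M$ are involutive algebras. The fine C*-algebra $\mathcal C$ is the norm closure of $\widetilde{\mathcal B}$ in $\mathcal M$; $A\subseteq\mathcal C\subseteq\mathcal M$. Finite energy. $\omega\in A^*_+$ (positive functional) is a finite-energy functional if for some $c_\omega\ge0$, $\omega(b)\le c_\omega\|b\|_{\mathcal F}$ for all $b\in\mathcal B_+:=\mathcal B\cap L^2_+(A,\tau)$. Its potential $G(\omega)$ is the unique element of $\mathcal F$ with $\omega(b)=\langle G(\omega),b\rangle_{\mathcal F}$ for all $b\in\mathcal B$. *)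

theory Defs
  imports "HOL-Analysis.Analysis"
begin

section \<open>Complex Hilbert spaces and C*-algebras\<close>

class complex_vector = real_vector +
  fixes scaleC :: "complex \<Rightarrow> 'a \<Rightarrow> 'a"  (infixr "*\<^sub>C" 75)
  assumes scaleC_add_right: "c *\<^sub>C (x + y) = c *\<^sub>C x + c *\<^sub>C y"
    and scaleC_add_left: "(c + d) *\<^sub>C x = c *\<^sub>C x + d *\<^sub>C x"
    and scaleC_scaleC: "c *\<^sub>C d *\<^sub>C x = (c * d) *\<^sub>C x"
    and scaleC_of_real: "complex_of_real r *\<^sub>C x = r *\<^sub>R x"

text \<open>The inner product is linear in the second variable; its real part is the real inner
  product that carries the norm.\<close>

class complex_hilbert_space = complex_vector + real_inner + complete_space +
  fixes cinner :: "'a \<Rightarrow> 'a \<Rightarrow> complex"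
  assumes cinner_add_right: "cinner x (y + z) = cinner x y + cinner x z"
    and cinner_scaleC_right: "cinner x (c *\<^sub>C y) = c * cinner x y"
    and cinner_commute: "cinner y x = cnj (cinner x y)"
    and Re_cinner: "Re (cinner x y) = inner x y"

text \<open>Not necessarily unital.\<close>

class cstar_algebra = complex_vector + real_normed_algebra + complete_space +
  fixes star :: "'a \<Rightarrow> 'a"
  assumes norm_scaleC: "norm (c *\<^sub>C x) = cmod c * norm x"
    and scaleC_mult_left: "(c *\<^sub>C x) * y = c *\<^sub>C (x * y)"
    and scaleC_mult_right: "x * (c *\<^sub>C y) = c *\<^sub>C (x * y)"
    and star_star: "star (star x) = x"
    and star_add: "star (x + y) = star x + star y"
    and star_scaleC: "star (c *\<^sub>C x) = cnj c *\<^sub>C star x"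
    and star_mult: "star (x * y) = star y * star x"
    and cstar_identity: "norm (star x * x) = (norm x)\<^sup>2"

definition csubspace :: "'v::complex_vector set \<Rightarrow> bool" where
  "csubspace S \<longleftrightarrow> 0 \<in> S \<and> (\<forall>x\<in>S. \<forall>y\<in>S. x + y \<in> S) \<and> (\<forall>c. \<forall>x\<in>S. c *\<^sub>C x \<in> S)"

definition pos_cone :: "'a::cstar_algebra set" where
  "pos_cone = {star b * b | b. True}"

definition positive_functional :: "('a::cstar_algebra \<Rightarrow> complex) \<Rightarrow> bool" where
  "positive_functional \<omega> \<longleftrightarrow>
     bounded_linear \<omega> \<and> (\<forall>c x. \<omega> (c *\<^sub>C x) = c * \<omega> x) \<and> (\<forall>a\<in>pos_cone. \<omega> a \<in> \<real>\<^sub>\<ge>\<^sub>0)"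

text \<open>Bounded operators are elements of the type \<open>'h \<Rightarrow>\<^sub>L 'h\<close> of bounded real-linear maps with the
  operator norm; the complex-linear ones are singled out where needed.  The complex structure on
  these operators is pointwise.\<close>

definition complex_linear_op :: "('h::complex_hilbert_space \<Rightarrow>\<^sub>L 'h) \<Rightarrow> bool" where
  "complex_linear_op T \<longleftrightarrow> (\<forall>c \<xi>. blinfun_apply T (c *\<^sub>C \<xi>) = c *\<^sub>C blinfun_apply T \<xi>)"

definition scaleC_op :: "complex \<Rightarrow> ('h::complex_hilbert_space \<Rightarrow>\<^sub>L 'h) \<Rightarrow> 'h \<Rightarrow>\<^sub>L 'h" where
  "scaleC_op c T = Blinfun (\<lambda>\<xi>. c *\<^sub>C blinfun_apply T \<xi>)"

definition adj :: "('h::complex_hilbert_space \<Rightarrow>\<^sub>L 'h) \<Rightarrow> 'h \<Rightarrow>\<^sub>L 'h" where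
  "adj T = (THE S. \<forall>\<xi> \<zeta>. cinner (blinfun_apply T \<xi>) \<zeta> = cinner \<xi> (blinfun_apply S \<zeta>))"

definition positive_op :: "('h::complex_hilbert_space \<Rightarrow>\<^sub>L 'h) \<Rightarrow> bool" where
  "positive_op T \<longleftrightarrow> complex_linear_op T \<and> (\<forall>\<xi>. cinner \<xi> (blinfun_apply T \<xi>) \<in> \<real>\<^sub>\<ge>\<^sub>0)"

definition op_le :: "('h::complex_hilbert_space \<Rightarrow>\<^sub>L 'h) \<Rightarrow> ('h \<Rightarrow>\<^sub>L 'h) \<Rightarrow> bool" where
  "op_le S T \<longleftrightarrow> positive_op (T - S)"

definition commutant :: "('h::complex_hilbert_space \<Rightarrow>\<^sub>L 'h) set \<Rightarrow> ('h \<Rightarrow>\<^sub>L 'h) set" where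
  "commutant S = {T. complex_linear_op T \<and> (\<forall>s\<in>S. T o\<^sub>L s = s o\<^sub>L T)}"


section \<open>Traces and the GNS space\<close>

locale faithful_semifinite_trace =
  fixes \<tau> :: "'a::cstar_algebra \<Rightarrow> ennreal"  \<comment> \<open>only the values on \<^term>\<open>pos_cone\<close> matter\<close>
  assumes trace_add: "a \<in> pos_cone \<Longrightarrow> b \<in> pos_cone \<Longrightarrow> \<tau> (a + b) = \<tau> a + \<tau> b"
    and trace_scale: "a \<in> pos_cone \<Longrightarrow> 0 \<le> r \<Longrightarrow> \<tau> (r *\<^sub>R a) = ennreal r * \<tau> a"
    and trace_tracial: "\<tau> (star a * a) = \<tau> (a * star a)"
    and densely_defined: "pos_cone \<subseteq> closure {a \<in> pos_cone. \<tau> a < \<infinity>}"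
    and faithful: "a \<in> pos_cone \<Longrightarrow> \<tau> a = 0 \<Longrightarrow> a = 0"
    and semifinite: "a \<in> pos_cone \<Longrightarrow>
      \<tau> a = (SUP b\<in>{b \<in> pos_cone. a - b \<in> pos_cone \<and> \<tau> b < \<infinity>}. \<tau> b)"
    and lower_semicontinuous: "closed {a \<in> pos_cone. \<tau> a \<le> ennreal t}"

text \<open>\<open>A \<inter> L\<^sup>2(A,\<tau>)\<close>.\<close>

definition sq_integrable :: "('a::cstar_algebra \<Rightarrow> ennreal) \<Rightarrow> 'a set" where
  "sq_integrable \<tau> = {a. \<tau> (star a * a) < \<infinity>}"

text \<open>The GNS space \<open>L\<^sup>2(A,\<tau>)\<close> is the type \<open>'h\<close> together with the embedding \<open>\<eta>\<close> of \<open>A \<inter> L\<^sup>2(A,\<tau>)\<close>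
  into it.  By polarisation the norm condition says that \<open>cinner (\<eta> a) (\<eta> b) = \<tau> (star a * b)\<close>
  for the linear extension of \<open>\<tau>\<close>, so this data is determined up to a unique unitary.\<close>

locale gns_space = faithful_semifinite_trace \<tau>
  for \<tau> :: "'a::cstar_algebra \<Rightarrow> ennreal" +
  fixes \<eta> :: "'a \<Rightarrow> 'h::complex_hilbert_space"
  assumes gns_add: "a \<in> sq_integrable \<tau> \<Longrightarrow> b \<in> sq_integrable \<tau> \<Longrightarrow> \<eta> (a + b) = \<eta> a + \<eta> b"
    and gns_scaleC: "a \<in> sq_integrable \<tau> \<Longrightarrow> \<eta> (c *\<^sub>C a) = c *\<^sub>C \<eta> a"
    and gns_norm: "a \<in> sq_integrable \<tau> \<Longrightarrow> ennreal ((norm (\<eta> a))\<^sup>2) = \<tau> (star a * a)"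
    and gns_dense: "closure (\<eta> ` sq_integrable \<tau>) = UNIV"

definition left_mult ::
  "('a::cstar_algebra \<Rightarrow> ennreal) \<Rightarrow> ('a \<Rightarrow> 'h::complex_hilbert_space) \<Rightarrow> 'a \<Rightarrow> 'h \<Rightarrow>\<^sub>L 'h" where
  "left_mult \<tau> \<eta> a = (THE T. \<forall>b\<in>sq_integrable \<tau>. blinfun_apply T (\<eta> b) = \<eta> (a * b))"

definition vn_algebra ::
  "('a::cstar_algebra \<Rightarrow> ennreal) \<Rightarrow> ('a \<Rightarrow> 'h::complex_hilbert_space) \<Rightarrow> ('h \<Rightarrow>\<^sub>L 'h) set" where
  "vn_algebra \<tau> \<eta> = commutant (commutant (range (left_mult \<tau> \<eta>)))"

definition conj_J ::
  "('a::cstar_algebra \<Rightarrow> ennreal) \<Rightarrow> ('a \<Rightarrow> 'h::complex_hilbert_space) \<Rightarrow> 'h \<Rightarrow> 'h" where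
  "conj_J \<tau> \<eta> = (THE j.
     (\<forall>\<xi> \<zeta>. j (\<xi> + \<zeta>) = j \<xi> + j \<zeta>) \<and> (\<forall>c \<xi>. j (c *\<^sub>C \<xi>) = cnj c *\<^sub>C j \<xi>) \<and>
     (\<forall>\<xi> \<zeta>. cinner (j \<xi>) (j \<zeta>) = cinner \<zeta> \<xi>) \<and> (\<forall>\<xi>. j (j \<xi>) = \<xi>) \<and>
     (\<forall>a\<in>sq_integrable \<tau>. j (\<eta> a) = \<eta> (star a)))"

definition L2_pos ::
  "('a::cstar_algebra \<Rightarrow> ennreal) \<Rightarrow> ('a \<Rightarrow> 'h::complex_hilbert_space) \<Rightarrow> 'h set" where
  "L2_pos \<tau> \<eta> = closure (\<eta> ` (pos_cone \<inter> sq_integrable \<tau>))"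

definition vn_pos ::
  "('a::cstar_algebra \<Rightarrow> ennreal) \<Rightarrow> ('a \<Rightarrow> 'h::complex_hilbert_space) \<Rightarrow> ('h \<Rightarrow>\<^sub>L 'h) set" where
  "vn_pos \<tau> \<eta> = {x \<in> vn_algebra \<tau> \<eta>. positive_op x}"

text \<open>The normal extension of the trace to \<open>\<M>\<close>; it is determined by these conditions.  In
  \<open>normal\<close>, \<open>x\<close> is the supremum of the upward directed set \<open>D\<close>.\<close>

locale normal_trace_extension = gns_space \<tau> \<eta>
  for \<tau> :: "'a::cstar_algebra \<Rightarrow> ennreal" and \<eta> :: "'a \<Rightarrow> 'h::complex_hilbert_space" +
  fixes \<tau>M :: "('h \<Rightarrow>\<^sub>L 'h) \<Rightarrow> ennreal"
  assumes traceM_add: "x \<in> vn_pos \<tau> \<eta> \<Longrightarrow> y \<in> vn_pos \<tau> \<eta> \<Longrightarrow> \<tau>M (x + y) = \<tau>M x + \<tau>M y"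
    and traceM_scale: "x \<in> vn_pos \<tau> \<eta> \<Longrightarrow> 0 \<le> r \<Longrightarrow> \<tau>M (r *\<^sub>R x) = ennreal r * \<tau>M x"
    and traceM_tracial: "x \<in> vn_algebra \<tau> \<eta> \<Longrightarrow> \<tau>M (adj x o\<^sub>L x) = \<tau>M (x o\<^sub>L adj x)"
    and normal: "D \<subseteq> vn_pos \<tau> \<eta> \<Longrightarrow> D \<noteq> {} \<Longrightarrow>
      (\<forall>y\<in>D. \<forall>z\<in>D. \<exists>w\<in>D. op_le y w \<and> op_le z w) \<Longrightarrow>
      x \<in> vn_pos \<tau> \<eta> \<Longrightarrow> (\<forall>y\<in>D. op_le y x) \<Longrightarrow>
      (\<forall>z\<in>vn_pos \<tau> \<eta>. (\<forall>y\<in>D. op_le y z) \<longrightarrow> op_le x z) \<Longrightarrow>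
      \<tau>M x = (SUP y\<in>D. \<tau>M y)"
    and extends: "a \<in> pos_cone \<Longrightarrow> \<tau>M (left_mult \<tau> \<eta> a) = \<tau> a"

text \<open>The identification of an operator \<open>x \<in> \<M>\<close> with \<open>\<tau>(x\<^sup>*x) < \<infinity>\<close> with a vector \<open>\<xi>\<close> of \<open>L\<^sup>2(A,\<tau>)\<close>:
  one sequence in \<open>A \<inter> L\<^sup>2(A,\<tau>)\<close> converges to \<open>x\<close> for the norm \<open>\<tau>(y\<^sup>*y)\<^sup>1\<^sup>/\<^sup>2\<close> and to \<open>\<xi>\<close> in
  \<open>L\<^sup>2(A,\<tau>)\<close>.  The vector is unique.\<close>

definition op_represents ::
  "('a::cstar_algebra \<Rightarrow> ennreal) \<Rightarrow> ('a \<Rightarrow> 'h::complex_hilbert_space) \<Rightarrow> (('h \<Rightarrow>\<^sub>L 'h) \<Rightarrow> ennreal)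
    \<Rightarrow> ('h \<Rightarrow>\<^sub>L 'h) \<Rightarrow> 'h \<Rightarrow> bool" where
  "op_represents \<tau> \<eta> \<tau>M x \<xi> \<longleftrightarrow>
     x \<in> vn_algebra \<tau> \<eta> \<and> \<tau>M (adj x o\<^sub>L x) < \<infinity> \<and>
     (\<exists>a. (\<forall>k::nat. a k \<in> sq_integrable \<tau>) \<and> (\<lambda>k. \<eta> (a k)) \<longlonglongrightarrow> \<xi> \<and>
        (\<lambda>k. \<tau>M (adj (x - left_mult \<tau> \<eta> (a k)) o\<^sub>L (x - left_mult \<tau> \<eta> (a k)))) \<longlonglongrightarrow> 0)"

definition op_vec ::
  "('a::cstar_algebra \<Rightarrow> ennreal) \<Rightarrow> ('a \<Rightarrow> 'h::complex_hilbert_space) \<Rightarrow> (('h \<Rightarrow>\<^sub>L 'h) \<Rightarrow> ennreal)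
    \<Rightarrow> ('h \<Rightarrow>\<^sub>L 'h) \<Rightarrow> 'h" where
  "op_vec \<tau> \<eta> \<tau>M x = (THE \<xi>. op_represents \<tau> \<eta> \<tau>M x \<xi>)"


section \<open>The unit contraction\<close>

definition nearest :: "('v \<Rightarrow> 'v \<Rightarrow> real) \<Rightarrow> 'v set \<Rightarrow> 'v \<Rightarrow> 'v" where
  "nearest d K x = (THE p. p \<in> K \<and> (\<forall>k\<in>K. d x p \<le> d x k))"

definition below_one ::
  "('a::cstar_algebra \<Rightarrow> ennreal) \<Rightarrow> ('a \<Rightarrow> 'h::complex_hilbert_space) \<Rightarrow> 'h set" where
  "below_one \<tau> \<eta> = closure (\<eta> `
     {a \<in> sq_integrable \<tau>. star a = a \<and> op_le (left_mult \<tau> \<eta> a) id_blinfun})"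

definition wedge_one ::
  "('a::cstar_algebra \<Rightarrow> ennreal) \<Rightarrow> ('a \<Rightarrow> 'h::complex_hilbert_space) \<Rightarrow> 'h \<Rightarrow> 'h" where
  "wedge_one \<tau> \<eta> = nearest dist (below_one \<tau> \<eta>)"

text \<open>The same over \<open>\<bbbM>\<^sub>n(A)\<close> with the trace \<open>\<tau> \<otimes> tr\<^sub>n\<close>, whose GNS space is \<open>\<bbbM>\<^sub>n(L\<^sup>2(A,\<tau>))\<close>.  An \<open>n \<times> n\<close>
  matrix is a function of two indices that vanishes outside \<open>{..<n} \<times> {..<n}\<close>.\<close>

definition mats :: "nat \<Rightarrow> 'v::zero set \<Rightarrow> (nat \<Rightarrow> nat \<Rightarrow> 'v) set" where
  "mats n S = {X. \<forall>i j. (i < n \<and> j < n \<longrightarrow> X i j \<in> S) \<and> (\<not> (i < n \<and> j < n) \<longrightarrow> X i j = 0)}"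

definition mat_inner ::
  "nat \<Rightarrow> (nat \<Rightarrow> nat \<Rightarrow> 'h::complex_hilbert_space) \<Rightarrow> (nat \<Rightarrow> nat \<Rightarrow> 'h) \<Rightarrow> complex" where
  "mat_inner n X Y = (\<Sum>i<n. \<Sum>j<n. cinner (X i j) (Y i j)) / of_nat n"

definition mat_dist ::
  "nat \<Rightarrow> (nat \<Rightarrow> nat \<Rightarrow> 'h::complex_hilbert_space) \<Rightarrow> (nat \<Rightarrow> nat \<Rightarrow> 'h) \<Rightarrow> real" where
  "mat_dist n X Y =
     sqrt (Re (mat_inner n (\<lambda>i j. X i j - Y i j) (\<lambda>i j. X i j - Y i j)))"

definition mat_closure ::
  "nat \<Rightarrow> (nat \<Rightarrow> nat \<Rightarrow> 'h::complex_hilbert_space) set \<Rightarrow> (nat \<Rightarrow> nat \<Rightarrow> 'h) set" where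
  "mat_closure n K = {X \<in> mats n UNIV. \<forall>e>0. \<exists>Y\<in>K. mat_dist n X Y < e}"

definition mat_left_mult ::
  "('a::cstar_algebra \<Rightarrow> ennreal) \<Rightarrow> ('a \<Rightarrow> 'h::complex_hilbert_space) \<Rightarrow> nat
    \<Rightarrow> (nat \<Rightarrow> nat \<Rightarrow> 'a) \<Rightarrow> (nat \<Rightarrow> nat \<Rightarrow> 'h) \<Rightarrow> nat \<Rightarrow> nat \<Rightarrow> 'h" where
  "mat_left_mult \<tau> \<eta> n a X = (\<lambda>i j. \<Sum>k<n. blinfun_apply (left_mult \<tau> \<eta> (a i k)) (X k j))"

definition mat_J ::
  "('a::cstar_algebra \<Rightarrow> ennreal) \<Rightarrow> ('a \<Rightarrow> 'h::complex_hilbert_space)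
    \<Rightarrow> (nat \<Rightarrow> nat \<Rightarrow> 'h) \<Rightarrow> nat \<Rightarrow> nat \<Rightarrow> 'h" where
  "mat_J \<tau> \<eta> X = (\<lambda>i j. conj_J \<tau> \<eta> (X j i))"

definition mat_below_one ::
  "('a::cstar_algebra \<Rightarrow> ennreal) \<Rightarrow> ('a \<Rightarrow> 'h::complex_hilbert_space) \<Rightarrow> nat
    \<Rightarrow> (nat \<Rightarrow> nat \<Rightarrow> 'h) set" where
  "mat_below_one \<tau> \<eta> n = mat_closure n ((\<lambda>a i j. \<eta> (a i j)) `
     {a \<in> mats n (sq_integrable \<tau>). (\<forall>i j. star (a i j) = a j i) \<and>
        (\<forall>X\<in>mats n UNIV. mat_inner n X X - mat_inner n X (mat_left_mult \<tau> \<eta> n a X) \<in> \<real>\<^sub>\<ge>\<^sub>0)})"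

definition mat_wedge_one ::
  "('a::cstar_algebra \<Rightarrow> ennreal) \<Rightarrow> ('a \<Rightarrow> 'h::complex_hilbert_space) \<Rightarrow> nat
    \<Rightarrow> (nat \<Rightarrow> nat \<Rightarrow> 'h) \<Rightarrow> nat \<Rightarrow> nat \<Rightarrow> 'h" where
  "mat_wedge_one \<tau> \<eta> n = nearest (mat_dist n) (mat_below_one \<tau> \<eta> n)"


section \<open>Dirichlet forms\<close>

definition mat_energy ::
  "('h \<Rightarrow> 'h \<Rightarrow> complex) \<Rightarrow> nat \<Rightarrow> (nat \<Rightarrow> nat \<Rightarrow> 'h) \<Rightarrow> real" where
  "mat_energy E n X = (\<Sum>i<n. \<Sum>j<n. Re (E (X i j) (X i j)))"

definition F_inner ::
  "('h::complex_hilbert_space \<Rightarrow> 'h \<Rightarrow> complex) \<Rightarrow> 'h \<Rightarrow> 'h \<Rightarrow> complex" where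
  "F_inner E \<xi> \<zeta> = E \<xi> \<zeta> + cinner \<xi> \<zeta>"

definition F_norm :: "('h::complex_hilbert_space \<Rightarrow> 'h \<Rightarrow> complex) \<Rightarrow> 'h \<Rightarrow> real" where
  "F_norm E \<xi> = sqrt (Re (F_inner E \<xi> \<xi>))"

text \<open>\<open>\<B> = A \<inter> \<F>\<close>, as a subset of \<open>A\<close>.\<close>

definition form_algebra ::
  "('a::cstar_algebra \<Rightarrow> ennreal) \<Rightarrow> ('a \<Rightarrow> 'h::complex_hilbert_space) \<Rightarrow> 'h set \<Rightarrow> 'a set" where
  "form_algebra \<tau> \<eta> F = {a \<in> sq_integrable \<tau>. \<eta> a \<in> F}"

text \<open>The quadratic form is given by its sesquilinear form \<open>E\<close>, of which only the values on
  \<open>F \<times> F\<close> matter.\<close>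

locale dirichlet_form = normal_trace_extension \<tau> \<eta> \<tau>M
  for \<tau> :: "'a::cstar_algebra \<Rightarrow> ennreal" and \<eta> :: "'a \<Rightarrow> 'h::complex_hilbert_space"
    and \<tau>M :: "('h \<Rightarrow>\<^sub>L 'h) \<Rightarrow> ennreal" +
  fixes E :: "'h \<Rightarrow> 'h \<Rightarrow> complex" and F :: "'h set"
  assumes separable: "\<exists>D::'a set. countable D \<and> closure D = UNIV"
    and domain_subspace: "csubspace F"
    and domain_dense: "closure F = UNIV"
    and form_add: "\<xi> \<in> F \<Longrightarrow> \<zeta> \<in> F \<Longrightarrow> \<theta> \<in> F \<Longrightarrow> E \<xi> (\<zeta> + \<theta>) = E \<xi> \<zeta> + E \<xi> \<theta>"
    and form_scaleC: "\<xi> \<in> F \<Longrightarrow> \<zeta> \<in> F \<Longrightarrow> E \<xi> (c *\<^sub>C \<zeta>) = c * E \<xi> \<zeta>"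
    and form_hermitian: "\<xi> \<in> F \<Longrightarrow> \<zeta> \<in> F \<Longrightarrow> E \<zeta> \<xi> = cnj (E \<xi> \<zeta>)"
    and form_nonneg: "\<xi> \<in> F \<Longrightarrow> 0 \<le> Re (E \<xi> \<xi>)"
    and form_closed: "(\<forall>k::nat. u k \<in> F) \<Longrightarrow> u \<longlonglongrightarrow> \<xi> \<Longrightarrow>
      (\<forall>e>0. \<exists>N. \<forall>k\<ge>N. \<forall>l\<ge>N. Re (E (u k - u l) (u k - u l)) < e) \<Longrightarrow>
      \<xi> \<in> F \<and> (\<lambda>k. Re (E (u k - \<xi>) (u k - \<xi>))) \<longlonglongrightarrow> 0"
    and form_real: "\<xi> \<in> F \<Longrightarrow> conj_J \<tau> \<eta> \<xi> \<in> F \<and>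
      Re (E (conj_J \<tau> \<eta> \<xi>) (conj_J \<tau> \<eta> \<xi>)) = Re (E \<xi> \<xi>)"
    and form_markovian: "\<xi> \<in> F \<Longrightarrow> conj_J \<tau> \<eta> \<xi> = \<xi> \<Longrightarrow> wedge_one \<tau> \<eta> \<xi> \<in> F \<and>
      Re (E (wedge_one \<tau> \<eta> \<xi>) (wedge_one \<tau> \<eta> \<xi>)) \<le> Re (E \<xi> \<xi>)"
    and complete_real: "1 \<le> n \<Longrightarrow> X \<in> mats n F \<Longrightarrow> mat_J \<tau> \<eta> X \<in> mats n F \<and>
      mat_energy E n (mat_J \<tau> \<eta> X) = mat_energy E n X"
    and complete_markovian: "1 \<le> n \<Longrightarrow> X \<in> mats n F \<Longrightarrow> mat_J \<tau> \<eta> X = X \<Longrightarrow>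
      mat_wedge_one \<tau> \<eta> n X \<in> mats n F \<and>
      mat_energy E n (mat_wedge_one \<tau> \<eta> n X) \<le> mat_energy E n X"
    and regular_dense: "closure (form_algebra \<tau> \<eta> F) = UNIV"
    and regular_core: "\<xi> \<in> F \<Longrightarrow> 0 < e \<Longrightarrow> \<exists>b\<in>form_algebra \<tau> \<eta> F. F_norm E (\<xi> - \<eta> b) < e"

text \<open>\<open>\<F> \<inter> \<M>\<close>, as a subset of \<open>\<M>\<close>.\<close>

definition ext_form_algebra ::
  "('a::cstar_algebra \<Rightarrow> ennreal) \<Rightarrow> ('a \<Rightarrow> 'h::complex_hilbert_space) \<Rightarrow> (('h \<Rightarrow>\<^sub>L 'h) \<Rightarrow> ennreal)
    \<Rightarrow> 'h set \<Rightarrow> ('h \<Rightarrow>\<^sub>L 'h) set" where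
  "ext_form_algebra \<tau> \<eta> \<tau>M F = {x. \<exists>\<xi>\<in>F. op_represents \<tau> \<eta> \<tau>M x \<xi>}"

definition fine_algebra ::
  "('a::cstar_algebra \<Rightarrow> ennreal) \<Rightarrow> ('a \<Rightarrow> 'h::complex_hilbert_space) \<Rightarrow> (('h \<Rightarrow>\<^sub>L 'h) \<Rightarrow> ennreal)
    \<Rightarrow> 'h set \<Rightarrow> ('h \<Rightarrow>\<^sub>L 'h) set" where
  "fine_algebra \<tau> \<eta> \<tau>M F = closure (ext_form_algebra \<tau> \<eta> \<tau>M F)"


section \<open>Finite-energy functionals\<close>

definition finite_energy ::
  "('a::cstar_algebra \<Rightarrow> ennreal) \<Rightarrow> ('a \<Rightarrow> 'h::complex_hilbert_space) \<Rightarrow> ('h \<Rightarrow> 'h \<Rightarrow> complex)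
    \<Rightarrow> 'h set \<Rightarrow> ('a \<Rightarrow> complex) \<Rightarrow> bool" where
  "finite_energy \<tau> \<eta> E F \<omega> \<longleftrightarrow> positive_functional \<omega> \<and>
     (\<exists>c\<ge>0. \<forall>b\<in>form_algebra \<tau> \<eta> F. \<eta> b \<in> L2_pos \<tau> \<eta> \<longrightarrow> Re (\<omega> b) \<le> c * F_norm E (\<eta> b))"

definition potential ::
  "('a::cstar_algebra \<Rightarrow> ennreal) \<Rightarrow> ('a \<Rightarrow> 'h::complex_hilbert_space) \<Rightarrow> ('h \<Rightarrow> 'h \<Rightarrow> complex)
    \<Rightarrow> 'h set \<Rightarrow> ('a \<Rightarrow> complex) \<Rightarrow> 'h" where
  "potential \<tau> \<eta> E F \<omega> =
     (THE g. g \<in> F \<and> (\<forall>b\<in>form_algebra \<tau> \<eta> F. \<omega> b = F_inner E g (\<eta> b)))"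

definition omega_tilde ::
  "('a::cstar_algebra \<Rightarrow> ennreal) \<Rightarrow> ('a \<Rightarrow> 'h::complex_hilbert_space) \<Rightarrow> (('h \<Rightarrow>\<^sub>L 'h) \<Rightarrow> ennreal)
    \<Rightarrow> ('h \<Rightarrow> 'h \<Rightarrow> complex) \<Rightarrow> 'h set \<Rightarrow> ('a \<Rightarrow> complex) \<Rightarrow> ('h \<Rightarrow>\<^sub>L 'h) \<Rightarrow> complex" where
  "omega_tilde \<tau> \<eta> \<tau>M E F \<omega> b = F_inner E (potential \<tau> \<eta> E F \<omega>) (op_vec \<tau> \<eta> \<tau>M b)"

text \<open>For a norm closed *-subalgebra \<open>C\<close> of the bounded operators, an element is positive in \<open>C\<close> iff it
  is a positive operator.\<close>

definition positive_functional_on ::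
  "('h::complex_hilbert_space \<Rightarrow>\<^sub>L 'h) set \<Rightarrow> (('h \<Rightarrow>\<^sub>L 'h) \<Rightarrow> complex) \<Rightarrow> bool" where
  "positive_functional_on C \<phi> \<longleftrightarrow>
     (\<forall>x\<in>C. \<forall>y\<in>C. \<phi> (x + y) = \<phi> x + \<phi> y) \<and> (\<forall>c. \<forall>x\<in>C. \<phi> (scaleC_op c x) = c * \<phi> x) \<and>
     (\<exists>K. \<forall>x\<in>C. cmod (\<phi> x) \<le> K * norm x) \<and>
     (\<forall>x\<in>C. positive_op x \<longrightarrow> \<phi> x \<in> \<real>\<^sub>\<ge>\<^sub>0)"

definition dual_norm :: "'v::real_normed_vector set \<Rightarrow> ('v \<Rightarrow> complex) \<Rightarrow> real" where
  "dual_norm C \<phi> = (SUP x\<in>{x\<in>C. norm x \<le> 1}. cmod (\<phi> x))"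

end

theory Submission
  imports Defs
begin

text \<open>Let \<open>W\<close> be the norm of \<open>\<omega>\<close> and \<open>G\<close> its potential.  Everything rests on one inequality: if
  \<open>x \<in> \<F> \<inter> \<M>\<close> is the vector \<open>\<xi>\<close> and \<open>Re (z, x z) \<le> \<parallel>z\<parallel>\<^sup>2\<close> for all \<open>z\<close>, then the real part of the form
  inner product of \<open>G\<close> and \<open>\<xi>\<close> is at most \<open>W\<close> (\<open>potential_pairing_le\<close>).  For a unimodular multiple of
  \<open>x / \<parallel>x\<parallel>\<close> it says that the functional has norm at most \<open>W\<close>, so that it extends to \<open>\<C>\<close>.  For
  approximants of \<open>- x\<close> and \<open>\<plusminus> i x\<close>, where \<open>x \<in> \<C>\<close> is positive, it says that the extension is positive.
  The norm is not smaller than \<open>W\<close>, since \<open>b \<in> \<B>\<close> acts on \<open>L\<^sup>2\<close> with operator norm at most \<open>\<parallel>b\<parallel>\<close>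
  and \<open>\<B>\<close> is dense in \<open>A\<close>.

  The inequality is proved by truncation.  Elements of \<open>\<B>\<close> converge to \<open>\<xi>\<close> in the form norm; let \<open>a\<^sub>n\<close> be
  their self-adjoint parts and \<open>q\<^sub>n = a\<^sub>n - (a\<^sub>n - 1)\<^sub>+\<close>, which is \<open>a\<^sub>n \<and> 1\<close>.  By the Markov property
  \<open>q\<^sub>n \<in> \<B>\<close> stays bounded in the form norm; because of \<open>x \<le> 1\<close> it is not further than \<open>a\<^sub>n\<close> from the limit
  of the \<open>a\<^sub>n\<close> in \<open>L\<^sup>2\<close>; and \<open>\<omega>(q\<^sub>n) \<le> W\<close>, the positive part of \<open>q\<^sub>n\<close> being a contraction.  A sequence that is
  bounded in the form norm and converges in \<open>L\<^sup>2\<close> converges weakly for the form inner product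
  (\<open>half_space_closed_under_bounded_limits\<close>), so the bound passes to the limit.

  Truncation also yields the potential.  For \<open>b = b\<^sup>*\<close> in \<open>\<B>\<close> and \<open>\<epsilon> > 0\<close> write \<open>b = (b - \<epsilon>)\<^sub>+ + b \<and> \<epsilon>\<close>.
  The first summand is positive with form norm at most twice that of \<open>b\<close>, and \<open>\<omega>\<close> of the second is at
  most \<open>\<epsilon> W\<close>.  So finite energy makes \<open>\<omega>\<close> bounded for the form norm on all of \<open>\<B>\<close>, and the Riesz theorem
  applies.

  That \<open>a \<and> 1\<close>, defined as a Hilbert projection, is \<open>a - (a - 1)\<^sub>+\<close>, and that truncation does not increase
  the distance to that limit, both come from \<open>(\<eta>(c\<^sup>2), \<xi>) \<le> \<parallel>\<eta>(c)\<parallel>\<^sup>2\<close> for \<open>c\<^sup>2 = (a - 1)\<^sub>+\<close>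
  (\<open>op_represents_pairing_le\<close>), that is from \<open>\<tau>(c x c) \<le> \<tau>(c\<^sup>2)\<close>.  The elements \<open>c\<close> are produced inside \<open>A\<close> by
  square roots alone, without spectral theory: \<open>truncation_at_one\<close>.\<close>


section \<open>Elementary limits and commutation\<close>

lemma nonneg_squeeze_zero:
  fixes f g :: "nat \<Rightarrow> real"
  assumes "\<And>n. 0 \<le> f n" "\<And>n. f n \<le> g n" "g \<longlonglongrightarrow> 0"
  shows "f \<longlonglongrightarrow> 0"
  using tendsto_sandwich[of "\<lambda>_. 0" f sequentially g 0] assms by simp

lemma ennreal_squeeze_zero:
  fixes f g :: "nat \<Rightarrow> ennreal"
  assumes "\<And>n. f n \<le> g n" "g \<longlonglongrightarrow> 0"
  shows "f \<longlonglongrightarrow> 0"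
  using tendsto_sandwich[of "\<lambda>_. 0" f sequentially g 0] assms by simp

lemma Cauchy_of_square_le:
  fixes u :: "nat \<Rightarrow> 'v::real_normed_vector" and g :: "nat \<Rightarrow> nat \<Rightarrow> real"
  assumes le: "\<And>m n. (norm (u m - u n))\<^sup>2 \<le> g m n"
    and g: "\<And>e. e > 0 \<Longrightarrow> \<exists>N. \<forall>m\<ge>N. \<forall>n\<ge>N. g m n < e"
  shows "Cauchy u"
  unfolding Cauchy_def dist_norm
proof (intro allI impI)
  fix e :: real assume e: "e > 0"
  then obtain N where N: "\<forall>m\<ge>N. \<forall>n\<ge>N. g m n < e\<^sup>2" using g[of "e\<^sup>2"] by auto
  have "norm (u m - u n) < e" if "m \<ge> N" "n \<ge> N" for m n
    using that e N le[of m n] by (intro power2_less_imp_less[of _ e]) (auto intro: le_less_trans)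
  then show "\<exists>N. \<forall>m\<ge>N. \<forall>n\<ge>N. norm (u m - u n) < e" by blast
qed

lemma le_of_le_add_scaled:
  fixes x y C :: real
  assumes "\<And>e. 0 < e \<Longrightarrow> x \<le> y + e * C" and "0 \<le> C"
  shows "x \<le> y"
proof (rule field_le_epsilon)
  fix e :: real assume e: "0 < e"
  have "e / (C + 1) * C \<le> e" using e assms(2) by (simp add: field_simps)
  then show "x \<le> y + e" using assms(1)[of "e / (C + 1)"] e assms(2) by auto
qed

lemma commute_mult:
  fixes z :: "'b::semigroup_mult"
  assumes "z * x = x * z" and "z * y = y * z"
  shows "z * (x * y) = x * y * z"
  by (metis assms mult.assoc)


section \<open>Square roots in Banach algebras\<close>

instance cstar_algebra \<subseteq> banach ..

text \<open>The iteration \<open>y \<mapsto> (x + y\<^sup>2) / 2\<close> from \<open>0\<close>; a fixed point \<open>y\<close> satisfies \<open>(1 - y)\<^sup>2 = 1 - x\<close>, but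
  the iterates make sense without a unit.\<close>

primrec sqrt_iter :: "'b::real_normed_algebra \<Rightarrow> nat \<Rightarrow> 'b" where
  "sqrt_iter x 0 = 0"
| "sqrt_iter x (Suc n) = (1/2) *\<^sub>R (x + sqrt_iter x n * sqrt_iter x n)"

declare sqrt_iter.simps(2) [simp del]
lemmas sqrt_iter_Suc = sqrt_iter.simps(2)

lemma sqrt_iter_commute:
  assumes "z * x = x * z"
  shows "z * sqrt_iter x n = sqrt_iter x n * z"
proof (induction n)
  case (Suc n)
  then show ?case
    using assms commute_mult[OF Suc Suc] by (simp add: sqrt_iter_Suc distrib_left distrib_right)
qed simp

lemma sqrt_iter_real_mono: "0 \<le> sqrt_iter (1::real) n \<and> sqrt_iter (1::real) n \<le> 1 \<and>
   sqrt_iter (1::real) n \<le> sqrt_iter (1::real) (Suc n)"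
proof (induction n)
  case (Suc n)
  let ?t = "sqrt_iter (1::real) n" and ?u = "sqrt_iter (1::real) (Suc n)"
  have u: "0 \<le> ?u" "?u \<le> 1" using Suc mult_le_one[of ?t ?t] by (auto simp: sqrt_iter_Suc)
  have "?t * ?t \<le> ?u * ?u" using Suc u by (intro mult_mono) auto
  then have "?u \<le> sqrt_iter 1 (Suc (Suc n))" by (simp add: sqrt_iter_Suc)
  with u show ?case by blast
qed (simp add: sqrt_iter_Suc)

text \<open>The scalar iteration for \<open>x = 1\<close> majorises the one for \<open>\<parallel>x\<parallel> \<le> 1\<close>: successive differences
  satisfy \<open>y\<^sub>n\<^sub>+\<^sub>2 - y\<^sub>n\<^sub>+\<^sub>1 = (y\<^sub>n\<^sub>+\<^sub>1 - y\<^sub>n) (y\<^sub>n\<^sub>+\<^sub>1 + y\<^sub>n) / 2\<close>, since the iterates commute.  In this way the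
  boundary case \<open>\<parallel>x\<parallel> = 1\<close>, where the iteration is not a strict contraction, is covered.\<close>

lemma sqrt_iter_bounds:
  fixes x :: "'b::real_normed_algebra"
  assumes "norm x \<le> 1"
  shows "norm (sqrt_iter x n) \<le> sqrt_iter 1 n"
    and "norm (sqrt_iter x (Suc n) - sqrt_iter x n) \<le> sqrt_iter 1 (Suc n) - sqrt_iter 1 n"
proof -
  have nb: "norm (sqrt_iter x n) \<le> sqrt_iter 1 n" for n
  proof (induction n)
    case (Suc n)
    have "norm (x + sqrt_iter x n * sqrt_iter x n) \<le> 1 + sqrt_iter 1 n * sqrt_iter 1 n"
      using assms Suc norm_mult_ineq[of "sqrt_iter x n" "sqrt_iter x n"]
        mult_mono[OF Suc Suc] sqrt_iter_real_mono[of n]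
      by (intro norm_triangle_le) (smt (verit) norm_ge_zero)
    then show ?case by (simp add: sqrt_iter_Suc)
  qed simp
  show "norm (sqrt_iter x n) \<le> sqrt_iter 1 n" by (rule nb)
  show "norm (sqrt_iter x (Suc n) - sqrt_iter x n) \<le> sqrt_iter 1 (Suc n) - sqrt_iter 1 n"
  proof (induction n)
    case 0
    then show ?case using assms by (simp add: sqrt_iter_Suc)
  next
    case (Suc n)
    let ?u = "sqrt_iter x (Suc n)" and ?v = "sqrt_iter x n"
    let ?s = "sqrt_iter (1::real) (Suc n)" and ?t = "sqrt_iter (1::real) n"
    have comm: "?u * ?v = ?v * ?u"
      by (intro sqrt_iter_commute sqrt_iter_commute[symmetric]) simp
    have "sqrt_iter x (Suc (Suc n)) - ?u = (1/2) *\<^sub>R (?u * ?u - ?v * ?v)"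
      by (simp only: sqrt_iter_Suc[of x "Suc n"] sqrt_iter_Suc[of x n] scaleR_diff_right
          scaleR_add_right) simp
    also have "?u * ?u - ?v * ?v = (?u - ?v) * (?u + ?v)"
      using comm by (simp only: left_diff_distrib distrib_left) (simp add: algebra_simps)
    finally have eq: "sqrt_iter x (Suc (Suc n)) - ?u = (1/2) *\<^sub>R ((?u - ?v) * (?u + ?v))" .
    have "norm ((?u - ?v) * (?u + ?v)) \<le> (?s - ?t) * (?s + ?t)"
    proof (rule order_trans[OF norm_mult_ineq mult_mono])
      show "norm (?u - ?v) \<le> ?s - ?t" by (rule Suc)
      show "norm (?u + ?v) \<le> ?s + ?t"
        by (rule norm_triangle_le[OF add_mono[OF nb nb]])
      show "0 \<le> ?s - ?t" using sqrt_iter_real_mono[of n] by simp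
    qed simp
    then have "norm (sqrt_iter x (Suc (Suc n)) - ?u) \<le> (1/2) * ((?s - ?t) * (?s + ?t))"
      unfolding eq by simp
    moreover have "(1/2) * ((?s - ?t) * (?s + ?t)) = sqrt_iter 1 (Suc (Suc n)) - ?s"
    proof -
      have *: "(1/2) * ((s - t) * (s + t)) = (1 + s * s) / 2 - (1 + t * t) / 2" for s t :: real
        by (simp add: algebra_simps diff_divide_distrib add_divide_distrib)
      have "(1 + ?s * ?s) / 2 = sqrt_iter 1 (Suc (Suc n))" "(1 + ?t * ?t) / 2 = ?s"
        by (simp_all add: sqrt_iter_Suc[of 1 "Suc n"] sqrt_iter_Suc[of 1 n])
      from trans[OF *[of ?s ?t] arg_cong2[of _ _ _ _ minus, OF this]] show ?thesis .
    qed
    ultimately show ?case by (simp only:)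
  qed
qed

text \<open>The differences of the iterates are dominated by those of a bounded increasing real sequence, so
  the iterates converge.  Properties that define a closed set invariant under the iteration, such as
  being self-adjoint, are inherited by the limit.\<close>

lemma banach_sqrt:
  fixes x :: "'b::{real_normed_algebra,banach}"
  assumes x: "norm x \<le> 1" and S: "closed S" "0 \<in> S" "\<And>y. y \<in> S \<Longrightarrow> (1/2) *\<^sub>R (x + y * y) \<in> S"
  shows "\<exists>y\<in>S. norm y \<le> 1 \<and> y + y = x + y * y \<and> (\<forall>z. z * x = x * z \<longrightarrow> z * y = y * z)"
proof -
  let ?y = "sqrt_iter x" and ?t = "sqrt_iter (1::real)"
  have "summable (\<lambda>n. ?t (Suc n) - ?t n)"
  proof (rule telescope_summable)
    have "incseq ?t" using sqrt_iter_real_mono by (blast intro: incseq_SucI)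
    moreover have "norm (?t n) \<le> 1" for n using sqrt_iter_real_mono[of n] by simp
    ultimately have "convergent ?t"
      by (intro Bseq_mono_convergent[OF BseqI'[of _ 1]]) (auto dest: incseqD)
    then show "?t \<longlonglongrightarrow> lim ?t" by (rule convergent_LIMSEQ_iff[THEN iffD1])
  qed
  then have "summable (\<lambda>n. ?y (Suc n) - ?y n)"
    by (rule summable_comparison_test') (rule sqrt_iter_bounds(2)[OF x])
  then have "convergent (\<lambda>n. \<Sum>k<n. ?y (Suc k) - ?y k)"
    by (rule summable_iff_convergent[THEN iffD1])
  moreover have "(\<lambda>n. \<Sum>k<n. ?y (Suc k) - ?y k) = ?y"
    by (simp only: sum_lessThan_telescope sqrt_iter.simps(1) diff_zero)
  ultimately obtain y where y: "?y \<longlonglongrightarrow> y" unfolding convergent_def by metis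
  have "?y n \<in> S" for n by (induction n) (use S in \<open>auto simp: sqrt_iter_Suc\<close>)
  then have "y \<in> S" using closed_sequentially[OF S(1) _ y] by blast
  moreover have "norm y \<le> 1"
  proof (rule LIMSEQ_le_const2[OF tendsto_norm[OF y]])
    show "\<exists>N. \<forall>n\<ge>N. norm (?y n) \<le> 1"
      using sqrt_iter_bounds(1)[OF x] sqrt_iter_real_mono by (meson order_trans)
  qed
  moreover have "y = (1/2) *\<^sub>R (x + y * y)"
  proof (rule LIMSEQ_unique[OF LIMSEQ_Suc[OF y]])
    show "(\<lambda>n. ?y (Suc n)) \<longlonglongrightarrow> (1/2) *\<^sub>R (x + y * y)"
      unfolding sqrt_iter_Suc by (intro tendsto_intros y)
  qed
  then have "y + y = x + y * y"
    by (metis (no_types) scaleR_half_double scaleR_right_distrib)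
  moreover have "z * y = y * z" if "z * x = x * z" for z
  proof (rule LIMSEQ_unique)
    show "(\<lambda>n. z * ?y n) \<longlonglongrightarrow> z * y" by (intro tendsto_intros y)
    show "(\<lambda>n. z * ?y n) \<longlonglongrightarrow> y * z"
      unfolding sqrt_iter_commute[OF that] by (intro tendsto_intros y)
  qed
  ultimately show ?thesis by blast
qed


section \<open>Self-adjoint elements of a C*-algebra\<close>

lemma scaleR_eq_scaleC: "r *\<^sub>R x = complex_of_real r *\<^sub>C (x::'b::complex_vector)"
  by (simp add: scaleC_of_real)

lemma scaleC_zero_right [simp]: "c *\<^sub>C (0::'b::complex_vector) = 0"
  using scaleC_add_right[of c 0 "0::'b"] by simp

lemma scaleC_zero_left [simp]: "0 *\<^sub>C (x::'b::complex_vector) = 0"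
  using scaleC_add_left[of 0 0 x] by simp

lemma scaleC_one [simp]: "1 *\<^sub>C (x::'b::complex_vector) = x"
  using scaleC_of_real[of 1 x] by simp

lemma scaleC_minus_right: "c *\<^sub>C (- x::'b::complex_vector) = - (c *\<^sub>C x)"
  using scaleC_add_right[of c x "-x"] by (simp add: eq_neg_iff_add_eq_0 add.commute)

lemma scaleC_minus_left: "(- c) *\<^sub>C (x::'b::complex_vector) = - (c *\<^sub>C x)"
  using scaleC_add_left[of c "-c" x] by (simp add: eq_neg_iff_add_eq_0 add.commute)

lemma scaleC_diff_right: "c *\<^sub>C (x - y::'b::complex_vector) = c *\<^sub>C x - c *\<^sub>C y"
  using scaleC_add_right[of c x "-y"] by (simp add: scaleC_minus_right)

lemma scaleC_scaleR: "c *\<^sub>C (r *\<^sub>R x) = r *\<^sub>R (c *\<^sub>C (x::'b::complex_vector))"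
  by (simp add: scaleR_eq_scaleC scaleC_scaleC mult.commute)

lemma star_scaleR: "star (r *\<^sub>R x) = r *\<^sub>R star (x::'a::cstar_algebra)"
  by (simp add: scaleR_eq_scaleC star_scaleC)

lemma star_zero [simp]: "star (0::'a::cstar_algebra) = 0"
  using star_scaleR[of 0 0] by simp

lemma star_minus: "star (- x) = - star (x::'a::cstar_algebra)"
  using star_scaleR[of "-1" x] by simp

lemma star_diff: "star (x - y) = star x - star (y::'a::cstar_algebra)"
  using star_add[of x "-y"] by (simp add: star_minus)

lemma norm_star: "norm (star x) = norm (x::'a::cstar_algebra)"
proof -
  have le: "norm y \<le> norm (star y)" for y :: 'a
  proof -
    have "norm y * norm y \<le> norm (star y) * norm y"
      using cstar_identity[of y] norm_mult_ineq[of "star y" y] by (simp add: power2_eq_square)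
    then show ?thesis by (cases "y = 0") auto
  qed
  from le[of x] le[of "star x"] show ?thesis by (simp add: star_star)
qed

lemma bounded_linear_star: "bounded_linear (star :: 'a::cstar_algebra \<Rightarrow> 'a)"
  by (rule bounded_linear_intro[where K = 1]) (simp_all add: star_add star_scaleR norm_star)

lemma closed_selfadjoint: "closed {x::'a::cstar_algebra. star x = x}"
  using closed_Collect_eq[of star "\<lambda>x::'a. x", OF linear_continuous_on[OF bounded_linear_star]
      continuous_on_id] .

lemma norm_selfadjoint_square: "star x = x \<Longrightarrow> norm (x * x) = (norm (x::'a::cstar_algebra))\<^sup>2"
  using cstar_identity[of x] by simp

lemma star_one [simp]: "star (1::'b::{cstar_algebra,real_normed_algebra_1}) = 1"
  using star_mult[of "star 1" "1::'b"] by (simp add: star_star)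

lemma selfadjoint_sqrt:
  fixes s :: "'b::{cstar_algebra,real_normed_algebra_1}"
  assumes "star s = s" and "norm (1 - s) \<le> 1"
  shows "\<exists>r. star r = r \<and> r * r = s \<and> norm (1 - r) \<le> 1 \<and> (\<forall>z. z * s = s * z \<longrightarrow> z * r = r * z)"
proof -
  have "\<exists>y\<in>{x. star x = x}. norm y \<le> 1 \<and> y + y = (1 - s) + y * y \<and>
      (\<forall>z. z * (1 - s) = (1 - s) * z \<longrightarrow> z * y = y * z)"
    by (rule banach_sqrt[OF assms(2) closed_selfadjoint])
      (simp_all add: star_scaleR star_add star_diff star_mult assms(1))
  then obtain y where y: "star y = y" "norm y \<le> 1" "y + y = (1 - s) + y * y"
    and comm: "\<And>z. z * (1 - s) = (1 - s) * z \<Longrightarrow> z * y = y * z"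
    by blast
  have "(1 - y) * (1 - y) = s" using y(3) by (simp add: algebra_simps)
  moreover have "z * (1 - y) = (1 - y) * z" if "z * s = s * z" for z
  proof -
    have "z * (1 - s) = (1 - s) * z" by (simp add: left_diff_distrib right_diff_distrib that)
    from comm[OF this] show ?thesis by (simp add: left_diff_distrib right_diff_distrib)
  qed
  moreover have "star (1 - y) = 1 - y" "norm (1 - (1 - y)) \<le> 1" by (simp_all add: star_diff y(1,2))
  ultimately show ?thesis by blast
qed

text \<open>The element \<open>u = a + i b\<close> satisfies \<open>u\<^sup>* u = 1\<close>, so it has norm \<open>1\<close>, and \<open>a = (u + u\<^sup>*) / 2\<close>.\<close>

lemma norm_le_one_of_squares_sum_one:
  fixes a b :: "'b::{cstar_algebra,real_normed_algebra_1}"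
  assumes sa: "star a = a" "star b = b" and comm: "a * b = b * a" and sum: "a * a + b * b = 1"
  shows "norm a \<le> 1"
proof -
  define u where "u = a + \<i> *\<^sub>C b"
  have su: "star u = a - \<i> *\<^sub>C b"
    by (simp add: u_def star_add star_scaleC sa scaleC_minus_left)
  have ii: "\<i> *\<^sub>C \<i> *\<^sub>C x = - x" for x :: 'b
    using scaleC_of_real[of "-1" x] by (simp add: scaleC_scaleC)
  have "star u * u = a * a + \<i> *\<^sub>C (a * b) - \<i> *\<^sub>C (b * a) - \<i> *\<^sub>C \<i> *\<^sub>C (b * b)"
    unfolding su unfolding u_def
    by (simp add: algebra_simps scaleC_mult_left scaleC_mult_right scaleC_add_right scaleC_diff_right)
  also have "\<dots> = 1" using sum comm by (simp add: ii)
  finally have "(norm u)\<^sup>2 = 1" using cstar_identity[of u] by simp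
  then have "norm u = 1" by (simp add: power2_eq_1_iff) (smt (verit) norm_ge_zero)
  have "norm a = norm ((1/2) *\<^sub>R (a + a))" by simp
  also have "a + a = u + star u" unfolding su by (simp add: u_def)
  also have "norm ((1/2) *\<^sub>R (u + star u)) \<le> (1/2) * (norm u + norm (star u))"
    by (simp add: norm_triangle_ineq)
  finally show ?thesis using \<open>norm u = 1\<close> by (simp add: norm_star)
qed

text \<open>Write \<open>1 - m\<^sup>2 = s\<^sup>2\<close>; then \<open>s\<^sup>2 + m\<^sup>2 = 1\<close> forces \<open>\<parallel>s\<parallel> \<le> 1\<close>.\<close>

lemma norm_one_minus_square_le:
  fixes m :: "'b::{cstar_algebra,real_normed_algebra_1}"
  assumes m: "star m = m" "norm m \<le> 1"
  shows "norm (1 - m * m) \<le> 1"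
proof -
  have "norm (1 - (1 - m * m)) \<le> 1"
    using m norm_mult_ineq[of m m] mult_le_one[of "norm m" "norm m"] by simp
  moreover have "star (1 - m * m) = 1 - m * m" by (simp add: star_diff star_mult m)
  ultimately obtain s where s: "star s = s" "s * s = 1 - m * m"
    and comm: "\<And>z. z * (1 - m * m) = (1 - m * m) * z \<Longrightarrow> z * s = s * z"
    using selfadjoint_sqrt[of "1 - m * m"] by blast
  have "m * s = s * m" by (rule comm) (simp add: algebra_simps)
  then have "norm s \<le> 1"
    using norm_le_one_of_squares_sum_one[of s m] s m by simp
  then show ?thesis
    using s norm_mult_ineq[of s s] mult_le_one[of "norm s" "norm s"] by simp
qed

lemma norm_selfadjoint_power:
  fixes x :: "'b::{cstar_algebra,real_normed_algebra_1}"
  assumes "star x = x"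
  shows "star (x ^ n) = x ^ n" and "norm (x ^ 2 ^ k) = norm x ^ 2 ^ k"
proof -
  show sa: "star (x ^ n) = x ^ n" for n
    by (induction n) (simp_all add: star_mult assms power_commutes)
  show "norm (x ^ 2 ^ k) = norm x ^ 2 ^ k"
  proof (induction k)
    case (Suc k)
    have "x ^ 2 ^ Suc k = x ^ 2 ^ k * x ^ 2 ^ k" by (simp add: mult_2 power_add)
    then show ?case
      using norm_selfadjoint_square[OF sa] Suc by (simp add: mult_2 power_add power2_eq_square)
  qed simp
qed

text \<open>If \<open>t = 1 + e\<close> with \<open>e > 0\<close>, squaring Bernoulli's inequality makes the powers grow at least like
  the square of the exponent.\<close>

lemma linear_growth_imp_le_one:
  fixes t C :: real
  assumes "0 \<le> t" "\<And>k. t ^ 2 ^ k \<le> 1 + 2 ^ k * C"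
  shows "t \<le> 1"
proof (rule ccontr)
  assume "\<not> t \<le> 1"
  define e where "e = t - 1"
  have e: "e > 0" using \<open>\<not> t \<le> 1\<close> by (simp add: e_def)
  have "2 ^ k * (e * e) \<le> 2 * C" for k
  proof -
    have "1 + 2 ^ k * e \<le> t ^ 2 ^ k"
      using Bernoulli_inequality[of e "2 ^ k"] e by (simp add: e_def)
    then have "(1 + 2 ^ k * e) * (1 + 2 ^ k * e) \<le> t ^ 2 ^ k * t ^ 2 ^ k"
      using e assms(1) by (intro mult_mono) auto
    also have "t ^ 2 ^ k * t ^ 2 ^ k = t ^ 2 ^ Suc k" by (simp only: power_add[symmetric] power_Suc mult_2)
    also have "\<dots> \<le> 1 + 2 ^ Suc k * C" by (rule assms(2))
    finally have "(1 + 2 ^ k * e) * (1 + 2 ^ k * e) \<le> 1 + 2 ^ Suc k * C" .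
    moreover have "(1 + 2 ^ k * e) * (1 + 2 ^ k * e) = 1 + 2 * (2 ^ k * e) + 2 ^ k * (2 ^ k * (e * e))"
      by (simp add: algebra_simps)
    moreover have "2 ^ k * e \<ge> 0" using e by simp
    moreover have "2 ^ Suc k * C = 2 ^ k * (2 * C)" by simp
    ultimately have "2 ^ k * (2 ^ k * (e * e)) \<le> 2 ^ k * (2 * C)" by linarith
    then show ?thesis by (rule mult_left_le_imp_le) simp
  qed
  then have "2 ^ k \<le> 2 * C / (e * e)" for k using e by (simp add: pos_le_divide_eq)
  moreover obtain k where "2 * C / (e * e) < 2 ^ k" using real_arch_pow[of 2] by auto
  ultimately show False by (meson not_less)
qed

text \<open>For self-adjoint \<open>h\<close>, \<open>\<parallel>1 - h\<parallel> \<le> 1\<close> amounts to \<open>0 \<le> h \<le> 2\<close>, so the claim is that a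
  summand of an orthogonal decomposition of a positive element is positive.  From \<open>p q = 0\<close> one gets
  \<open>(1 - p)\<^sup>k = 1 - p \<Sum>\<^sub>j\<^sub><\<^sub>k (1 - p - q)\<^sup>j\<close>, whose norm grows at most linearly in \<open>k\<close>, while the norm of the
  \<open>2\<^sup>l\<close>-th power of a self-adjoint element is the power of its norm.\<close>

lemma norm_one_minus_orthogonal_summand:
  fixes p q :: "'b::{cstar_algebra,real_normed_algebra_1}"
  assumes p: "star p = p" and pq: "p * q = 0" and pq1: "norm (1 - (p + q)) \<le> 1"
  shows "norm (1 - p) \<le> 1"
proof -
  let ?g = "\<lambda>k. \<Sum>j<k. (1 - (p + q)) ^ j"
  have *: "p * (1 - (p + q)) = (1 - p) * p" by (simp add: algebra_simps pq)
  have "(1 - p) ^ k = 1 - p * ?g k" for k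
  proof (induction k)
    case (Suc k)
    have pk: "p * (1 - (p + q)) ^ k = (1 - p) ^ k * p" for k
    proof (induction k)
      case (Suc k)
      have "p * (1 - (p + q)) ^ Suc k = (1 - p) * (p * (1 - (p + q)) ^ k)"
        by (simp only: power_Suc mult.assoc[symmetric] *)
      also have "\<dots> = (1 - p) ^ Suc k * p" by (simp only: Suc power_Suc mult.assoc)
      finally show ?case .
    qed simp
    have "(1 - p) ^ Suc k = (1 - p) ^ k - (1 - p) ^ k * p"
      by (simp only: power_Suc2 right_diff_distrib mult_1_right)
    also have "\<dots> = 1 - p * ?g (Suc k)"
      unfolding pk[symmetric] by (simp add: Suc distrib_left)
    finally show ?case .
  qed simp
  moreover have "norm (?g k) \<le> real k" for k
  proof -
    have "norm (?g k) \<le> (\<Sum>j<k. 1)"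
    proof (rule sum_norm_le)
      fix j
      show "norm ((1 - (p + q)) ^ j) \<le> 1"
        using norm_power_ineq[of "1 - (p + q)" j] power_le_one[OF norm_ge_zero pq1, of j] by linarith
    qed
    then show ?thesis by simp
  qed
  ultimately have bound: "norm ((1 - p) ^ k) \<le> 1 + real k * norm p" for k
  proof -
    have "norm ((1 - p) ^ k) \<le> norm (1::'b) + norm (p * ?g k)"
      using \<open>(1 - p) ^ k = 1 - p * ?g k\<close> norm_triangle_ineq4 by metis
    also have "norm (p * ?g k) \<le> norm p * real k"
      using \<open>norm (?g k) \<le> real k\<close> norm_mult_ineq by (metis mult_left_mono norm_ge_zero order_trans)
    finally show ?thesis by (simp add: mult.commute)
  qed
  have "star (1 - p) = 1 - p" by (simp add: star_diff p)
  from norm_selfadjoint_power(2)[OF this] show ?thesis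
    using bound[of "2 ^ _"] by (intro linear_growth_imp_le_one[of _ "norm p"]) auto
qed

text \<open>With \<open>n = \<bar>m\<bar>\<close>, the square root of \<open>m\<^sup>2\<close>, the positive and negative parts are \<open>(n \<plusminus> m) / 2\<close>.
  They are orthogonal with sum \<open>n\<close>, hence each has a square root, \<open>c\<close> or \<open>d\<close>.\<close>

lemma positive_negative_parts_unital:
  fixes m :: "'b::{cstar_algebra,real_normed_algebra_1}"
  assumes "star m = m"
  shows "\<exists>c d. star c = c \<and> star d = d \<and> c * c - d * d = m \<and> c * d = 0 \<and> d * c = 0 \<and>
    (\<forall>z. z * m = m * z \<longrightarrow> z * c = c * z \<and> z * d = d * z)"
proof -
  define r where "r = norm m + 1"
  have r: "r > 0" unfolding r_def by (smt (verit) norm_ge_zero)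
  \<comment> \<open>the square roots above need norm at most \<open>1\<close>\<close>
  define m' where "m' = inverse r *\<^sub>R m"
  have m': "star m' = m'" "norm m' \<le> 1" "r *\<^sub>R m' = m"
    using assms r by (auto simp: m'_def star_scaleR r_def field_simps)
  have "star (m' * m') = m' * m'" by (simp add: star_mult m')
  then obtain n where n: "star n = n" "n * n = m' * m'" "norm (1 - n) \<le> 1"
    and ncomm: "\<And>z. z * (m' * m') = (m' * m') * z \<Longrightarrow> z * n = n * z"
    using selfadjoint_sqrt[of "m' * m'"] norm_one_minus_square_le[OF m'(1,2)] by blast
  have nm: "m' * n = n * m'" by (rule ncomm) (simp add: mult.assoc)
  define p q where "p = (1/2) *\<^sub>R (n + m')" and "q = (1/2) *\<^sub>R (n - m')"
  have sa: "star p = p" "star q = q"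
    unfolding p_def q_def by (simp_all add: star_scaleR star_add star_diff n m')
  have pq0: "p * q = 0" "q * p = 0"
    unfolding p_def q_def using n(2) nm by (simp_all add: algebra_simps)
  have pqn: "p + q = n" "q + p = n" and pqm: "p - q = m'"
    unfolding p_def q_def by (simp_all add: algebra_simps flip: scaleR_add_left)
  obtain c where c: "star c = c" "c * c = p" and cc: "\<And>z. z * p = p * z \<Longrightarrow> z * c = c * z"
    using selfadjoint_sqrt[OF sa(1) norm_one_minus_orthogonal_summand[OF sa(1) pq0(1)]] n(3)
    unfolding pqn by blast
  obtain d where d: "star d = d" "d * d = q" and dc: "\<And>z. z * q = q * z \<Longrightarrow> z * d = d * z"
    using selfadjoint_sqrt[OF sa(2) norm_one_minus_orthogonal_summand[OF sa(2) pq0(2)]] n(3)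
    unfolding pqn by blast
  have "q * c = c * q" by (rule cc) (simp add: pq0)
  then have cd: "c * d = d * c" by (intro dc) (rule sym)
  have "star (c * d) * (c * d) = d * d * (c * c)"
  proof -
    have "c * (c * d) = d * (c * c)" by (metis cd mult.assoc)
    then show ?thesis by (simp add: star_mult c(1) d(1) mult.assoc)
  qed
  then have "(norm (c * d))\<^sup>2 = 0" using cstar_identity[of "c * d"] by (simp add: c d pq0)
  then have cd0: "c * d = 0" by simp
  have comm: "z * c = c * z \<and> z * d = d * z" if "z * m = m * z" for z
  proof -
    have zm: "z * m' = m' * z" using that by (simp add: m'_def)
    have zn: "z * n = n * z" by (rule ncomm[OF commute_mult[OF zm zm]])
    show ?thesis
      by (intro conjI cc dc) (simp_all add: p_def q_def algebra_simps zm zn)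
  qed
  let ?c = "sqrt r *\<^sub>R c" and ?d = "sqrt r *\<^sub>R d"
  have "?c * ?c - ?d * ?d = r *\<^sub>R (p - q)" using r by (simp add: c d scaleR_diff_right)
  also have "\<dots> = m" using pqm m'(3) by simp
  finally have "?c * ?c - ?d * ?d = m" .
  moreover have "star ?c = ?c" "star ?d = ?d" by (simp_all add: star_scaleR c(1) d(1))
  moreover have "?c * ?d = 0" "?d * ?c = 0" using cd cd0 by simp_all
  moreover have "z * ?c = ?c * z \<and> z * ?d = ?d * z" if "z * m = m * z" for z
    using comm[OF that] by simp
  ultimately show ?thesis by blast
qed


section \<open>The unitization of a C*-algebra\<close>

text \<open>Square roots and positive parts of \<open>b - 1\<close> are taken in \<open>\<complex> \<oplus> A\<close>; the scalar part then tells which of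
  the resulting elements lie in \<open>A\<close>.\<close>

typedef 'a unitization = "UNIV :: (complex \<times> 'a) set"
  morphisms unitization_rep Unitization by auto

setup_lifting type_definition_unitization

lift_definition scalar_part :: "'a unitization \<Rightarrow> complex" is fst .
lift_definition algebra_part :: "'a unitization \<Rightarrow> 'a" is snd .
lift_definition emb :: "'a::zero \<Rightarrow> 'a unitization" is "\<lambda>a. (0, a)" .

lemma unitization_eq_iff:
  "u = v \<longleftrightarrow> scalar_part u = scalar_part v \<and> algebra_part u = algebra_part v"
  by transfer (auto simp: prod_eq_iff)

lemma emb_parts [simp]: "scalar_part (emb a) = 0" "algebra_part (emb a) = a"
  by (transfer, simp)+

definition left_action :: "'a::cstar_algebra unitization \<Rightarrow> 'a \<Rightarrow> 'a" where
  "left_action u x = scalar_part u *\<^sub>C x + algebra_part u * x"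

instantiation unitization :: (cstar_algebra)
  "{complex_vector, times, one}"
begin

lift_definition zero_unitization :: "'a unitization" is "(0, 0)" .
lift_definition one_unitization :: "'a unitization" is "(1, 0)" .
lift_definition plus_unitization :: "'a unitization \<Rightarrow> 'a unitization \<Rightarrow> 'a unitization"
  is "\<lambda>(c, a) (d, b). (c + d, a + b)" .
lift_definition minus_unitization :: "'a unitization \<Rightarrow> 'a unitization \<Rightarrow> 'a unitization"
  is "\<lambda>(c, a) (d, b). (c - d, a - b)" .
lift_definition uminus_unitization :: "'a unitization \<Rightarrow> 'a unitization"
  is "\<lambda>(c, a). (- c, - a)" .
lift_definition scaleR_unitization :: "real \<Rightarrow> 'a unitization \<Rightarrow> 'a unitization"
  is "\<lambda>r (c, a). (r *\<^sub>R c, r *\<^sub>R a)" .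
lift_definition scaleC_unitization :: "complex \<Rightarrow> 'a unitization \<Rightarrow> 'a unitization"
  is "\<lambda>z (c, a). (z * c, z *\<^sub>C a)" .
lift_definition times_unitization :: "'a unitization \<Rightarrow> 'a unitization \<Rightarrow> 'a unitization"
  is "\<lambda>(c, a) (d, b). (c * d, c *\<^sub>C b + d *\<^sub>C a + a * b)" .

lemma scalar_part_simps:
  "scalar_part (0::'a unitization) = 0" "scalar_part (1::'a unitization) = 1"
  "scalar_part (u + v) = scalar_part u + scalar_part v"
  "scalar_part (u - v) = scalar_part u - scalar_part v"
  "scalar_part (- u) = - scalar_part u" "scalar_part (r *\<^sub>R u) = r *\<^sub>R scalar_part u"
  "scalar_part (z *\<^sub>C u) = z * scalar_part u" "scalar_part (u * v) = scalar_part u * scalar_part v"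
  by (transfer, auto)+

lemma algebra_part_simps:
  "algebra_part (0::'a unitization) = 0" "algebra_part (1::'a unitization) = 0"
  "algebra_part (u + v) = algebra_part u + algebra_part v"
  "algebra_part (u - v) = algebra_part u - algebra_part v"
  "algebra_part (- u) = - algebra_part u" "algebra_part (r *\<^sub>R u) = r *\<^sub>R algebra_part u"
  "algebra_part (z *\<^sub>C u) = z *\<^sub>C algebra_part u"
  "algebra_part (u * v) = scalar_part u *\<^sub>C algebra_part v + scalar_part v *\<^sub>C algebra_part u +
     algebra_part u * algebra_part v"
  by (transfer, auto)+

instance
  by standard
    (auto simp: unitization_eq_iff scalar_part_simps algebra_part_simps scaleC_add_right
      scaleC_add_left scaleC_scaleC scaleC_of_real scaleR_add_right scaleR_add_left algebra_simps
      scaleR_conv_of_real)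

end

text \<open>When \<open>A\<close> has a unit \<open>e\<close> already, \<open>1 - e\<close> acts on \<open>A\<close> as zero.  Taking the maximum with the modulus
  of the scalar part keeps the norm definite, and a maximum of two C*-seminorms has the C*-property.\<close>

definition unitization_norm :: "'a::cstar_algebra unitization \<Rightarrow> real" where
  "unitization_norm u = max (cmod (scalar_part u)) (onorm (left_action u))"

lemma left_action_mult: "left_action (u * v) x = left_action u (left_action v x)"
  by (simp add: left_action_def scalar_part_simps algebra_part_simps scaleC_add_right scaleC_scaleC
      scaleC_mult_left scaleC_mult_right distrib_left distrib_right mult.assoc mult.commute add.commute add.left_commute)

lemma left_action_add: "left_action (u + v) x = left_action u x + left_action v x"
  by (simp add: left_action_def scalar_part_simps algebra_part_simps scaleC_add_left distrib_right)

lemma bounded_linear_left_action: "bounded_linear (left_action (u::'a::cstar_algebra unitization))"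
proof (rule bounded_linear_intro)
  show "norm (left_action u x) \<le> norm x * (cmod (scalar_part u) + norm (algebra_part u))" for x
  proof -
    have "norm (left_action u x) \<le> cmod (scalar_part u) * norm x + norm (algebra_part u) * norm x"
      unfolding left_action_def
      by (rule norm_triangle_le) (intro add_mono norm_mult_ineq, simp add: norm_scaleC)
    then show ?thesis by (simp add: algebra_simps)
  qed
qed (simp_all add: left_action_def scaleC_add_right distrib_left scaleC_scaleR scaleR_add_right)

lemma unitization_norm_action_le: "norm (left_action u x) \<le> unitization_norm u * norm (x::'a::cstar_algebra)"
  using onorm[OF bounded_linear_left_action, of u x]
  using mult_right_mono[of "onorm (left_action u)" "unitization_norm u" "norm x"]
  by (simp add: unitization_norm_def)

lemma unitization_norm_le:
  assumes "cmod (scalar_part u) \<le> K" and "\<And>x. norm (left_action u x) \<le> K * norm x"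
  shows "unitization_norm (u::'a::cstar_algebra unitization) \<le> K"
proof -
  have "0 \<le> K" using assms(1) norm_ge_zero order_trans by blast
  then show ?thesis unfolding unitization_norm_def using assms by (simp add: onorm_bound)
qed

text \<open>The action on \<open>a\<^sup>*\<close> recovers \<open>\<parallel>a\<parallel>\<close> because \<open>\<parallel>a a\<^sup>*\<parallel> = \<parallel>a\<parallel>\<^sup>2\<close>.\<close>

lemma unitization_norm_algebra_part:
  "norm (algebra_part u) \<le> cmod (scalar_part u) + unitization_norm (u::'a::cstar_algebra unitization)"
proof (cases "algebra_part u = 0")
  case False
  let ?a = "algebra_part u"
  have "norm ?a * norm ?a = norm (?a * star ?a)"
    using cstar_identity[of "star ?a"] by (simp add: star_star norm_star power2_eq_square)
  also have "?a * star ?a = left_action u (star ?a) - scalar_part u *\<^sub>C star ?a"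
    by (simp add: left_action_def)
  also have "norm \<dots> \<le> unitization_norm u * norm ?a + cmod (scalar_part u) * norm ?a"
    using unitization_norm_action_le[of u "star ?a"]
    by (intro order_trans[OF norm_triangle_ineq4] add_mono) (simp_all add: norm_star norm_scaleC)
  finally have "norm ?a * norm ?a \<le> (cmod (scalar_part u) + unitization_norm u) * norm ?a"
    by (simp add: algebra_simps)
  then show ?thesis using False by simp
qed (simp add: unitization_norm_def add_nonneg_nonneg le_max_iff_disj)

lemma unitization_norm_scalar_part: "cmod (scalar_part u) \<le> unitization_norm (u::'a::cstar_algebra unitization)"
  by (simp add: unitization_norm_def)

lemma unitization_norm_le_sum:
  "unitization_norm (u::'a::cstar_algebra unitization) \<le> cmod (scalar_part u) + norm (algebra_part u)"
proof (rule unitization_norm_le)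
  show "norm (left_action u x) \<le> (cmod (scalar_part u) + norm (algebra_part u)) * norm x" for x
    unfolding left_action_def distrib_right
    by (rule norm_triangle_le) (intro add_mono norm_mult_ineq, simp add: norm_scaleC)
qed simp

lemma left_action_scaleC: "left_action (z *\<^sub>C u) x = z *\<^sub>C left_action u x"
  by (simp add: left_action_def scalar_part_simps algebra_part_simps scaleC_scaleC
      scaleC_add_right scaleC_mult_left)

lemma unitization_norm_scaleC:
  "unitization_norm (z *\<^sub>C u) = cmod z * unitization_norm (u::'a::cstar_algebra unitization)"
proof -
  have le: "unitization_norm (z *\<^sub>C u) \<le> cmod z * unitization_norm u" for z and u :: "'a unitization"
  proof (rule unitization_norm_le)
    show "cmod (scalar_part (z *\<^sub>C u)) \<le> cmod z * unitization_norm u"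
      using unitization_norm_scalar_part[of u] by (simp add: scalar_part_simps norm_mult mult_left_mono)
    show "norm (left_action (z *\<^sub>C u) x) \<le> cmod z * unitization_norm u * norm x" for x
      using mult_left_mono[OF unitization_norm_action_le[of u x], of "cmod z"]
      by (simp add: left_action_scaleC mult.assoc norm_scaleC)
  qed
  show ?thesis
  proof (cases "z = 0")
    case True
    then show ?thesis
      using le[of 0 u] order_trans[OF norm_ge_zero unitization_norm_scalar_part[of "0 *\<^sub>C u"]]
      by (intro antisym) simp_all
  next
    case False
    have "unitization_norm u \<le> inverse (cmod z) * unitization_norm (z *\<^sub>C u)"
      using le[of "inverse z" "z *\<^sub>C u"] False by (simp add: scaleC_scaleC norm_inverse)
    then have "cmod z * unitization_norm u \<le> unitization_norm (z *\<^sub>C u)" using False by (simp add: field_simps)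
    with le[of z u] show ?thesis by simp
  qed
qed

instantiation unitization :: (cstar_algebra) real_normed_algebra_1
begin

definition norm_unitization :: "'a unitization \<Rightarrow> real" where
  "norm_unitization = unitization_norm"
definition sgn_unitization :: "'a unitization \<Rightarrow> 'a unitization" where
  "sgn_unitization u = inverse (norm u) *\<^sub>R u"
definition dist_unitization :: "'a unitization \<Rightarrow> 'a unitization \<Rightarrow> real" where
  "dist_unitization u v = norm (u - v)"
definition uniformity_unitization :: "('a unitization \<times> 'a unitization) filter" where
  "uniformity_unitization = (INF e\<in>{0<..}. principal {(x, y). dist (x::'a unitization) y < e})"
definition open_unitization :: "'a unitization set \<Rightarrow> bool" where
  "open_unitization U \<longleftrightarrow> (\<forall>x\<in>U. \<forall>\<^sub>F (x', y) in uniformity. x' = x \<longrightarrow> y \<in> U)"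

lemmas norm_left_action_le = unitization_norm_action_le[where 'a = 'a, folded norm_unitization_def]
lemmas norm_unitization_le = unitization_norm_le[where 'a = 'a, folded norm_unitization_def]
lemmas norm_algebra_part_le = unitization_norm_algebra_part[where 'a = 'a, folded norm_unitization_def]
lemmas norm_scalar_part_le = unitization_norm_scalar_part[where 'a = 'a, folded norm_unitization_def]
lemmas norm_unitization_le_sum = unitization_norm_le_sum[where 'a = 'a, folded norm_unitization_def]

instance
proof
  fix u v w :: "'a unitization" and r :: real
  show "dist u v = norm (u - v)" by (rule dist_unitization_def)
  show "sgn u = inverse (norm u) *\<^sub>R u" by (rule sgn_unitization_def)
  show "uniformity = (INF e\<in>{0<..}. principal {(x, y). dist (x::'a unitization) y < e})"
    by (rule uniformity_unitization_def)
  show "open U \<longleftrightarrow> (\<forall>x\<in>U. \<forall>\<^sub>F (x', y) in uniformity. x' = x \<longrightarrow> y \<in> U)" for U :: "'a unitization set"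
    by (rule open_unitization_def)
  show "norm u = 0 \<longleftrightarrow> u = 0"
  proof
    assume "norm u = 0"
    with norm_scalar_part_le[of u] norm_algebra_part_le[of u] show "u = 0"
      by (simp add: unitization_eq_iff scalar_part_simps algebra_part_simps)
  next
    assume "u = 0"
    then show "norm u = 0"
      using norm_unitization_le_sum[of u] norm_scalar_part_le[of u]
      by (simp add: scalar_part_simps algebra_part_simps)
  qed
  show "norm (u + v) \<le> norm u + norm v"
  proof (rule norm_unitization_le)
    show "cmod (scalar_part (u + v)) \<le> norm u + norm v"
      using norm_scalar_part_le[of u] norm_scalar_part_le[of v]
        norm_triangle_ineq[of "scalar_part u" "scalar_part v"] by (simp add: scalar_part_simps)
    show "norm (left_action (u + v) x) \<le> (norm u + norm v) * norm x" for x
      unfolding left_action_add distrib_right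
      by (intro norm_triangle_le add_mono norm_left_action_le)
  qed
  show "norm (r *\<^sub>R u) = \<bar>r\<bar> * norm u"
    by (simp add: norm_unitization_def scaleR_eq_scaleC unitization_norm_scaleC)
  show "u * v * w = u * (v * w)" "1 * u = u" "u * 1 = u"
    "(u + v) * w = u * w + v * w" "u * (v + w) = u * v + u * w" "(0::'a unitization) \<noteq> 1"
    "(r *\<^sub>R u) * v = r *\<^sub>R (u * v)" "u * (r *\<^sub>R v) = r *\<^sub>R (u * v)"
    by (auto simp: unitization_eq_iff scalar_part_simps algebra_part_simps scaleC_add_right
        scaleC_add_left scaleC_scaleC scaleR_eq_scaleC scaleC_mult_left scaleC_mult_right
        algebra_simps)
  show "norm (u * v) \<le> norm u * norm v"
  proof (rule norm_unitization_le)
    show "cmod (scalar_part (u * v)) \<le> norm u * norm v"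
      unfolding scalar_part_simps norm_mult
      by (intro mult_mono norm_scalar_part_le order_trans[OF norm_ge_zero norm_scalar_part_le]) simp
    show "norm (left_action (u * v) x) \<le> norm u * norm v * norm x" for x
      unfolding left_action_mult mult.assoc
      by (rule order_trans[OF norm_left_action_le mult_left_mono[OF norm_left_action_le]])
        (rule order_trans[OF norm_ge_zero norm_scalar_part_le])
  qed
  show "norm (1::'a unitization) = 1"
  proof (rule antisym)
    show "norm (1::'a unitization) \<le> 1"
      using norm_unitization_le_sum[of "1::'a unitization"]
      by (simp add: scalar_part_simps algebra_part_simps)
    show "1 \<le> norm (1::'a unitization)"
      using norm_scalar_part_le[of "1::'a unitization"] by (simp add: scalar_part_simps)
  qed
qed

end

instantiation unitization :: (cstar_algebra) cstar_algebra
begin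

lift_definition star_unitization :: "'a unitization \<Rightarrow> 'a unitization"
  is "\<lambda>(c, a). (cnj c, star a)" .

lemma star_parts: "scalar_part (star u) = cnj (scalar_part (u::'a unitization))"
  "algebra_part (star u) = star (algebra_part u)"
  by (transfer, auto)+

instance
proof
  fix u v :: "'a unitization" and z :: complex
  show "(z *\<^sub>C u) * v = z *\<^sub>C (u * v)" "u * (z *\<^sub>C v) = z *\<^sub>C (u * v)" "star (star u) = u"
    "star (u + v) = star u + star v" "star (z *\<^sub>C u) = cnj z *\<^sub>C star u"
    "star (u * v) = star v * star u"
    by (auto simp: unitization_eq_iff scalar_part_simps algebra_part_simps star_parts scaleC_add_right
        scaleC_add_left scaleC_scaleC scaleC_mult_left scaleC_mult_right star_star star_add star_scaleC
        star_mult algebra_simps)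
  show "norm (z *\<^sub>C u) = cmod z * norm u"
    by (simp add: norm_unitization_def unitization_norm_scaleC)
  have star_action: "star x * left_action (star u * u) x = star (left_action u x) * left_action u x"
    for u and x :: 'a
    unfolding left_action_mult
    by (simp add: left_action_def[of "star u"] left_action_def[of u x] star_parts star_add star_scaleC star_mult distrib_left distrib_right
        scaleC_mult_left scaleC_mult_right mult.assoc scaleC_add_right scaleC_scaleC mult.commute[of "cnj _"])
  \<comment> \<open>half of the C*-identity; the other half follows from it, because it makes \<open>star\<close> isometric\<close>
  have sq_le: "norm u * norm u \<le> norm (star u * u)" for u :: "'a unitization"
  proof -
    have "norm u \<le> sqrt (norm (star u * u))"
    proof (rule norm_unitization_le)
      have "(cmod (scalar_part u))\<^sup>2 \<le> norm (star u * u)"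
        using norm_scalar_part_le[of "star u * u"]
        by (simp add: scalar_part_simps star_parts norm_mult power2_eq_square)
      then show "cmod (scalar_part u) \<le> sqrt (norm (star u * u))" by (rule real_le_rsqrt)
      show "norm (left_action u x) \<le> sqrt (norm (star u * u)) * norm x" for x
      proof -
        have "(norm (left_action u x))\<^sup>2 = norm (star x * left_action (star u * u) x)"
          unfolding star_action by (rule cstar_identity[symmetric])
        also have "\<dots> \<le> norm (star u * u) * (norm x)\<^sup>2"
          using norm_mult_ineq[of "star x" "left_action (star u * u) x"]
            mult_left_mono[OF norm_left_action_le[of "star u * u" x] norm_ge_zero[of x]]
          by (simp add: norm_star power2_eq_square mult.left_commute mult.commute)
        finally show ?thesis
          using real_le_rsqrt by (fastforce simp: real_sqrt_mult)
      qed
    qed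
    then have "norm u * norm u \<le> sqrt (norm (star u * u)) * sqrt (norm (star u * u))"
      by (intro mult_mono) auto
    then show ?thesis by simp
  qed
  have "norm u \<le> norm (star u)" for u :: "'a unitization"
  proof -
    have "norm u * norm u \<le> norm (star u) * norm u"
      using sq_le[of u] norm_mult_ineq[of "star u" u] by linarith
    then show ?thesis by (cases "u = 0") auto
  qed
  from this[of u] this[of "star u"] have "norm (star u) = norm u"
    using \<open>star (star u) = u\<close> by simp
  then show "norm (star u * u) = (norm u)\<^sup>2"
    using sq_le[of u] norm_mult_ineq[of "star u" u] by (simp add: power2_eq_square)
next
  fix X :: "nat \<Rightarrow> 'a unitization"
  assume X: "Cauchy X"
  have "bounded_linear (scalar_part :: 'a unitization \<Rightarrow> complex)"
    using norm_scalar_part_le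
    by (intro bounded_linear_intro[where K = 1]) (simp_all add: scalar_part_simps)
  from bounded_linear.Cauchy[OF this X]
  obtain z where z: "(\<lambda>n. scalar_part (X n)) \<longlonglongrightarrow> z"
    using Cauchy_convergent convergent_def by blast
  have "norm (algebra_part u) \<le> norm u * 2" for u :: "'a unitization"
    using norm_algebra_part_le[of u] norm_scalar_part_le[of u] by simp
  then have "bounded_linear (algebra_part :: 'a unitization \<Rightarrow> 'a)"
    by (intro bounded_linear_intro[where K = 2]) (simp_all add: algebra_part_simps)
  from bounded_linear.Cauchy[OF this X]
  obtain a where a: "(\<lambda>n. algebra_part (X n)) \<longlonglongrightarrow> a"
    using Cauchy_convergent convergent_def by blast
  define u where "u = z *\<^sub>C 1 + emb a"
  have u: "scalar_part u = z" "algebra_part u = a"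
    by (simp_all add: u_def scalar_part_simps algebra_part_simps)
  have "(\<lambda>n. cmod (scalar_part (X n) - z) + norm (algebra_part (X n) - a)) \<longlonglongrightarrow> 0 + 0"
    by (intro tendsto_add LIM_zero tendsto_norm_zero z a)
  then have "(\<lambda>n. cmod (scalar_part (X n) - z) + norm (algebra_part (X n) - a)) \<longlonglongrightarrow> 0" by simp
  moreover have "norm (X n - u) \<le> cmod (scalar_part (X n) - z) + norm (algebra_part (X n) - a)" for n
    using norm_unitization_le_sum[of "X n - u"] by (simp add: scalar_part_simps algebra_part_simps u)
  ultimately have "(\<lambda>n. norm (X n - u)) \<longlonglongrightarrow> 0"
    by (intro nonneg_squeeze_zero[where f = "\<lambda>n. norm (X n - u)"] norm_ge_zero)
  then have "X \<longlonglongrightarrow> u" by (rule LIM_zero_cancel[OF tendsto_norm_zero_cancel])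
  then show "convergent X" by (rule convergentI)
qed

end

lemma emb_algebra_part: "scalar_part u = 0 \<Longrightarrow> emb (algebra_part u) = u"
  by (simp add: unitization_eq_iff)

lemma emb_hom:
  "emb (a + b) = emb a + emb (b::'a::cstar_algebra)" "emb (a - b) = emb a - emb b"
  "emb (a * b) = emb a * emb b" "emb (star a) = star (emb a)" "emb 0 = 0"
  by (simp_all add: unitization_eq_iff scalar_part_simps algebra_part_simps star_parts)

lemma emb_eq_iff: "emb a = emb b \<longleftrightarrow> a = b"
  by (simp add: unitization_eq_iff)

lemma norm_emb_ge: "norm a \<le> norm (emb (a::'a::cstar_algebra))"
  using norm_algebra_part_le[of "emb a"] by simp

lemma scalar_part_selfadjoint:
  "star u = u \<Longrightarrow> scalar_part u = of_real (Re (scalar_part (u::'a::cstar_algebra unitization)))"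
  by (metis star_parts(1) complex_is_Real_iff Reals_cnj_iff of_real_Re)


section \<open>Positive parts and truncation inside a C*-algebra\<close>

text \<open>The scalar parts \<open>s\<close>, \<open>t\<close> of the square roots in the unitization are real with \<open>s\<^sup>2 = t\<^sup>2\<close> and
  \<open>s t = 0\<close>, so both roots belong to the algebra.\<close>

lemma positive_negative_parts:
  fixes a :: "'a::cstar_algebra"
  assumes "star a = a"
  shows "\<exists>c d. star c = c \<and> star d = d \<and> a = c * c - d * d \<and> c * d = 0 \<and>
    (\<forall>z. z * emb a = emb a * z \<longrightarrow> z * emb c = emb c * z)"
proof -
  have "star (emb a) = emb a" using assms by (simp flip: emb_hom)
  then obtain c d where c: "star c = c" and d: "star d = d" and cd: "c * c - d * d = emb a" "c * d = 0"
    and comm: "\<And>z. z * emb a = emb a * z \<Longrightarrow> z * c = c * z"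
    using positive_negative_parts_unital[of "emb a"] by blast
  define s t where "s = Re (scalar_part c)" and "t = Re (scalar_part d)"
  have st: "scalar_part c = of_real s" "scalar_part d = of_real t"
    unfolding s_def t_def by (rule scalar_part_selfadjoint[OF c], rule scalar_part_selfadjoint[OF d])
  have "complex_of_real (s * s - t * t) = 0" "complex_of_real (s * t) = 0"
    using arg_cong[OF cd(1), of scalar_part] arg_cong[OF cd(2), of scalar_part]
    by (simp_all add: scalar_part_simps st)
  then have "s * s = t * t" "s * t = 0" unfolding of_real_eq_0_iff by simp_all
  then have "s = 0" "t = 0" by auto
  then have e: "emb (algebra_part c) = c" "emb (algebra_part d) = d"
    by (simp_all add: emb_algebra_part st)
  define c' d' where "c' = algebra_part c" and "d' = algebra_part d"
  have "emb (star c') = emb c'" "emb (star d') = emb d'"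
    "emb a = emb (c' * c' - d' * d')" "emb (c' * d') = emb 0"
    unfolding c'_def d'_def emb_hom e by (simp_all add: c d cd)
  then have "star c' = c'" "star d' = d'" "a = c' * c' - d' * d'" "c' * d' = 0"
    unfolding emb_eq_iff by simp_all
  moreover have "z * emb c' = emb c' * z" if "z * emb a = emb a * z" for z
    using comm[OF that] unfolding c'_def e(1) .
  ultimately show ?thesis by blast
qed

text \<open>Here \<open>c\<^sup>2 = (b - 1)\<^sub>+\<close>, and \<open>q = b - c\<^sup>2\<close> is \<open>b \<and> 1\<close>.  If \<open>d\<^sup>2 = (b - 1)\<^sub>-\<close> then \<open>q = 1 - d\<^sup>2\<close>.  The scalar part of
  \<open>b - 1\<close> is \<open>-1\<close>, which forces scalar part \<open>0\<close> for \<open>c\<close> and \<open>\<plusminus>1\<close> for \<open>d\<close>.  Up to a sign \<open>d = 1 - f\<close> with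
  \<open>f\<close> in the algebra, and \<open>q = 2 f - f\<^sup>2\<close> expresses \<open>1 - q = (1 - f)\<^sup>2 \<ge> 0\<close> without a unit.  Finally
  \<open>q = k\<^sup>2 - l\<^sup>2\<close> is the decomposition of \<open>q\<close> into positive and negative part.\<close>

lemma truncation_at_one:
  fixes b :: "'a::cstar_algebra"
  assumes "star b = b"
  shows "\<exists>c f k l. star c = c \<and> star f = f \<and> star k = k \<and> star l = l \<and> (b - c * c) * c = c \<and>
    b - c * c = f + f - f * f \<and> b - c * c = k * k - l * l \<and> norm (k * k) \<le> 1"
proof -
  have "star (emb b - 1) = emb b - 1" using assms by (simp add: star_diff flip: emb_hom)
  then obtain c d where c: "star c = c" and d: "star d = d"
    and cd: "c * c - d * d = emb b - 1" "d * c = 0"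
    using positive_negative_parts_unital[of "emb b - 1"] by blast
  define s t where "s = Re (scalar_part c)" and "t = Re (scalar_part d)"
  have st: "scalar_part c = of_real s" "scalar_part d = of_real t"
    unfolding s_def t_def by (rule scalar_part_selfadjoint[OF c], rule scalar_part_selfadjoint[OF d])
  have "complex_of_real (s * s - t * t) = of_real (-1)" "complex_of_real (t * s) = 0"
    using arg_cong[OF cd(1), of scalar_part] arg_cong[OF cd(2), of scalar_part]
    by (simp_all add: scalar_part_simps st)
  then have *: "s * s - t * t = -1" "t * s = 0" unfolding of_real_eq_iff of_real_eq_0_iff by simp_all
  have "t \<noteq> 0"
  proof
    assume "t = 0"
    then show False using *(1) zero_le_square[of s] by simp
  qed
  then have "s = 0" using *(2) by simp
  then have t1: "t * t = 1" using * by simp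
  define e where "e = t *\<^sub>R d"
  have ee: "e * e = d * d" using t1 by (simp add: e_def)
  have e: "star e = e" "scalar_part e = 1"
    using t1 by (simp_all add: e_def star_scaleR d scalar_part_simps st scaleR_conv_of_real[of t "complex_of_real t"] flip: of_real_mult)
  define c' f where "c' = algebra_part c" and "f = algebra_part (1 - e)"
  have c': "emb c' = c" and f: "emb f = 1 - e"
    using \<open>s = 0\<close> e unfolding c'_def f_def
    by (simp_all add: emb_algebra_part st scalar_part_simps)
  define q where "q = b - c' * c'"
  have q: "emb q = 1 - d * d"
    using cd(1) unfolding q_def emb_hom c' by (simp add: algebra_simps)
  have "emb (star q) = emb q"
    unfolding q emb_hom by (simp add: star_diff star_mult d)
  then have "star q = q" by (simp add: emb_eq_iff)
  then obtain k l where k: "star k = k" and l: "star l = l" and kl: "q = k * k - l * l" "k * l = 0"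
    and kcomm: "\<And>z. z * emb q = emb q * z \<Longrightarrow> z * emb k = emb k * z"
    using positive_negative_parts[of q] by blast
  have dk: "d * emb k = emb k * d" by (rule kcomm) (simp add: q algebra_simps)
  let ?k = "emb k"
  have "k * k * q = k * k * (k * k)"
  proof -
    have "k * k * (l * l) = k * (k * l) * l" by (simp only: mult.assoc)
    then show ?thesis by (simp add: kl right_diff_distrib)
  qed
  then have kq: "?k * ?k * (1 - d * d) = ?k * ?k * (?k * ?k)"
    unfolding q[symmetric] emb_hom[symmetric] by simp
  have kd2: "(?k * d) * (?k * d) = ?k * ?k * (d * d)"
  proof -
    have "?k * d * (?k * d) = ?k * (d * ?k) * d" by (simp only: mult.assoc)
    then show ?thesis by (simp only: dk mult.assoc)
  qed
  let ?T = "?k * ?k"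
  \<comment> \<open>hence \<open>(2 T - 1)\<^sup>2 + (2 k d)\<^sup>2 = 1\<close> for \<open>T = k\<^sup>2\<close>, which gives \<open>\<parallel>2 T - 1\<parallel> \<le> 1\<close> and so \<open>\<parallel>T\<parallel> \<le> 1\<close>\<close>
  have TT: "?T - ?T * ?T = (?k * d) * (?k * d)"
    unfolding kd2 kq[symmetric] by (simp add: algebra_simps)
  have sk: "star ?k = ?k" using k by (simp flip: emb_hom)
  have "norm (?T + ?T - 1) \<le> 1"
  proof (rule norm_le_one_of_squares_sum_one)
    show "star (?T + ?T - 1) = ?T + ?T - 1" by (simp add: star_add star_diff star_mult sk)
    show "star (?k * d + ?k * d) = ?k * d + ?k * d" by (simp add: star_add star_mult sk d dk)
    have dT: "d * ?T = ?T * d" using commute_mult[OF dk dk] .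
    have "?T * (?k * d) = (?k * d) * ?T"
      by (simp only: mult.assoc dT[unfolded mult.assoc])
    then show "(?T + ?T - 1) * (?k * d + ?k * d) = (?k * d + ?k * d) * (?T + ?T - 1)"
      by (simp only: left_diff_distrib right_diff_distrib distrib_left distrib_right mult_1_left mult_1_right)
        (simp only: diff_conv_add_uminus minus_add_distrib ac_simps)
    have "(x + x - 1) * (x + x - 1) = 1 - (x - x * x + (x - x * x) + (x - x * x + (x - x * x)))"
      for x :: "'a unitization"
      by (simp add: algebra_simps)
    moreover have "(x + x) * (x + x) = x * x + x * x + (x * x + x * x)" for x :: "'a unitization"
      by (simp add: algebra_simps)
    ultimately show "(?T + ?T - 1) * (?T + ?T - 1) + (?k * d + ?k * d) * (?k * d + ?k * d) = 1"
      by (simp only: TT diff_add_cancel)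
  qed
  then have "norm (?T + ?T - 1 + 1) \<le> 2"
    using norm_triangle_ineq[of "?T + ?T - 1" 1] by simp
  then have "norm ?T \<le> 1" by (simp flip: scaleR_2)
  then have "norm (k * k) \<le> 1" using norm_emb_ge[of "k * k"] by (simp add: emb_hom)
  moreover have "q = f + f - f * f"
    by (rule emb_eq_iff[THEN iffD1], unfold emb_hom f q ee[symmetric]) (simp add: algebra_simps)
  moreover have "q * c' = c'"
    by (rule emb_eq_iff[THEN iffD1], unfold emb_hom c' q)
      (simp add: left_diff_distrib mult.assoc cd(2))
  moreover have "star c' = c'" "star f = f"
    by (rule emb_eq_iff[THEN iffD1], simp add: emb_hom c' f star_diff c e)+
  ultimately show ?thesis using k l kl(1) unfolding q_def by blast
qed


section \<open>Least-norm sequences, the Riesz theorem and weak limits\<close>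

text \<open>A real Hilbert space carried by a subspace \<open>V\<close> of a normed space, with its own inner product \<open>B\<close>.
  It is applied to the inner product of a Hilbert space, to get adjoints, and to the form domain with
  the form inner product, to get potentials and weak limits.\<close>

locale complete_form =
  fixes V :: "'v::real_normed_vector set" and B :: "'v \<Rightarrow> 'v \<Rightarrow> real"
  assumes subspace_V: "subspace V"
    and form_add_right: "x \<in> V \<Longrightarrow> y \<in> V \<Longrightarrow> z \<in> V \<Longrightarrow> B x (y + z) = B x y + B x z"
    and form_scaleR_right: "x \<in> V \<Longrightarrow> y \<in> V \<Longrightarrow> B x (r *\<^sub>R y) = r * B x y"
    and form_sym: "x \<in> V \<Longrightarrow> y \<in> V \<Longrightarrow> B x y = B y x"
    and form_pos: "x \<in> V \<Longrightarrow> 0 \<le> B x x"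
    and form_complete: "(\<And>n::nat. u n \<in> V) \<Longrightarrow>
      (\<And>e. e > 0 \<Longrightarrow> \<exists>N. \<forall>m\<ge>N. \<forall>n\<ge>N. B (u m - u n) (u m - u n) < e) \<Longrightarrow>
      \<exists>v\<in>V. (\<lambda>n. B (u n - v) (u n - v)) \<longlonglongrightarrow> 0"
begin

lemmas V_add = subspace_add[OF subspace_V] and V_scale = subspace_scale[OF subspace_V]
  and V_diff = subspace_diff[OF subspace_V] and V_zero = subspace_0[OF subspace_V]

lemma form_diff_right: "x \<in> V \<Longrightarrow> y \<in> V \<Longrightarrow> z \<in> V \<Longrightarrow> B x (y - z) = B x y - B x z"
  using form_add_right[of x "y - z" z] V_diff by simp

lemma form_add_left: "x \<in> V \<Longrightarrow> y \<in> V \<Longrightarrow> z \<in> V \<Longrightarrow> B (x + y) z = B x z + B y z"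
  using form_add_right[of z x y] V_add by (simp add: form_sym[of _ z])

lemma form_scaleR_left: "x \<in> V \<Longrightarrow> y \<in> V \<Longrightarrow> B (r *\<^sub>R x) y = r * B x y"
  using form_scaleR_right[of y x r] V_scale by (simp add: form_sym[of _ y])

lemma form_diff_left: "x \<in> V \<Longrightarrow> y \<in> V \<Longrightarrow> z \<in> V \<Longrightarrow> B (x - y) z = B x z - B y z"
  using form_diff_right[of z x y] V_diff by (simp add: form_sym[of _ z])

lemmas form_simps = form_add_right form_add_left form_diff_right form_diff_left
  form_scaleR_right form_scaleR_left V_add V_diff V_scale

lemma form_zero: "x \<in> V \<Longrightarrow> B x 0 = 0"
  using form_scaleR_right[of x 0 0] V_zero by simp

lemma form_square_add_scale:
  assumes "x \<in> V" "y \<in> V"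
  shows "B (x + t *\<^sub>R y) (x + t *\<^sub>R y) = B x x + 2 * t * B x y + t * t * B y y"
  using assms form_sym[of y x] by (simp add: form_simps algebra_simps)

lemma form_minimal_imp_orthogonal:
  assumes "x \<in> V" "y \<in> V" and min: "\<And>t. B x x \<le> B (x + t *\<^sub>R y) (x + t *\<^sub>R y)"
  shows "B x y = 0"
proof (rule ccontr)
  assume nz: "B x y \<noteq> 0"
  have ineq: "0 \<le> 2 * t * B x y + t * t * B y y" for t
    using min[of t] form_square_add_scale[OF assms(1,2), of t] by simp
  define s where "s = 1 / (B y y + 1)"
  have s: "0 < s" "s * B y y < 1" using form_pos[OF assms(2)] by (auto simp: s_def divide_simps)
  have "0 \<le> B x y * B x y * (s * (s * B y y - 2))"
    using ineq[of "- s * B x y"] by (simp add: algebra_simps)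
  moreover have "s * (s * B y y - 2) < 0" using s by (simp add: mult_pos_neg)
  moreover have "0 < B x y * B x y" using nz not_real_square_gt_zero by blast
  ultimately show False by (meson mult_pos_neg not_less)
qed

lemma form_cauchy_schwarz:
  assumes "x \<in> V" "y \<in> V"
  shows "(B x y)\<^sup>2 \<le> B x x * B y y"
proof (cases "B y y = 0")
  case True
  have "B y x = 0"
  proof (rule form_minimal_imp_orthogonal[OF assms(2,1)])
    show "B y y \<le> B (y + t *\<^sub>R x) (y + t *\<^sub>R x)" for t
      using True form_pos[of "y + t *\<^sub>R x"] assms by (simp add: form_simps)
  qed
  then show ?thesis using True form_sym[OF assms] by simp
next
  case False
  then have p: "B y y > 0" using form_pos[OF assms(2)] by simp
  have "0 \<le> B (x + (- B x y / B y y) *\<^sub>R y) (x + (- B x y / B y y) *\<^sub>R y)"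
    using assms by (intro form_pos V_add V_scale)
  also have "\<dots> = B x x - (B x y)\<^sup>2 / B y y"
    unfolding form_square_add_scale[OF assms] using p by (simp add: field_simps power2_eq_square)
  finally show ?thesis using p by (simp add: field_simps)
qed

lemma form_tendsto:
  assumes u: "\<And>n. u n \<in> V" and v: "v \<in> V" and lim: "(\<lambda>n. B (u n - v) (u n - v)) \<longlonglongrightarrow> 0"
  shows "y \<in> V \<Longrightarrow> (\<lambda>n. B y (u n)) \<longlonglongrightarrow> B y v" and "(\<lambda>n. B (u n) (u n)) \<longlonglongrightarrow> B v v"
proof -
  have weak: "(\<lambda>n. B y (u n)) \<longlonglongrightarrow> B y v" if y: "y \<in> V" for y
  proof (rule LIM_zero_cancel, rule tendsto_rabs_zero_cancel)
    have "(\<lambda>n. sqrt (B y y * B (u n - v) (u n - v))) \<longlonglongrightarrow> sqrt (B y y * 0)"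
      by (intro tendsto_intros lim)
    then have lim': "(\<lambda>n. sqrt (B y y * B (u n - v) (u n - v))) \<longlonglongrightarrow> 0" by simp
    have "\<bar>B y (u n) - B y v\<bar> \<le> sqrt (B y y * B (u n - v) (u n - v))" for n
      using form_cauchy_schwarz[OF y V_diff[OF u v]] form_diff_right[OF y u v]
      by (intro real_le_rsqrt) simp
    then show "(\<lambda>n. \<bar>B y (u n) - B y v\<bar>) \<longlonglongrightarrow> 0"
      by (rule nonneg_squeeze_zero[OF abs_ge_zero _ lim'])
  qed
  then show "y \<in> V \<Longrightarrow> (\<lambda>n. B y (u n)) \<longlonglongrightarrow> B y v" .
  have "B (u n) (u n) = B (u n - v) (u n - v) + 2 * B v (u n) - B v v" for n
    using form_sym[OF u v] u v by (simp add: form_simps)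
  moreover have "(\<lambda>n. B (u n - v) (u n - v) + 2 * B v (u n) - B v v) \<longlonglongrightarrow> 0 + 2 * B v v - B v v"
    by (intro tendsto_intros lim weak v)
  ultimately show "(\<lambda>n. B (u n) (u n)) \<longlonglongrightarrow> B v v" by simp
qed

text \<open>The usual proof that a closed convex set has an element of least norm, for a decreasing sequence
  of sets: the infima of the squared norms increase to a limit, and by the parallelogram law elements
  that nearly attain them form a Cauchy sequence.  A constant sequence leads to the Riesz theorem,
  a shrinking one to weak limits.\<close>

lemma least_norm_sequence:
  assumes DV: "\<And>n::nat. D n \<subseteq> V" and decr: "\<And>n. D (Suc n) \<subseteq> D n"
    and mid: "\<And>n x y. x \<in> D n \<Longrightarrow> y \<in> D n \<Longrightarrow> (1/2) *\<^sub>R (x + y) \<in> D n"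
    and bdd: "\<And>n. \<exists>x\<in>D n. B x x \<le> R"
  shows "\<exists>u. \<exists>v\<in>V. (\<forall>n. u n \<in> D n) \<and> (\<lambda>n. B (u n - v) (u n - v)) \<longlonglongrightarrow> 0 \<and>
    (\<forall>x. (\<forall>n. x \<in> D n) \<longrightarrow> B v v \<le> B x x)"
proof -
  define d where "d n = (INF x\<in>D n. B x x)" for n
  have bb: "bdd_below ((\<lambda>x. B x x) ` D n)" for n
    using form_pos DV by (intro bdd_belowI[of _ 0]) auto
  have ne: "D n \<noteq> {}" for n using bdd[of n] by auto
  have dle: "d n \<le> B x x" if "x \<in> D n" for n x
    unfolding d_def by (rule cINF_lower[OF bb that])
  have dR: "d n \<le> R" for n using bdd[of n] dle by (meson order_trans)
  have dec': "D m \<subseteq> D n" if "n \<le> m" for m n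
    using that decr by (metis lift_Suc_antimono_le)
  have dmono: "d n \<le> d m" if "n \<le> m" for m n
    unfolding d_def using dec'[OF that] by (intro cINF_superset_mono bb ne) auto
  have "convergent d"
  proof (rule Bseq_mono_convergent)
    have "\<bar>d n\<bar> \<le> max \<bar>d 0\<bar> \<bar>R\<bar>" for n using dR[of n] dmono[of 0 n] by auto
    then show "Bseq d" by (intro BseqI'[of _ "max \<bar>d 0\<bar> \<bar>R\<bar>"]) simp
  qed (use dmono in auto)
  then obtain l where l: "d \<longlonglongrightarrow> l" unfolding convergent_def by blast
  have dl: "d n \<le> l" for n
    using dmono by (intro incseq_le[OF _ l]) (simp add: incseq_def)
  have "\<exists>x\<in>D n. B x x < d n + 1 / real (Suc n)" for n
    using cInf_lessD[of "(\<lambda>x. B x x) ` D n" "d n + 1 / real (Suc n)"] ne[of n]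
    by (auto simp: d_def)
  then obtain u where u: "\<And>n. u n \<in> D n" "\<And>n. B (u n) (u n) < d n + 1 / real (Suc n)" by metis
  have uV: "u n \<in> V" for n using u(1) DV by blast
  have close: "B (u m - u n) (u m - u n) \<le> 4 * (l - d N) + 4 / real (Suc N)" if "N \<le> m" "N \<le> n" for m n N
  proof -
    have "(1/2) *\<^sub>R (u m + u n) \<in> D N" using u(1) dec' that by (intro mid) blast+
    from dle[OF this] have "d N \<le> (1/2) * ((1/2) * B (u m + u n) (u m + u n))"
      using uV by (simp only: form_scaleR_left form_scaleR_right V_add V_scale)
    then have "4 * d N \<le> B (u m + u n) (u m + u n)" by linarith
    moreover have "B (u m - u n) (u m - u n) + B (u m + u n) (u m + u n) =
        2 * B (u m) (u m) + 2 * B (u n) (u n)"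
      using uV by (simp add: form_simps)
    moreover have "1 / real (Suc m) \<le> 1 / real (Suc N)" "1 / real (Suc n) \<le> 1 / real (Suc N)"
      using that by (auto intro!: divide_left_mono)
    ultimately show ?thesis using u(2)[of m] u(2)[of n] dl[of m] dl[of n] by simp
  qed
  have "(\<lambda>N. 4 * (l - d N) + 4 * inverse (real (Suc N))) \<longlonglongrightarrow> 4 * (l - l) + 4 * 0"
    by (intro tendsto_intros l LIMSEQ_inverse_real_of_nat)
  then have small: "(\<lambda>N. 4 * (l - d N) + 4 / real (Suc N)) \<longlonglongrightarrow> 0" by (simp add: divide_inverse)
  have "\<exists>N. \<forall>m\<ge>N. \<forall>n\<ge>N. B (u m - u n) (u m - u n) < e" if "e > 0" for e
  proof -
    have "\<forall>\<^sub>F N in sequentially. 4 * (l - d N) + 4 / real (Suc N) < e"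
      by (rule order_tendstoD(2)[OF small that])
    then obtain N where "4 * (l - d N) + 4 / real (Suc N) < e"
      unfolding eventually_sequentially by blast
    then show ?thesis using close[of N] by (meson le_less_trans)
  qed
  from form_complete[of u, OF uV this]
  obtain v where v: "v \<in> V" "(\<lambda>n. B (u n - v) (u n - v)) \<longlonglongrightarrow> 0"
    by blast
  have "B v v \<le> B x x" if x: "\<forall>n. x \<in> D n" for x
  proof (rule LIMSEQ_le[OF form_tendsto(2)[OF uV v]])
    have "(\<lambda>n. B x x + inverse (real (Suc n))) \<longlonglongrightarrow> B x x + 0"
      by (intro tendsto_intros LIMSEQ_inverse_real_of_nat)
    then show "(\<lambda>n. B x x + inverse (real (Suc n))) \<longlonglongrightarrow> B x x" by simp
    have "B (u n) (u n) \<le> B x x + inverse (real (Suc n))" for n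
      using u(2)[of n] dle[of x n] x by (simp add: divide_inverse)
    then show "\<exists>N. \<forall>n\<ge>N. B (u n) (u n) \<le> B x x + inverse (real (Suc n))" by blast
  qed
  then show ?thesis using u(1) v by blast
qed

text \<open>The element \<open>v\<close> of least norm in the closure of \<open>{x \<in> D. f x = 1}\<close> is orthogonal to the kernel of
  \<open>f\<close>; it is nonzero because \<open>f\<close> is bounded, and \<open>v / B v v\<close> represents \<open>f\<close>.\<close>

lemma riesz_representation:
  assumes D: "subspace D" "D \<subseteq> V"
    and add: "\<And>x y. x \<in> D \<Longrightarrow> y \<in> D \<Longrightarrow> f (x + y) = f x + f y"
    and scale: "\<And>r x. x \<in> D \<Longrightarrow> f (r *\<^sub>R x) = r * f x"
    and bdd: "\<And>x. x \<in> D \<Longrightarrow> (f x)\<^sup>2 \<le> K * B x x"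
  shows "\<exists>g\<in>V. \<forall>x\<in>D. B g x = f x"
proof (cases "\<forall>x\<in>D. f x = 0")
  case True
  then show ?thesis
    using form_zero form_sym V_zero D(2) by (intro bexI[of _ 0]) (auto simp: subset_iff)
next
  case False
  then obtain w where w: "w \<in> D" "f w \<noteq> 0" by blast
  have fdiff: "f (x - y) = f x - f y" if "x \<in> D" "y \<in> D" for x y
    using add[of "x - y" y] that subspace_diff[OF D(1)] by simp
  define w1 where "w1 = (1 / f w) *\<^sub>R w"
  have w1: "w1 \<in> D" "f w1 = 1" using w scale subspace_scale[OF D(1)] by (auto simp: w1_def)
  define D1 where "D1 = {x \<in> D. f x = 1}"
  have "\<exists>u. \<exists>v\<in>V. (\<forall>n::nat. u n \<in> D1) \<and> (\<lambda>n. B (u n - v) (u n - v)) \<longlonglongrightarrow> 0 \<and>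
    (\<forall>x. (\<forall>n::nat. x \<in> D1) \<longrightarrow> B v v \<le> B x x)"
  proof (rule least_norm_sequence)
    show "(1/2) *\<^sub>R (x + y) \<in> D1" if "x \<in> D1" "y \<in> D1" for x y
      using that add scale subspace_add[OF D(1)] subspace_scale[OF D(1)] by (auto simp: D1_def)
    show "\<exists>x\<in>D1. B x x \<le> B w1 w1" using w1 by (auto simp: D1_def)
  qed (use D in \<open>auto simp: D1_def\<close>)
  then obtain u v where u: "\<And>n::nat. u n \<in> D1" and v: "v \<in> V" "(\<lambda>n. B (u n - v) (u n - v)) \<longlonglongrightarrow> 0"
    and min: "\<And>x. x \<in> D1 \<Longrightarrow> B v v \<le> B x x" by blast
  have uV: "u n \<in> V" and uD: "u n \<in> D" and fu: "f (u n) = 1" for n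
    using u[of n] D(2) by (auto simp: D1_def)
  have orth: "B v x = 0" if x: "x \<in> D" "f x = 0" for x
  proof (rule form_minimal_imp_orthogonal[OF v(1)])
    show xV: "x \<in> V" using x D by blast
    show "B v v \<le> B (v + t *\<^sub>R x) (v + t *\<^sub>R x)" for t
    proof (rule LIMSEQ_le_const[of "\<lambda>n. B (u n + t *\<^sub>R x) (u n + t *\<^sub>R x)"])
      have "u n + t *\<^sub>R x - (v + t *\<^sub>R x) = u n - v" for n by simp
      then show "(\<lambda>n. B (u n + t *\<^sub>R x) (u n + t *\<^sub>R x)) \<longlonglongrightarrow> B (v + t *\<^sub>R x) (v + t *\<^sub>R x)"
        using v uV xV by (intro form_tendsto(2)) (simp_all add: V_add V_scale)
      have "u n + t *\<^sub>R x \<in> D1" for n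
        using uD fu x add scale subspace_add[OF D(1)] subspace_scale[OF D(1)] by (simp add: D1_def)
      then show "\<exists>N. \<forall>n\<ge>N. B v v \<le> B (u n + t *\<^sub>R x) (u n + t *\<^sub>R x)" using min by blast
    qed
  qed
  have vD: "B v y = f y * B v (u 0)" if y: "y \<in> D" for y
  proof -
    have "B v (y - f y *\<^sub>R u 0) = 0"
      using y uD[of 0] fu[of 0] subspace_diff[OF D(1)] subspace_scale[OF D(1)]
      by (intro orth) (simp_all add: fdiff scale)
    moreover have "y \<in> V" using y D(2) by blast
    ultimately show ?thesis using v(1) uV[of 0] by (simp add: form_simps)
  qed
  have "(\<lambda>n. B v (u n)) \<longlonglongrightarrow> B v v" by (rule form_tendsto(1)[OF uV v v(1)])
  moreover have "(\<lambda>n. B v (u n)) = (\<lambda>n. B v (u 0))"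
    using vD[OF uD] fu by (intro ext) (simp only: mult_1)
  ultimately have "(\<lambda>n::nat. B v (u 0)) \<longlonglongrightarrow> B v v" by (simp only:)
  then have vv: "B v (u 0) = B v v" by (simp add: LIMSEQ_const_iff)
  have "1 \<le> K * B v v"
  proof (rule LIMSEQ_le_const[of "\<lambda>n. K * B (u n) (u n)"])
    show "(\<lambda>n. K * B (u n) (u n)) \<longlonglongrightarrow> K * B v v"
      by (intro tendsto_mult tendsto_const form_tendsto(2)[OF uV v])
    show "\<exists>N. \<forall>n\<ge>N. 1 \<le> K * B (u n) (u n)" using bdd[OF uD] fu by simp
  qed
  then have nz: "B v v \<noteq> 0" by auto
  have "B ((1 / B v v) *\<^sub>R v) y = f y" if "y \<in> D" for y
    using vD[OF that] vv nz v(1) that D(2) by (simp add: form_scaleR_left subset_iff)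
  then show ?thesis using v(1) V_scale by blast
qed

text \<open>Bounded sequences that converge in the weaker norm converge weakly for \<open>B\<close>.  The elements of the
  half space that are \<open>1 / (n + 1)\<close>-close to \<open>\<xi>\<close> form decreasing convex sets \<open>D n\<close> which contain elements
  of bounded form norm.  A least-norm sequence for them converges with respect to \<open>B\<close>, necessarily to
  \<open>\<xi>\<close>, without leaving the half space.\<close>

lemma half_space_closed_under_bounded_limits:
  assumes dom: "\<And>x. x \<in> V \<Longrightarrow> (norm x)\<^sup>2 \<le> B x x" and g: "g \<in> V" and \<xi>: "\<xi> \<in> V"
    and u: "\<And>n::nat. u n \<in> V" "\<And>n. B (u n) (u n) \<le> R" "u \<longlonglongrightarrow> \<xi>" and half: "\<And>n. B g (u n) \<le> s"
  shows "B g \<xi> \<le> s"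
proof -
  define D where "D n = {x \<in> V. B g x \<le> s \<and> norm (x - \<xi>) \<le> 1 / real (Suc n)}" for n
  have "\<exists>w. \<exists>v\<in>V. (\<forall>n. w n \<in> D n) \<and> (\<lambda>n. B (w n - v) (w n - v)) \<longlonglongrightarrow> 0 \<and>
    (\<forall>x. (\<forall>n. x \<in> D n) \<longrightarrow> B v v \<le> B x x)"
  proof (rule least_norm_sequence)
    show "D n \<subseteq> V" for n by (auto simp: D_def)
    have "1 / real (Suc (Suc n)) \<le> 1 / real (Suc n)" for n by (simp add: field_simps)
    then show "D (Suc n) \<subseteq> D n" for n by (auto simp: D_def intro: order_trans)
    show "\<exists>x\<in>D n. B x x \<le> R" for n
    proof -
      have "\<forall>\<^sub>F k in sequentially. dist (u k) \<xi> < 1 / real (Suc n)"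
        by (rule tendstoD[OF u(3)]) simp
      then obtain k where "dist (u k) \<xi> < 1 / real (Suc n)" unfolding eventually_sequentially by blast
      then show ?thesis using u half by (intro bexI[of _ "u k"]) (auto simp: D_def dist_norm)
    qed
    show "(1/2) *\<^sub>R (x + y) \<in> D n" if "x \<in> D n" "y \<in> D n" for n x y
    proof -
      have "(1/2) *\<^sub>R (x + y) - \<xi> = (1/2) *\<^sub>R ((x - \<xi>) + (y - \<xi>))"
      proof -
        have "(1/2) *\<^sub>R \<xi> + (1/2) *\<^sub>R \<xi> = \<xi>" by (simp flip: scaleR_add_left)
        then have "(1/2) *\<^sub>R (x + y) - \<xi> = (1/2) *\<^sub>R (x + y) - ((1/2) *\<^sub>R \<xi> + (1/2) *\<^sub>R \<xi>)"
          by (simp only:)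
        then show ?thesis by (simp add: algebra_simps)
      qed
      then have "norm ((1/2) *\<^sub>R (x + y) - \<xi>) \<le> (norm (x - \<xi>) + norm (y - \<xi>)) / 2"
        using norm_triangle_ineq[of "x - \<xi>" "y - \<xi>"] by simp
      then show ?thesis using that g by (auto simp: D_def form_simps)
    qed
  qed
  then obtain w v where w: "\<And>n. w n \<in> D n" and v: "v \<in> V" "(\<lambda>n. B (w n - v) (w n - v)) \<longlonglongrightarrow> 0" by blast
  have wV: "w n \<in> V" for n using w[of n] by (simp add: D_def)
  have "(\<lambda>n. (norm (w n - v))\<^sup>2) \<longlonglongrightarrow> 0"
    using dom wV v(1) by (intro nonneg_squeeze_zero[OF _ _ v(2)]) (simp_all add: V_diff)
  then have "(\<lambda>n. sqrt ((norm (w n - v))\<^sup>2)) \<longlonglongrightarrow> sqrt 0" by (intro tendsto_intros)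
  then have "(\<lambda>n. norm (w n - v)) \<longlonglongrightarrow> 0" by simp
  then have "w \<longlonglongrightarrow> v" by (rule LIM_zero_cancel[OF tendsto_norm_zero_cancel])
  moreover have "w \<longlonglongrightarrow> \<xi>"
  proof (rule LIM_zero_cancel, rule tendsto_norm_zero_cancel)
    have "(\<lambda>n. 1 / real (Suc n)) \<longlonglongrightarrow> 0"
      using LIMSEQ_inverse_real_of_nat by (simp add: divide_inverse)
    moreover have "norm (w n - \<xi>) \<le> 1 / real (Suc n)" for n using w[of n] by (simp add: D_def)
    ultimately show "(\<lambda>n. norm (w n - \<xi>)) \<longlonglongrightarrow> 0"
      by (intro nonneg_squeeze_zero[of "\<lambda>n. norm (w n - \<xi>)" "\<lambda>n. 1 / real (Suc n)"] norm_ge_zero)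
  qed
  ultimately have "v = \<xi>" by (rule LIMSEQ_unique)
  have "B g v \<le> s"
  proof (rule LIMSEQ_le_const2[OF form_tendsto(1)[OF wV v g]])
    show "\<exists>N. \<forall>n\<ge>N. B g (w n) \<le> s" using w by (auto simp: D_def)
  qed
  then show ?thesis using \<open>v = \<xi>\<close> by simp
qed

end


section \<open>Extension from a dense subspace\<close>

lemma closure_sequence:
  "x \<in> closure S \<Longrightarrow> \<exists>u. (\<forall>n. u n \<in> S) \<and> u \<longlonglongrightarrow> (x::'x::real_normed_vector)"
  by (simp add: closure_sequential)

text \<open>A linear map on a dense subspace is given by a common parametrisation of points \<open>p x\<close> and
  values \<open>q x\<close>; the bound makes the value depend on the point alone.  With \<open>p = \<eta>\<close> this constructs
  the left multiplications and the involution \<open>J\<close>; with \<open>p\<close> the identity it extends the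
  functional to the fine algebra.\<close>

lemma bounded_linear_extension:
  fixes p :: "'c \<Rightarrow> 'v::real_normed_vector" and q :: "'c \<Rightarrow> 'w::banach"
  assumes ne: "S \<noteq> {}"
    and add: "\<And>x y. x \<in> S \<Longrightarrow> y \<in> S \<Longrightarrow> \<exists>z\<in>S. p z = p x + p y \<and> q z = q x + q y"
    and scale: "\<And>x r. x \<in> S \<Longrightarrow> \<exists>z\<in>S. p z = r *\<^sub>R p x \<and> q z = r *\<^sub>R q x"
    and bound: "\<And>x. x \<in> S \<Longrightarrow> norm (q x) \<le> K * norm (p x)"
  shows "\<exists>f. (\<forall>x\<in>S. f (p x) = q x) \<and> continuous_on (closure (p ` S)) f \<and>
    (\<forall>x\<in>closure (p ` S). \<forall>y\<in>closure (p ` S). f (x + y) = f x + f y) \<and>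
    (\<forall>r. \<forall>x\<in>closure (p ` S). f (r *\<^sub>R x) = r *\<^sub>R f x) \<and>
    (\<forall>x\<in>closure (p ` S). norm (f x) \<le> K * norm x)"
proof -
  let ?P = "p ` S"
  have diff: "\<exists>z\<in>S. p z = p x - p y \<and> q z = q x - q y" if x: "x \<in> S" and y: "y \<in> S" for x y
  proof -
    obtain y' where "y' \<in> S" "p y' = (-1) *\<^sub>R p y" "q y' = (-1) *\<^sub>R q y" using scale[OF y] by blast
    with add[OF x this(1)] show ?thesis by auto
  qed
  have lip: "norm (q x - q y) \<le> K * norm (p x - p y)" if "x \<in> S" "y \<in> S" for x y
    using diff[OF that] bound by metis
  define g where "g v = q (SOME x. x \<in> S \<and> p x = v)" for v
  have gp: "g (p x) = q x" if x: "x \<in> S" for x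
  proof -
    define y where "y = (SOME y. y \<in> S \<and> p y = p x)"
    have y: "y \<in> S \<and> p y = p x" unfolding y_def by (rule someI[of _ x]) (simp add: x)
    then have "norm (q y - q x) \<le> 0" using lip[of y x] x by simp
    then show ?thesis unfolding g_def y_def[symmetric] by simp
  qed
  have "uniformly_continuous_on ?P g"
    unfolding uniformly_continuous_on_def
  proof (intro allI impI)
    fix e :: real assume e: "e > 0"
    show "\<exists>d>0. \<forall>x\<in>?P. \<forall>x'\<in>?P. dist x' x < d \<longrightarrow> dist (g x') (g x) < e"
    proof (intro exI[of _ "e / (\<bar>K\<bar> + 1)"] conjI ballI impI)
      fix x x' assume "x \<in> ?P" "x' \<in> ?P" and d: "dist x' x < e / (\<bar>K\<bar> + 1)"
      then have "dist (g x') (g x) \<le> K * dist x' x" using lip gp by (auto simp: dist_norm)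
      also have "\<dots> \<le> (\<bar>K\<bar> + 1) * dist x' x" by (intro mult_right_mono) auto
      also have "\<dots> < e" using d by (simp add: field_simps)
      finally show "dist (g x') (g x) < e" .
    qed (use e in simp)
  qed
  then obtain f where f: "uniformly_continuous_on (closure ?P) f" "\<And>x. x \<in> ?P \<Longrightarrow> g x = f x"
    using uniformly_continuous_on_extension_on_closure by metis
  have cf: "continuous_on (closure ?P) f" by (rule uniformly_continuous_imp_continuous[OF f(1)])
  have fp: "f (p x) = q x" if "x \<in> S" for x using gp[OF that] f(2)[of "p x"] that by simp
  have seq: "\<exists>u. (\<forall>n::nat. u n \<in> S) \<and> (\<lambda>n. p (u n)) \<longlonglongrightarrow> x \<and> (\<lambda>n. q (u n)) \<longlonglongrightarrow> f x"
    if x: "x \<in> closure ?P" for x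
  proof -
    obtain w where w: "\<forall>n::nat. w n \<in> ?P" "w \<longlonglongrightarrow> x" using closure_sequence[OF x] by blast
    then obtain u where u: "\<And>n. u n \<in> S" "\<And>n. w n = p (u n)" unfolding image_iff Bex_def by metis
    have "(\<lambda>n. f (w n)) \<longlonglongrightarrow> f x"
      using w(1) closure_subset[of ?P]
      by (intro continuous_on_tendsto_compose[OF cf w(2) x] always_eventually) blast
    moreover have "w = (\<lambda>n. p (u n))" using u(2) by (rule ext)
    ultimately show ?thesis using u(1) w(2) fp by (intro exI[of _ u]) simp
  qed
  have ev: "f x = l" if "\<And>n::nat. z n \<in> S" "(\<lambda>n. p (z n)) \<longlonglongrightarrow> x" "(\<lambda>n. q (z n)) \<longlonglongrightarrow> l" for z x l
  proof (rule LIMSEQ_unique[OF _ that(3)])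
    have "\<forall>n. p (z n) \<in> ?P" using that(1) by blast
    then have "x \<in> closure ?P"
      unfolding closure_sequential using that(2) by (intro exI[of _ "\<lambda>n. p (z n)"]) simp
    then have "(\<lambda>n. f (p (z n))) \<longlonglongrightarrow> f x"
      using that(1) closure_subset[of ?P]
      by (intro continuous_on_tendsto_compose[OF cf that(2)] always_eventually) blast+
    then show "(\<lambda>n. q (z n)) \<longlonglongrightarrow> f x" using fp that(1) by simp
  qed
  have "f (x + y) = f x + f y" if x: "x \<in> closure ?P" and y: "y \<in> closure ?P" for x y
  proof -
    obtain u w where u: "\<And>n::nat. u n \<in> S" "(\<lambda>n. p (u n)) \<longlonglongrightarrow> x" "(\<lambda>n. q (u n)) \<longlonglongrightarrow> f x"
      and w: "\<And>n::nat. w n \<in> S" "(\<lambda>n. p (w n)) \<longlonglongrightarrow> y" "(\<lambda>n. q (w n)) \<longlonglongrightarrow> f y"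
      using seq[OF x] seq[OF y] by blast
    obtain z where z: "\<And>n. z n \<in> S" "\<And>n. p (z n) = p (u n) + p (w n)" "\<And>n. q (z n) = q (u n) + q (w n)"
      using bchoice[of UNIV "\<lambda>n z. z \<in> S \<and> p z = p (u n) + p (w n) \<and> q z = q (u n) + q (w n)"]
        add[OF u(1) w(1)] by blast
    show ?thesis
      by (rule ev[of z]) (simp_all add: z tendsto_add u w)
  qed
  moreover have "f (r *\<^sub>R x) = r *\<^sub>R f x" if x: "x \<in> closure ?P" for r x
  proof -
    obtain u where u: "\<And>n::nat. u n \<in> S" "(\<lambda>n. p (u n)) \<longlonglongrightarrow> x" "(\<lambda>n. q (u n)) \<longlonglongrightarrow> f x"
      using seq[OF x] by blast
    obtain z where z: "\<And>n. z n \<in> S" "\<And>n. p (z n) = r *\<^sub>R p (u n)" "\<And>n. q (z n) = r *\<^sub>R q (u n)"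
      using bchoice[of UNIV "\<lambda>n z. z \<in> S \<and> p z = r *\<^sub>R p (u n) \<and> q z = r *\<^sub>R q (u n)"]
        scale[OF u(1)] by blast
    show ?thesis
      by (rule ev[of z]) (simp_all add: z tendsto_scaleR u)
  qed
  moreover have "norm (f x) \<le> K * norm x" if x: "x \<in> closure ?P" for x
  proof -
    obtain u where u: "\<And>n::nat. u n \<in> S" "(\<lambda>n. p (u n)) \<longlonglongrightarrow> x" "(\<lambda>n. q (u n)) \<longlonglongrightarrow> f x"
      using seq[OF x] by blast
    show ?thesis
      by (rule LIMSEQ_le[OF tendsto_norm[OF u(3)] tendsto_mult[OF tendsto_const tendsto_norm[OF u(2)]]])
        (use bound u(1) in blast)
  qed
  ultimately show ?thesis using fp cf by blast
qed

lemma agree_on_dense: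
  fixes f g :: "'x::topological_space \<Rightarrow> 'y::t2_space"
  assumes "continuous_on UNIV f" "continuous_on UNIV g" "closure S = UNIV" "\<And>x. x \<in> S \<Longrightarrow> f x = g x"
  shows "f x = g x"
  using closure_minimal[of S "{x. f x = g x}"] closed_Collect_eq[OF assms(1,2)] assms(3,4) by auto


section \<open>Complex Hilbert spaces and adjoints\<close>

instance complex_hilbert_space \<subseteq> banach ..

lemma cinner_scaleC_left: "cinner (c *\<^sub>C x) y = cnj c * cinner x (y::'h::complex_hilbert_space)"
  by (metis cinner_scaleC_right cinner_commute complex_cnj_mult)

lemma Im_cinner: "Im (cinner x y) = inner (\<i> *\<^sub>C x) (y::'h::complex_hilbert_space)"
  by (simp add: Re_cinner[symmetric] cinner_scaleC_left)

text \<open>The complex inner product is determined by the real one, which lets adjoints be handled through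
  real inner products.\<close>

lemma cinner_eq_iff:
  "cinner x y = cinner z w \<longleftrightarrow>
     inner x y = inner z (w::'h::complex_hilbert_space) \<and> inner (\<i> *\<^sub>C x) y = inner (\<i> *\<^sub>C z) w"
  by (simp add: complex_eq_iff Im_cinner Re_cinner)

lemma norm_scaleC_hilbert: "norm (c *\<^sub>C x) = cmod c * norm (x::'h::complex_hilbert_space)"
proof -
  have "(norm (c *\<^sub>C x))\<^sup>2 = Re (cnj c * c * cinner x x)"
    by (simp only: power2_norm_eq_inner Re_cinner[symmetric] cinner_scaleC_left cinner_scaleC_right
        ac_simps)
  also have "cnj c * c = of_real ((cmod c)\<^sup>2)"
    using complex_norm_square[of c] by (simp add: mult.commute)
  also have "Re (of_real ((cmod c)\<^sup>2) * cinner x x) = (cmod c)\<^sup>2 * Re (cinner x x)"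
    by (simp del: of_real_power)
  also have "\<dots> = (cmod c * norm x)\<^sup>2"
    by (simp only: Re_cinner power2_norm_eq_inner power_mult_distrib)
  finally show ?thesis by (simp add: power2_eq_iff_nonneg)
qed

lemma bounded_linear_scaleC: "bounded_linear (\<lambda>x::'h::complex_hilbert_space. c *\<^sub>C x)"
  by (rule bounded_linear_intro[where K = "cmod c"])
    (simp_all add: scaleC_add_right scaleC_scaleR norm_scaleC_hilbert)

lemma scaleC_op_apply: "(scaleC_op c T) \<xi> = c *\<^sub>C T \<xi>"
  unfolding scaleC_op_def
  by (subst bounded_linear_Blinfun_apply)
    (rule bounded_linear_compose[OF bounded_linear_scaleC blinfun.bounded_linear_right], rule refl)

lemma scaleC_op_of_real: "scaleC_op (complex_of_real r) x = r *\<^sub>R (x :: 'h::complex_hilbert_space \<Rightarrow>\<^sub>L 'h)"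
  by (rule blinfun_eqI) (simp only: scaleC_op_apply scaleC_of_real blinfun.scaleR_left)

lemma norm_scaleC_op_le: "norm (scaleC_op c x) \<le> cmod c * norm x"
proof (rule norm_blinfun_bound)
  show "norm ((scaleC_op c x) z) \<le> cmod c * norm x * norm z" for z
    using mult_left_mono[OF norm_blinfun[of x z], of "cmod c"]
    by (simp add: scaleC_op_apply norm_scaleC_hilbert mult.assoc)
qed simp

lemma inner_blinfun_le:
  fixes x :: "'h::real_inner \<Rightarrow>\<^sub>L 'h"
  shows "inner z (x z) \<le> norm x * (norm z)\<^sup>2"
  using norm_cauchy_schwarz[of z "x z"] mult_left_mono[OF norm_blinfun[of x z] norm_ge_zero[of z]]
  by (simp add: power2_eq_square ac_simps)

lemma cinner_scaleR_right: "cinner x (r *\<^sub>R y) = of_real r * cinner x (y::'h::complex_hilbert_space)"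
  by (simp add: scaleR_eq_scaleC cinner_scaleC_right)

lemma blinfun_eq_iff: "S = T \<longleftrightarrow> (\<forall>x. blinfun_apply S x = blinfun_apply T x)"
  by (auto intro: blinfun_eqI)

lemma blinfun_compose_assoc: "(S o\<^sub>L T) o\<^sub>L U = S o\<^sub>L (T o\<^sub>L U)"
  by (rule blinfun_eqI) simp

lemma complete_form_inner: "complete_form (UNIV :: 'h::complex_hilbert_space set) inner"
proof
  fix u :: "nat \<Rightarrow> 'h"
  assume c: "\<And>e. e > 0 \<Longrightarrow> \<exists>N. \<forall>m\<ge>N. \<forall>n\<ge>N. inner (u m - u n) (u m - u n) < e"
  have "Cauchy u" by (rule Cauchy_of_square_le[OF _ c]) (simp_all add: power2_norm_eq_inner)
  then obtain v where v: "u \<longlonglongrightarrow> v" using Cauchy_convergent convergent_def by blast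
  have "(\<lambda>n. inner (u n - v) (u n - v)) \<longlonglongrightarrow> inner (v - v) (v - v)"
    by (intro tendsto_intros v)
  then show "\<exists>v\<in>UNIV. (\<lambda>n. inner (u n - v) (u n - v)) \<longlonglongrightarrow> 0" by auto
qed (simp_all add: inner_add_right inner_commute)

text \<open>Riesz representation of \<open>x \<mapsto> (T x, y)\<close> for the real inner product; for complex-linear \<open>T\<close> the
  result is the complex adjoint.\<close>

lemma real_adjoint_exists:
  fixes T :: "'h::complex_hilbert_space \<Rightarrow>\<^sub>L 'h"
  shows "\<exists>S::'h \<Rightarrow>\<^sub>L 'h. \<forall>x y. inner (T x) y = inner x (S y)"
proof -
  have "\<exists>g. \<forall>x. inner g x = inner (T x) y" for y
  proof -
    have "\<exists>g\<in>UNIV. \<forall>x\<in>UNIV. inner g x = inner (T x) y"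
    proof (rule complete_form.riesz_representation[OF complete_form_inner, where K = "(norm T * norm y)\<^sup>2"])
      show "(inner (T x) y)\<^sup>2 \<le> (norm T * norm y)\<^sup>2 * inner x x" for x
      proof -
        have "\<bar>inner (T x) y\<bar> \<le> norm T * norm y * norm x"
          using Cauchy_Schwarz_ineq2[of "T x" y]
            mult_right_mono[OF norm_blinfun[of T x] norm_ge_zero[of y]]
          by (simp add: ac_simps)
        then have "\<bar>inner (T x) y\<bar>\<^sup>2 \<le> (norm T * norm y * norm x)\<^sup>2"
          by (rule power_mono) simp
        then show ?thesis by (simp add: power_mult_distrib power2_norm_eq_inner)
      qed
    qed (simp_all add: blinfun.add_right blinfun.scaleR_right inner_add_left)
    then show ?thesis by blast
  qed
  then obtain s where s: "\<And>x y. inner (s y) x = inner (T x) y" by metis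
  have eqI: "a = b" if "\<And>x. inner a x = inner b x" for a b :: 'h
    using that[of "a - b"] by (metis inner_diff_left inner_eq_zero_iff right_minus_eq)
  have "bounded_linear s"
  proof (rule bounded_linear_intro[where K = "norm T"])
    show "s (x + y) = s x + s y" for x y
      by (rule eqI) (simp add: s inner_add_left inner_add_right)
    show "s (r *\<^sub>R x) = r *\<^sub>R s x" for r x
      by (rule eqI) (simp add: s)
    show "norm (s x) \<le> norm x * norm T" for x
    proof -
      have "norm (s x) * norm (s x) = inner (T (s x)) x"
        using s[of x "s x"] by (simp add: power2_norm_eq_inner[symmetric] power2_eq_square)
      also have "\<dots> \<le> norm T * norm (s x) * norm x"
        using norm_cauchy_schwarz[of "T (s x)" x]
          mult_right_mono[OF norm_blinfun[of T "s x"] norm_ge_zero[of x]] by linarith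
      finally show ?thesis by (cases "s x = 0") (auto simp: ac_simps)
    qed
  qed
  then have "inner (T x) y = inner x ((Blinfun s) y)" for x y
    by (simp only: bounded_linear_Blinfun_apply s[symmetric] inner_commute[of "s y"])
  then show ?thesis by blast
qed

lemma adj_eqI:
  fixes S T :: "'h::complex_hilbert_space \<Rightarrow>\<^sub>L 'h"
  assumes "complex_linear_op T" and "\<And>x y. inner (T x) y = inner x (S y)"
  shows "adj T = S"
  unfolding adj_def
proof (rule the_equality)
  have "inner (\<i> *\<^sub>C T x) y = inner (\<i> *\<^sub>C x) (S y)" for x y
    using assms by (metis complex_linear_op_def)
  then show "\<forall>x y. cinner (T x) y = cinner x (S y)"
    using assms(2) by (simp add: cinner_eq_iff)
  show "R = S" if R: "\<forall>x y. cinner (T x) y = cinner x (R y)" for R :: "'h \<Rightarrow>\<^sub>L 'h"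
  proof (rule blinfun_eqI)
    fix y
    have "inner x (R y) = inner x (S y)" for x
      using R assms(2)[of x y] by (simp add: cinner_eq_iff)
    from this[of "R y - S y"] show "R y = S y"
      by (metis inner_diff_right inner_eq_zero_iff right_minus_eq)
  qed
qed

lemma inner_adj:
  fixes T :: "'h::complex_hilbert_space \<Rightarrow>\<^sub>L 'h"
  assumes "complex_linear_op T"
  shows "inner (T x) y = inner x (adj T y)"
proof -
  obtain S :: "'h \<Rightarrow>\<^sub>L 'h" where S: "\<And>x y. inner (T x) y = inner x (S y)"
    using real_adjoint_exists by blast
  show ?thesis using S unfolding adj_eqI[OF assms S] .
qed

lemma inner_adj':
  "complex_linear_op T \<Longrightarrow> inner (adj T x) y = inner x (T y)"
  using inner_adj[of T y x] by (simp add: inner_commute)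

lemma cinner_adj:
  assumes "complex_linear_op T"
  shows "cinner (T x) y = cinner x (adj T y)"
  unfolding cinner_eq_iff using assms inner_adj[OF assms] by (metis complex_linear_op_def)

lemma complex_linear_op_adj:
  assumes "complex_linear_op T"
  shows "complex_linear_op (adj T)"
  unfolding complex_linear_op_def
proof (intro allI)
  fix c y
  let ?d = "adj T (c *\<^sub>C y) - c *\<^sub>C adj T y"
  have "cinner x (adj T (c *\<^sub>C y)) = cinner x (c *\<^sub>C adj T y)" for x
    by (simp add: cinner_adj[OF assms, symmetric] cinner_scaleC_right)
  then have "inner x ?d = 0" for x by (simp add: inner_diff_right cinner_eq_iff)
  from this[of ?d] show "adj T (c *\<^sub>C y) = c *\<^sub>C adj T y" by simp
qed

lemma complex_linear_op_simps:
  "complex_linear_op S \<Longrightarrow> complex_linear_op T \<Longrightarrow> complex_linear_op (S + T)"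
  "complex_linear_op S \<Longrightarrow> complex_linear_op T \<Longrightarrow> complex_linear_op (S - T)"
  "complex_linear_op T \<Longrightarrow> complex_linear_op (r *\<^sub>R T)"
  "complex_linear_op S \<Longrightarrow> complex_linear_op T \<Longrightarrow> complex_linear_op (S o\<^sub>L T)"
  "complex_linear_op T \<Longrightarrow> complex_linear_op (scaleC_op c T)"
  "complex_linear_op (id_blinfun :: 'h::complex_hilbert_space \<Rightarrow>\<^sub>L 'h)"
  by (auto simp: complex_linear_op_def blinfun.add_left blinfun.diff_left blinfun.scaleR_left
      scaleC_op_apply scaleC_add_right scaleC_diff_right scaleC_scaleR scaleC_scaleC mult.commute)

lemma adj_binary:
  assumes S: "complex_linear_op S" and T: "complex_linear_op T"
  shows "adj (S + T) = adj S + adj T" "adj (S - T) = adj S - adj T" "adj (S o\<^sub>L T) = adj T o\<^sub>L adj S"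
  by (intro adj_eqI complex_linear_op_simps S T;
    simp add: blinfun.add_left blinfun.diff_left inner_add_left inner_add_right
      inner_diff_left inner_diff_right inner_adj[OF S] inner_adj[OF T])+

lemma adj_unary:
  assumes T: "complex_linear_op T"
  shows "adj (r *\<^sub>R T) = r *\<^sub>R adj T" "adj (adj T) = T" "adj (scaleC_op c T) = scaleC_op (cnj c) (adj T)"
proof -
  have "inner (c *\<^sub>C x) y = inner x (cnj c *\<^sub>C y)" for c and x y :: 'a
    by (simp add: Re_cinner[symmetric] cinner_scaleC_left cinner_scaleC_right)
  then show "adj (scaleC_op c T) = scaleC_op (cnj c) (adj T)"
    using complex_linear_op_adj[OF T]
    by (intro adj_eqI complex_linear_op_simps T)
      (simp add: scaleC_op_apply inner_adj[OF T] complex_linear_op_def)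
qed (intro adj_eqI complex_linear_op_simps complex_linear_op_adj T;
    simp add: blinfun.scaleR_left inner_adj[OF T] inner_adj'[OF T])+

lemma norm_adj_le:
  assumes "complex_linear_op T"
  shows "norm (adj T) \<le> norm T"
proof (rule norm_blinfun_bound)
  fix y
  let ?z = "adj T y"
  have "norm ?z * norm ?z = inner (T ?z) y"
    by (simp add: inner_adj[OF assms] power2_norm_eq_inner[symmetric] power2_eq_square)
  also have "\<dots> \<le> norm T * norm ?z * norm y"
    using norm_cauchy_schwarz[of "T ?z" y]
      mult_right_mono[OF norm_blinfun[of T ?z] norm_ge_zero[of y]] by linarith
  finally show "norm ?z \<le> norm T * norm y" by (cases "?z = 0") (auto simp: ac_simps)
qed simp

lemma adj_id: "adj (id_blinfun :: 'h::complex_hilbert_space \<Rightarrow>\<^sub>L 'h) = id_blinfun"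
  by (rule adj_eqI) (simp_all add: complex_linear_op_simps)

lemma positive_opI:
  assumes "complex_linear_op T" and "adj T = T" and "\<And>x. 0 \<le> inner x (T x)"
  shows "positive_op T"
  unfolding positive_op_def
proof (intro conjI allI assms(1))
  fix x
  have "cinner x (T x) = cnj (cinner x (T x))"
    using cinner_adj[OF assms(1), of x x] assms(2) by (simp add: cinner_commute[of _ x])
  then have "Im (cinner x (T x)) = 0" by (simp add: complex_eq_iff)
  then show "cinner x (T x) \<in> \<real>\<^sub>\<ge>\<^sub>0"
    using assms(3)[of x] by (simp add: complex_nonneg_Reals_iff Re_cinner)
qed

lemma positive_op_square:
  assumes "complex_linear_op x"
  shows "positive_op (adj x o\<^sub>L x)"
proof (rule positive_opI)
  note c = complex_linear_op_adj[OF assms]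
  show "complex_linear_op (adj x o\<^sub>L x)" by (intro complex_linear_op_simps c assms)
  show "adj (adj x o\<^sub>L x) = adj x o\<^sub>L x"
    by (simp add: adj_binary(3)[OF c assms] adj_unary(2)[OF assms])
  show "0 \<le> inner z ((adj x o\<^sub>L x) z)" for z
    by (simp add: inner_adj[OF assms, symmetric])
qed

lemma positive_op_add:
  "positive_op S \<Longrightarrow> positive_op T \<Longrightarrow> positive_op (S + T)"
  by (auto simp: positive_op_def complex_linear_op_simps blinfun.add_left cinner_add_right
      complex_nonneg_Reals_iff)

lemma positive_op_scaleR: "positive_op T \<Longrightarrow> 0 \<le> r \<Longrightarrow> positive_op (r *\<^sub>R T)"
  by (auto simp: positive_op_def complex_linear_op_simps blinfun.scaleR_left cinner_scaleR_right
      complex_nonneg_Reals_iff)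


section \<open>Consequences of the trace axioms\<close>

context faithful_semifinite_trace
begin

abbreviation "L2 \<equiv> sq_integrable \<tau>"

lemma square_in_pos_cone: "star b * b \<in> pos_cone"
  by (auto simp: pos_cone_def)

lemma scaled_square: "0 \<le> r \<Longrightarrow> r *\<^sub>R (star b * b) = star (sqrt r *\<^sub>R b) * (sqrt r *\<^sub>R b)"
  by (simp add: star_scaleR flip: real_sqrt_mult)

lemma trace_scaled_square:
  "0 \<le> r \<Longrightarrow> \<tau> (r *\<^sub>R (star b * b)) = ennreal r * \<tau> (star b * b)"
  by (rule trace_scale[OF square_in_pos_cone])

lemma trace_add_scaled_squares:
  assumes "0 \<le> r" "0 \<le> s"
  shows "\<tau> (r *\<^sub>R (star a * a) + s *\<^sub>R (star b * b)) =
    ennreal r * \<tau> (star a * a) + ennreal s * \<tau> (star b * b)"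
proof -
  have pos: "0 \<le> r \<Longrightarrow> r *\<^sub>R (star b * b) \<in> pos_cone" for r b
    unfolding scaled_square by (rule square_in_pos_cone)
  show ?thesis
    unfolding trace_scaled_square[OF assms(1), symmetric] trace_scaled_square[OF assms(2), symmetric]
    by (intro trace_add pos assms)
qed

lemma trace_zero: "\<tau> 0 = 0"
  using trace_scaled_square[of 0 0] by simp

lemma trace_add_squares:
  "\<tau> (star a * a + star b * b) = \<tau> (star a * a) + \<tau> (star b * b)"
  by (rule trace_add[OF square_in_pos_cone square_in_pos_cone])

lemma parallelogram_square:
  "star (a + b) * (a + b) + star (a - b) * (a - b) = 2 *\<^sub>R (star a * a) + 2 *\<^sub>R (star (b::'a) * b)"
  by (simp add: star_add star_diff algebra_simps scaleR_2)

text \<open>The parallelogram identity turns \<open>(a + b)\<^sup>* (a + b) + (a - b)\<^sup>* (a - b)\<close> into a sum of squares with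
  finite trace.\<close>

lemma L2_add:
  assumes "a \<in> L2" "b \<in> L2"
  shows "a + b \<in> L2"
proof -
  have "\<tau> (star (a + b) * (a + b)) + \<tau> (star (a - b) * (a - b)) =
      ennreal 2 * \<tau> (star a * a) + ennreal 2 * \<tau> (star b * b)"
    unfolding trace_add_squares[symmetric] parallelogram_square by (rule trace_add_scaled_squares) auto
  also have "\<dots> < \<infinity>" using assms by (simp add: sq_integrable_def ennreal_mult_less_top)
  finally show ?thesis by (simp add: sq_integrable_def)
qed

lemma L2_scaleC:
  assumes "a \<in> L2"
  shows "c *\<^sub>C a \<in> L2"
proof -
  have "star (c *\<^sub>C a) * (c *\<^sub>C a) = (cmod c)\<^sup>2 *\<^sub>R (star a * a)"
    by (simp add: star_scaleC scaleC_mult_left scaleC_mult_right scaleC_scaleC scaleR_eq_scaleC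
        complex_norm_square[symmetric] mult.commute)
  then show ?thesis
    using assms by (simp add: sq_integrable_def trace_scaled_square ennreal_mult_less_top)
qed

lemma L2_scaleR: "a \<in> L2 \<Longrightarrow> r *\<^sub>R a \<in> L2"
  unfolding scaleR_eq_scaleC by (rule L2_scaleC)

lemma L2_zero: "0 \<in> L2"
  by (simp add: sq_integrable_def trace_zero)

lemma L2_diff:
  "a \<in> L2 \<Longrightarrow> b \<in> L2 \<Longrightarrow> a - b \<in> L2"
  using L2_add[of a "(-1) *\<^sub>R b"] L2_scaleR[of b "-1"] by simp

lemma L2_star: "a \<in> L2 \<Longrightarrow> star a \<in> L2"
  using trace_tracial[of a] by (simp add: sq_integrable_def star_star)

text \<open>Put \<open>x = a\<^sup>* a / \<parallel>a\<parallel>\<^sup>2\<close> and let \<open>(1 - y)\<^sup>2 = 1 - x\<close>.  Then \<open>b\<^sup>* b - b\<^sup>* x b = (b - y b)\<^sup>* (b - y b)\<close> is a square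
  in the algebra, so \<open>\<tau>(b\<^sup>* x b) \<le> \<tau>(b\<^sup>* b)\<close>.\<close>

lemma trace_mult_square_le:
  "\<tau> (star (a * b) * (a * b)) \<le> ennreal ((norm a)\<^sup>2) * \<tau> (star b * b)"
proof (cases "a = 0")
  case True
  then show ?thesis by (simp add: trace_zero)
next
  case False
  define x where "x = inverse ((norm a)\<^sup>2) *\<^sub>R (star a * a)"
  have "norm x \<le> 1" using False by (simp add: x_def cstar_identity)
  moreover have "star x = x" by (simp add: x_def star_scaleR star_mult star_star)
  ultimately have "\<exists>y\<in>{y. star y = y}. norm y \<le> 1 \<and> y + y = x + y * y \<and> (\<forall>z. z * x = x * z \<longrightarrow> z * y = y * z)"
    by (intro banach_sqrt closed_selfadjoint) (simp_all add: star_scaleR star_add star_mult)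
  then obtain y where y: "star y = y" "y + y = x + y * y" by blast
  have "star (b - y * b) * (b - y * b) = star b * b - star b * (y + y - y * y) * b"
    by (simp add: star_diff star_mult y(1) algebra_simps)
  also have "y + y - y * y = x" by (simp add: y(2))
  also have "star b * x * b = inverse ((norm a)\<^sup>2) *\<^sub>R (star (a * b) * (a * b))"
    by (simp add: x_def star_mult mult.assoc)
  finally have "star b * b =
      inverse ((norm a)\<^sup>2) *\<^sub>R (star (a * b) * (a * b)) + star (b - y * b) * (b - y * b)"
    by simp
  then have "star b * b = inverse ((norm a)\<^sup>2) *\<^sub>R (star (a * b) * (a * b)) +
      1 *\<^sub>R (star (b - y * b) * (b - y * b))"
    by (simp only: scaleR_one)
  then have "\<tau> (star b * b) = ennreal (inverse ((norm a)\<^sup>2)) * \<tau> (star (a * b) * (a * b)) +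
      ennreal 1 * \<tau> (star (b - y * b) * (b - y * b))"
    using trace_add_scaled_squares[of "inverse ((norm a)\<^sup>2)" 1 "a * b" "b - y * b"] by simp
  then have "ennreal (inverse ((norm a)\<^sup>2)) * \<tau> (star (a * b) * (a * b)) \<le> \<tau> (star b * b)"
    by (simp only: le_iff_add) blast
  then have "ennreal ((norm a)\<^sup>2) * (ennreal (inverse ((norm a)\<^sup>2)) * \<tau> (star (a * b) * (a * b))) \<le>
      ennreal ((norm a)\<^sup>2) * \<tau> (star b * b)"
    by (rule mult_left_mono) simp
  moreover have "ennreal ((norm a)\<^sup>2) * ennreal (inverse ((norm a)\<^sup>2)) = 1"
    using False by (simp flip: ennreal_mult)
  ultimately show ?thesis by (simp flip: mult.assoc)
qed

lemma L2_mult_left: "b \<in> L2 \<Longrightarrow> a * b \<in> L2"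
  using trace_mult_square_le[of a b]
  by (auto simp: sq_integrable_def ennreal_mult_less_top intro: le_less_trans)

lemma L2_mult_right: "b \<in> L2 \<Longrightarrow> b * a \<in> L2"
  using L2_star[OF L2_mult_left[OF L2_star, of b "star a"]]
  by (simp add: star_mult star_star)

lemma L2_of_trace_add:
  assumes "star a * a + star b * b = star d * d" "d \<in> L2"
  shows "a \<in> L2"
proof -
  have "\<tau> (star a * a) + \<tau> (star b * b) < \<infinity>"
    using assms unfolding trace_add_squares[symmetric] by (simp add: sq_integrable_def)
  then show ?thesis by (simp add: sq_integrable_def)
qed

text \<open>For \<open>c\<^sup>2 = (b - 1)\<^sub>+\<close> one has \<open>b c = c + c\<^sup>3\<close> and \<open>(c + c\<^sup>3)\<^sup>2 = (2 c\<^sup>2)\<^sup>2 + (c - c\<^sup>3)\<^sup>2\<close>.  Since \<open>b c\<close> is square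
  integrable, so are \<open>c\<^sup>2\<close>, \<open>c - c\<^sup>3\<close>, and their combination \<open>c\<close>.\<close>

lemma truncation_L2:
  assumes b: "b \<in> L2" and c: "star c = c" and bc: "(b - c * c) * c = c"
  shows "c * c \<in> L2" and "c \<in> L2"
proof -
  have bc': "b * c = c + c * c * c" using bc by (simp add: algebra_simps)
  have bcL2: "b * c \<in> L2" by (rule L2_mult_right[OF b])
  let ?e = "c - c * c * c" and ?p = "2 *\<^sub>R (c * c)"
  have sb: "star (b * c) = c + c * c * c"
    unfolding bc' by (simp add: star_add star_mult c mult.assoc)
  have four: "4 *\<^sub>R x = x + (x + (x + x))" for x :: 'a
    using scaleR_add_left[of 2 2 x] by (simp add: scaleR_2 add.assoc)
  have eq: "star ?p * ?p + star ?e * ?e = star (b * c) * (b * c)"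
    unfolding sb unfolding bc' by (simp add: star_diff star_mult star_scaleR c algebra_simps four)
  have p: "?p \<in> L2" by (rule L2_of_trace_add[OF eq bcL2])
  show "c * c \<in> L2" using L2_scaleR[OF p, of "1/2"] by simp
  have e: "?e \<in> L2"
    by (rule L2_of_trace_add[OF _ bcL2, of _ ?p]) (use eq in \<open>simp add: add.commute\<close>)
  have "(1/2) *\<^sub>R (b * c + ?e) = c" unfolding bc' by (simp flip: scaleR_2)
  then show "c \<in> L2" using L2_scaleR[OF L2_add[OF bcL2 e], of "1/2"] by simp
qed

end


section \<open>The GNS representation\<close>

context gns_space
begin

abbreviation "\<pi> \<equiv> left_mult \<tau> \<eta>"
abbreviation "J \<equiv> conj_J \<tau> \<eta>"

lemma eta_scaleR: "a \<in> L2 \<Longrightarrow> \<eta> (r *\<^sub>R a) = r *\<^sub>R \<eta> a"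
  unfolding scaleR_eq_scaleC by (rule gns_scaleC)

lemma eta_diff: "a \<in> L2 \<Longrightarrow> b \<in> L2 \<Longrightarrow> \<eta> (a - b) = \<eta> a - \<eta> b"
  using gns_add[of a "(-1) *\<^sub>R b"] eta_scaleR[of b "-1"] L2_scaleR[of b "-1"] by simp

lemma eta_zero: "\<eta> 0 = 0"
  using eta_scaleR[OF L2_zero, of 0] by simp

lemma norm_eta_mult_le: "b \<in> L2 \<Longrightarrow> norm (\<eta> (a * b)) \<le> norm a * norm (\<eta> b)"
proof -
  assume b: "b \<in> L2"
  have "ennreal ((norm (\<eta> (a * b)))\<^sup>2) \<le> ennreal ((norm a)\<^sup>2) * ennreal ((norm (\<eta> b))\<^sup>2)"
    using trace_mult_square_le[of a b] gns_norm[OF b] gns_norm[OF L2_mult_left[OF b]] by simp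
  then have "(norm (\<eta> (a * b)))\<^sup>2 \<le> (norm a * norm (\<eta> b))\<^sup>2"
    by (simp add: power_mult_distrib flip: ennreal_mult)
  then show ?thesis by (rule power2_le_imp_le) simp
qed

lemma norm_eta_star: "a \<in> L2 \<Longrightarrow> norm (\<eta> (star a)) = norm (\<eta> a)"
proof -
  assume a: "a \<in> L2"
  have "ennreal ((norm (\<eta> (star a)))\<^sup>2) = ennreal ((norm (\<eta> a))\<^sup>2)"
    using gns_norm[OF a] gns_norm[OF L2_star[OF a]] trace_tracial[of a] by (simp add: star_star)
  then show ?thesis by (simp add: power2_eq_iff_nonneg)
qed

text \<open>Polarisation: the cross terms of \<open>\<bar>x \<plusminus> y\<bar>\<^sup>2\<close> and \<open>\<bar>z \<plusminus> w\<bar>\<^sup>2\<close> agree, so \<open>\<bar>x + y\<bar>\<^sup>2 + \<bar>z - w\<bar>\<^sup>2\<close> and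
  \<open>\<bar>x - y\<bar>\<^sup>2 + \<bar>z + w\<bar>\<^sup>2\<close> are equal sums of squares and have the same trace.\<close>

lemma inner_eta_cong:
  assumes sq: "x \<in> L2" "y \<in> L2" "z \<in> L2" "w \<in> L2"
    and eq: "star x * y + star y * x = star z * w + star w * z"
  shows "inner (\<eta> x) (\<eta> y) = inner (\<eta> z) (\<eta> w)"
proof -
  have id: "star (x + y) * (x + y) + star (z - w) * (z - w) = star (x - y) * (x - y) + star (z + w) * (z + w)"
    using eq by (simp add: star_add star_diff algebra_simps)
  have mem: "x + y \<in> L2" "x - y \<in> L2" "z + w \<in> L2" "z - w \<in> L2"
    using sq by (simp_all add: L2_add L2_diff)
  have "ennreal ((norm (\<eta> (x + y)))\<^sup>2 + (norm (\<eta> (z - w)))\<^sup>2) = ennreal ((norm (\<eta> (x - y)))\<^sup>2 + (norm (\<eta> (z + w)))\<^sup>2)"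
    using arg_cong[OF id, of \<tau>] by (simp add: trace_add_squares gns_norm[OF mem(1), symmetric]
      gns_norm[OF mem(2), symmetric] gns_norm[OF mem(3), symmetric] gns_norm[OF mem(4), symmetric])
  then have "(norm (\<eta> (x + y)))\<^sup>2 + (norm (\<eta> (z - w)))\<^sup>2 = (norm (\<eta> (x - y)))\<^sup>2 + (norm (\<eta> (z + w)))\<^sup>2"
    by (subst (asm) ennreal_inj) auto
  then show ?thesis
    using sq by (simp add: gns_add eta_diff power2_norm_eq_inner inner_simps inner_commute)
qed

lemma inner_eta_star:
  assumes "x \<in> L2" "y \<in> L2"
  shows "inner (\<eta> (star x)) (\<eta> (star y)) = inner (\<eta> x) (\<eta> y)"
proof -
  have "(norm (\<eta> (star x + star y)))\<^sup>2 = (norm (\<eta> (x + y)))\<^sup>2"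
    using norm_eta_star[OF L2_add[OF assms]] by (simp add: star_add)
  then have "(norm (\<eta> (star x) + \<eta> (star y)))\<^sup>2 = (norm (\<eta> x + \<eta> y))\<^sup>2"
    using assms by (simp add: gns_add L2_star)
  moreover have "(norm (\<eta> (star x)))\<^sup>2 = (norm (\<eta> x))\<^sup>2" "(norm (\<eta> (star y)))\<^sup>2 = (norm (\<eta> y))\<^sup>2"
    using norm_eta_star assms by simp_all
  ultimately show ?thesis by (simp add: power2_norm_eq_inner inner_simps inner_commute)
qed

lemma left_mult_spec:
  shows left_mult_eta: "b \<in> L2 \<Longrightarrow> (\<pi> a) (\<eta> b) = \<eta> (a * b)"
    and norm_left_mult_le: "norm (\<pi> a) \<le> norm a"
proof -
  have ne: "L2 \<noteq> {}" using L2_zero by blast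
  have add: "\<exists>z\<in>L2. \<eta> z = \<eta> x + \<eta> y \<and> \<eta> (a * z) = \<eta> (a * x) + \<eta> (a * y)"
    if "x \<in> L2" "y \<in> L2" for x y
    using that by (intro bexI[of _ "x + y"]) (simp_all add: gns_add distrib_left L2_mult_left L2_add)
  have scale: "\<exists>z\<in>L2. \<eta> z = r *\<^sub>R \<eta> x \<and> \<eta> (a * z) = r *\<^sub>R \<eta> (a * x)" if "x \<in> L2" for x r
    using that by (intro bexI[of _ "r *\<^sub>R x"]) (simp_all add: eta_scaleR L2_mult_left L2_scaleR)
  from bounded_linear_extension[OF ne add scale norm_eta_mult_le]
  obtain f where f: "\<And>b. b \<in> L2 \<Longrightarrow> f (\<eta> b) = \<eta> (a * b)"
    and lin: "\<And>x y. f (x + y) = f x + f y" "\<And>r x. f (r *\<^sub>R x) = r *\<^sub>R f x"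
    and bd: "\<And>x. norm (f x) \<le> norm a * norm x"
    unfolding gns_dense by blast
  have bl: "bounded_linear f"
    using lin bd by (intro bounded_linear_intro[where K = "norm a"]) (simp_all add: mult.commute)
  have T: "(Blinfun f) (\<eta> b) = \<eta> (a * b)" if "b \<in> L2" for b
    using f[OF that] by (simp add: bounded_linear_Blinfun_apply[OF bl])
  have eq: "\<pi> a = Blinfun f"
    unfolding left_mult_def
  proof (rule the_equality)
    show "S = Blinfun f" if S: "\<forall>b\<in>L2. S (\<eta> b) = \<eta> (a * b)" for S :: "'h \<Rightarrow>\<^sub>L 'h"
    proof (rule blinfun_eqI)
      show "S x = (Blinfun f) x" for x
        by (rule agree_on_dense[OF _ _ gns_dense]) (use S T in \<open>auto intro!: continuous_intros\<close>)
    qed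
  qed (use T in blast)
  show "b \<in> L2 \<Longrightarrow> (\<pi> a) (\<eta> b) = \<eta> (a * b)"
    unfolding eq by (rule T)
  show "norm (\<pi> a) \<le> norm a"
    unfolding eq by (rule norm_blinfun_bound) (simp_all add: bounded_linear_Blinfun_apply[OF bl] bd)
qed

lemma blinfun_eq_on_eta:
  fixes S T :: "'h \<Rightarrow>\<^sub>L 'h"
  assumes "\<And>b. b \<in> L2 \<Longrightarrow> S (\<eta> b) = T (\<eta> b)"
  shows "S = T"
  by (rule blinfun_eqI, rule agree_on_dense[OF _ _ gns_dense]) (auto intro!: continuous_intros assms)

lemma left_mult_hom:
  "\<pi> (a + b) = \<pi> a + \<pi> b"
  "\<pi> (a - b) = \<pi> a - \<pi> b"
  "\<pi> (a * b) = \<pi> a o\<^sub>L \<pi> b"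
  "\<pi> (c *\<^sub>C a) = scaleC_op c (\<pi> a)"
  by (rule blinfun_eq_on_eta, simp add: left_mult_eta blinfun.add_left blinfun.diff_left scaleC_op_apply
      gns_add eta_diff gns_scaleC distrib_right left_diff_distrib scaleC_mult_left L2_mult_left
      mult.assoc)+

lemma complex_linear_left_mult: "complex_linear_op (\<pi> a)"
  unfolding complex_linear_op_def
proof (intro allI)
  fix c x
  show "(\<pi> a) (c *\<^sub>C x) = c *\<^sub>C (\<pi> a) x"
  proof (rule agree_on_dense[OF _ _ gns_dense, where x = x])
    show "continuous_on UNIV (\<lambda>x. (\<pi> a) (c *\<^sub>C x))"
      by (intro continuous_intros linear_continuous_on[OF bounded_linear_scaleC])
    show "continuous_on UNIV (\<lambda>x. c *\<^sub>C (\<pi> a) x)"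
      by (intro bounded_linear.continuous_on[OF bounded_linear_scaleC] continuous_intros)
  qed (auto simp: left_mult_eta gns_scaleC[symmetric] L2_mult_left L2_scaleC scaleC_mult_right)
qed

lemma adj_left_mult: "adj (\<pi> a) = \<pi> (star a)"
proof (rule adj_eqI[OF complex_linear_left_mult])
  fix x y
  have *: "inner ((\<pi> a) (\<eta> b)) (\<eta> d) = inner (\<eta> b) ((\<pi> (star a)) (\<eta> d))"
    if "b \<in> L2" "d \<in> L2" for b d
    using that
    by (simp add: left_mult_eta) (intro inner_eta_cong, simp_all add: L2_mult_left star_mult star_star mult.assoc)
  have **: "inner ((\<pi> a) x) (\<eta> d) = inner x ((\<pi> (star a)) (\<eta> d))"
    if "d \<in> L2" for d
    by (rule agree_on_dense[OF _ _ gns_dense, where x = x]) (use * that in \<open>auto intro!: continuous_intros\<close>)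
  show "inner ((\<pi> a) x) y = inner x ((\<pi> (star a)) y)"
    by (rule agree_on_dense[OF _ _ gns_dense, where x = y]) (use ** in \<open>auto intro!: continuous_intros\<close>)
qed

lemma conj_J_spec:
  shows conj_J_eta: "a \<in> L2 \<Longrightarrow> J (\<eta> a) = \<eta> (star a)"
    and conj_J_add: "J (\<xi> + \<zeta>) = J \<xi> + J \<zeta>"
    and conj_J_scaleC: "J (c *\<^sub>C \<xi>) = cnj c *\<^sub>C J \<xi>"
    and conj_J_cinner: "cinner (J \<xi>) (J \<zeta>) = cinner \<zeta> \<xi>"
proof -
  have ne: "L2 \<noteq> {}" using L2_zero by blast
  have add: "\<exists>z\<in>L2. \<eta> z = \<eta> x + \<eta> y \<and> \<eta> (star z) = \<eta> (star x) + \<eta> (star y)"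
    if "x \<in> L2" "y \<in> L2" for x y
    using that by (intro bexI[of _ "x + y"]) (simp_all add: gns_add star_add L2_star L2_add)
  have scale: "\<exists>z\<in>L2. \<eta> z = r *\<^sub>R \<eta> x \<and> \<eta> (star z) = r *\<^sub>R \<eta> (star x)" if "x \<in> L2" for x r
    using that by (intro bexI[of _ "r *\<^sub>R x"]) (simp_all add: eta_scaleR star_scaleR L2_star L2_scaleR)
  have bound: "norm (\<eta> (star x)) \<le> 1 * norm (\<eta> x)" if "x \<in> L2" for x
    using norm_eta_star[OF that] by simp
  from bounded_linear_extension[OF ne add scale bound]
  obtain f where f: "\<And>b. b \<in> L2 \<Longrightarrow> f (\<eta> b) = \<eta> (star b)" and cf: "continuous_on UNIV f"
    and add: "\<And>x y. f (x + y) = f x + f y"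
    unfolding gns_dense by blast
  have sc: "f (c *\<^sub>C x) = cnj c *\<^sub>C f x" for c x
  proof (rule agree_on_dense[OF _ _ gns_dense, where x = x])
    show "continuous_on UNIV (\<lambda>x. f (c *\<^sub>C x))"
      by (rule continuous_on_compose2[OF cf linear_continuous_on[OF bounded_linear_scaleC]]) simp
    show "continuous_on UNIV (\<lambda>x. cnj c *\<^sub>C f x)"
      by (rule bounded_linear.continuous_on[OF bounded_linear_scaleC cf])
  qed (auto simp: f gns_scaleC[symmetric] L2_scaleC L2_star star_scaleC)
  have inv: "f (f x) = x" for x
    by (rule agree_on_dense[OF _ continuous_on_id gns_dense, where x = x])
      (auto simp: f L2_star star_star intro: continuous_on_compose2[OF cf cf])
  have *: "inner (f (\<eta> b)) (f (\<eta> d)) = inner (\<eta> b) (\<eta> d)" if "b \<in> L2" "d \<in> L2" for b d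
    using that by (simp add: f inner_eta_star)
  have **: "inner (f x) (f (\<eta> d)) = inner x (\<eta> d)" if "d \<in> L2" for d x
    by (rule agree_on_dense[OF _ _ gns_dense, where x = x]) (use * that cf in \<open>auto intro!: continuous_intros\<close>)
  have inn: "inner (f x) (f y) = inner x y" for x y
    by (rule agree_on_dense[OF _ _ gns_dense, where x = y]) (use ** cf in \<open>auto intro!: continuous_intros\<close>)
  have cin: "cinner (f x) (f y) = cinner y x" for x y
  proof (rule complex_eqI)
    show "Re (cinner (f x) (f y)) = Re (cinner y x)" by (simp add: Re_cinner inn inner_commute)
    have "\<i> *\<^sub>C f x = f ((- \<i>) *\<^sub>C x)" by (simp add: sc)
    then have "Im (cinner (f x) (f y)) = inner ((- \<i>) *\<^sub>C x) y" by (simp add: Im_cinner inn)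
    also have "\<dots> = Im (cinner y x)"
      by (simp add: Re_cinner[symmetric] cinner_scaleC_left cinner_commute[of x y])
    finally show "Im (cinner (f x) (f y)) = Im (cinner y x)" .
  qed
  have eq: "J = f"
    unfolding conj_J_def
  proof (rule the_equality)
    fix j
    assume j: "(\<forall>\<xi> \<zeta>. j (\<xi> + \<zeta>) = j \<xi> + j \<zeta>) \<and> (\<forall>c \<xi>. j (c *\<^sub>C \<xi>) = cnj c *\<^sub>C j \<xi>) \<and>
     (\<forall>\<xi> \<zeta>. cinner (j \<xi>) (j \<zeta>) = cinner \<zeta> \<xi>) \<and> (\<forall>\<xi>. j (j \<xi>) = \<xi>) \<and> (\<forall>a\<in>L2. j (\<eta> a) = \<eta> (star a))"
    have "bounded_linear j"
    proof (rule bounded_linear_intro[where K = 1])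
      show "j (r *\<^sub>R x) = r *\<^sub>R j x" for r x using j unfolding scaleR_eq_scaleC by simp
      have "inner (j x) (j x) = inner x x" for x using j by (simp add: Re_cinner[symmetric])
      then show "norm (j x) \<le> norm x * 1" for x by (simp add: norm_eq_sqrt_inner)
    qed (use j in blast)
    show "j = f"
    proof
      show "j x = f x" for x
        by (rule agree_on_dense[OF linear_continuous_on[OF \<open>bounded_linear j\<close>] cf gns_dense])
          (use j f in auto)
    qed
  qed (use f add sc cin inv in blast)
  show "a \<in> L2 \<Longrightarrow> J (\<eta> a) = \<eta> (star a)" "J (\<xi> + \<zeta>) = J \<xi> + J \<zeta>"
    "J (c *\<^sub>C \<xi>) = cnj c *\<^sub>C J \<xi>" "cinner (J \<xi>) (J \<zeta>) = cinner \<zeta> \<xi>"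
    unfolding eq by (simp_all add: f add sc cin)
qed

end


section \<open>The von Neumann algebra and its trace\<close>

lemma adj_in_commutant:
  assumes S: "\<And>s. s \<in> S \<Longrightarrow> complex_linear_op s \<and> adj s \<in> S" and T: "T \<in> commutant S"
  shows "adj T \<in> commutant S"
proof -
  have cT: "complex_linear_op T" using T by (simp add: commutant_def)
  have "adj T o\<^sub>L s = s o\<^sub>L adj T" if s: "s \<in> S" for s
  proof -
    have cs: "complex_linear_op s" and cas: "complex_linear_op (adj s)"
      using S[OF s] complex_linear_op_adj by blast+
    have "adj s o\<^sub>L T = T o\<^sub>L adj s" using T S[OF s] by (simp add: commutant_def)
    from arg_cong[OF this, of adj] show ?thesis
      by (simp only: adj_binary(3)[OF cas cT] adj_binary(3)[OF cT cas] adj_unary(2)[OF cs])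
  qed
  then show ?thesis using complex_linear_op_adj[OF cT] by (simp add: commutant_def)
qed

context gns_space
begin

abbreviation "\<M> \<equiv> vn_algebra \<tau> \<eta>"

lemma vn_complex_linear: "x \<in> \<M> \<Longrightarrow> complex_linear_op x"
  by (simp add: vn_algebra_def commutant_def)

lemma vn_left_mult: "\<pi> a \<in> \<M>"
  by (auto simp: vn_algebra_def commutant_def complex_linear_left_mult)

lemma vn_ops:
  "x \<in> \<M> \<Longrightarrow> y \<in> \<M> \<Longrightarrow> x + y \<in> \<M>"
  "x \<in> \<M> \<Longrightarrow> y \<in> \<M> \<Longrightarrow> x - y \<in> \<M>"
  "x \<in> \<M> \<Longrightarrow> r *\<^sub>R x \<in> \<M>"
  "x \<in> \<M> \<Longrightarrow> y \<in> \<M> \<Longrightarrow> x o\<^sub>L y \<in> \<M>"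
  "x \<in> \<M> \<Longrightarrow> scaleC_op c x \<in> \<M>"
proof -
  let ?N = "commutant (range \<pi>)"
  have app: "x \<in> \<M> \<longleftrightarrow> complex_linear_op x \<and>
      (\<forall>s\<in>?N. \<forall>\<xi>. x (s \<xi>) = s (x \<xi>))" for x
    by (auto simp: vn_algebra_def commutant_def[of ?N] blinfun_eq_iff)
  have lin: "s (c *\<^sub>C \<xi>) = c *\<^sub>C s \<xi>" if "s \<in> ?N" for s c \<xi>
    using that by (simp add: commutant_def complex_linear_op_def)
  show "x \<in> \<M> \<Longrightarrow> y \<in> \<M> \<Longrightarrow> x + y \<in> \<M>" "x \<in> \<M> \<Longrightarrow> y \<in> \<M> \<Longrightarrow> x - y \<in> \<M>"
    "x \<in> \<M> \<Longrightarrow> r *\<^sub>R x \<in> \<M>" "x \<in> \<M> \<Longrightarrow> y \<in> \<M> \<Longrightarrow> x o\<^sub>L y \<in> \<M>" "x \<in> \<M> \<Longrightarrow> scaleC_op c x \<in> \<M>"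
    unfolding app
    by (simp_all add: complex_linear_op_simps blinfun.add_left blinfun.add_right blinfun.diff_left
        blinfun.diff_right blinfun.scaleR_left blinfun.scaleR_right scaleC_op_apply lin)
qed

text \<open>The generating set \<open>\<pi>(A)\<close> is closed under adjoints, hence so are its commutant and bicommutant.\<close>

lemma vn_adj: "x \<in> \<M> \<Longrightarrow> adj x \<in> \<M>"
  unfolding vn_algebra_def
proof (erule adj_in_commutant[rotated])
  fix s assume s: "s \<in> commutant (range \<pi>)"
  have "adj s \<in> commutant (range \<pi>)"
    by (rule adj_in_commutant[OF _ s]) (auto simp: complex_linear_left_mult adj_left_mult)
  with s show "complex_linear_op s \<and> adj s \<in> commutant (range \<pi>)" by (simp add: commutant_def)
qed

lemma vn_pos_square: "x \<in> \<M> \<Longrightarrow> adj x o\<^sub>L x \<in> vn_pos \<tau> \<eta>"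
  by (simp add: vn_pos_def positive_op_square vn_complex_linear vn_ops vn_adj)

lemma vn_pos_add: "x \<in> vn_pos \<tau> \<eta> \<Longrightarrow> y \<in> vn_pos \<tau> \<eta> \<Longrightarrow> x + y \<in> vn_pos \<tau> \<eta>"
  by (simp add: vn_pos_def positive_op_add vn_ops)

lemma vn_pos_scaleR: "x \<in> vn_pos \<tau> \<eta> \<Longrightarrow> 0 \<le> r \<Longrightarrow> r *\<^sub>R x \<in> vn_pos \<tau> \<eta>"
  by (simp add: vn_pos_def positive_op_scaleR vn_ops)

text \<open>The real part of \<open>\<tau>(c\<^sup>2 a) = \<tau>(c a c)\<close>.\<close>

lemma inner_eta_square:
  assumes "c \<in> L2" "a \<in> L2" "star c = c"
  shows "inner (\<eta> (c * c)) (\<eta> a) = inner (\<eta> c) (\<eta> (a * c))"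
proof -
  have "inner (\<eta> (c * c)) (\<eta> a) = inner (\<eta> c) (\<eta> (c * a))"
    by (rule inner_eta_cong) (simp_all add: assms L2_mult_left star_mult mult.assoc)
  also have "\<dots> = inner (\<eta> (star c)) (\<eta> (star (c * a)))"
    by (rule inner_eta_star[symmetric]) (simp_all add: assms L2_mult_left)
  also have "\<dots> = inner (\<eta> c) (\<eta> (star a * c))" by (simp add: star_mult assms)
  also have "\<dots> = inner (\<eta> c) (\<eta> (a * c))"
    by (rule inner_eta_cong)
      (simp_all add: assms L2_mult_left star_mult star_star mult.assoc add.commute)
  finally show ?thesis .
qed

end

context normal_trace_extension
begin

abbreviation "represents \<equiv> op_represents \<tau> \<eta> \<tau>M"

abbreviation traceM_sq :: "('h \<Rightarrow>\<^sub>L 'h) \<Rightarrow> ennreal" where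
  "traceM_sq x \<equiv> \<tau>M (adj x o\<^sub>L x)"

lemma traceM_sq_left_mult: "traceM_sq (\<pi> a) = \<tau> (star a * a)"
  by (simp add: adj_left_mult left_mult_hom(3)[symmetric] extends square_in_pos_cone)

lemma traceM_sq_left_mult_eta: "a \<in> L2 \<Longrightarrow> traceM_sq (\<pi> a) = ennreal ((norm (\<eta> a))\<^sup>2)"
  by (simp add: traceM_sq_left_mult gns_norm)

lemma traceM_sq_scaleC:
  assumes "x \<in> \<M>"
  shows "traceM_sq (scaleC_op c x) = ennreal ((cmod c)\<^sup>2) * traceM_sq x"
proof -
  note cx = vn_complex_linear[OF assms]
  have "adj (scaleC_op c x) o\<^sub>L scaleC_op c x = (cmod c)\<^sup>2 *\<^sub>R (adj x o\<^sub>L x)"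
    using complex_linear_op_adj[OF cx]
    by (intro blinfun_eqI)
      (simp add: adj_unary(3)[OF cx] scaleC_op_apply blinfun.scaleR_left complex_linear_op_def
        scaleC_scaleC scaleR_eq_scaleC complex_norm_square[symmetric] mult.commute)
  then show ?thesis using traceM_scale[OF vn_pos_square[OF assms]] by simp
qed

lemma traceM_sq_add_le:
  assumes "x \<in> \<M>" "y \<in> \<M>"
  shows "traceM_sq (x + y) \<le> 2 * traceM_sq x + 2 * traceM_sq y"
proof -
  note cl = vn_complex_linear[OF assms(1)] vn_complex_linear[OF assms(2)]
  have "(adj (x + y) o\<^sub>L (x + y)) + (adj (x - y) o\<^sub>L (x - y)) =
      2 *\<^sub>R (adj x o\<^sub>L x) + 2 *\<^sub>R (adj y o\<^sub>L y)"
    by (rule blinfun_eqI)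
      (simp add: adj_binary(1,2)[OF cl] blinfun.add_left blinfun.add_right blinfun.diff_left
        blinfun.diff_right blinfun.scaleR_left scaleR_2)
  from arg_cong[OF this, of \<tau>M]
  have "traceM_sq (x + y) + traceM_sq (x - y) = ennreal 2 * traceM_sq x + ennreal 2 * traceM_sq y"
    using assms by (simp add: traceM_add traceM_scale vn_pos_square vn_pos_scaleR vn_ops)
  then show ?thesis by (simp add: le_iff_add) metis
qed

text \<open>The operator \<open>K\<^sup>2 g g\<^sup>* - g C C\<^sup>* g\<^sup>* = g (K\<^sup>2 - C C\<^sup>*) g\<^sup>*\<close> is positive, and the trace property
  exchanges \<open>y y\<^sup>*\<close> for \<open>y\<^sup>* y\<close>.\<close>

lemma traceM_sq_mult_right_le:
  assumes g: "g \<in> \<M>" and C: "C \<in> \<M>" and K: "norm C \<le> K"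
  shows "traceM_sq (g o\<^sub>L C) \<le> ennreal (K\<^sup>2) * traceM_sq g"
proof -
  note cg = vn_complex_linear[OF g] and cC = vn_complex_linear[OF C]
  define R where "R = K\<^sup>2 *\<^sub>R (g o\<^sub>L adj g) - ((g o\<^sub>L C) o\<^sub>L adj (g o\<^sub>L C))"
  note ops = vn_ops vn_adj g C
  have "positive_op R"
  proof (rule positive_opI)
    show "complex_linear_op R" unfolding R_def
      by (intro vn_complex_linear ops)
    have sq: "adj (x o\<^sub>L adj x) = x o\<^sub>L adj x" if "x \<in> \<M>" for x
    proof -
      note cx = vn_complex_linear[OF that]
      show ?thesis by (simp add: adj_binary(3)[OF cx complex_linear_op_adj[OF cx]] adj_unary(2)[OF cx])
    qed
    show "adj R = R" unfolding R_def
      by (subst adj_binary(2)) (simp_all add: vn_complex_linear ops adj_unary(1) sq)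
    fix x
    let ?y = "(adj g) x"
    have "norm ((adj C) ?y) \<le> K * norm ?y"
      using norm_blinfun[of "adj C" ?y] norm_adj_le[OF cC] K
      by (meson mult_right_mono norm_ge_zero order_trans)
    then have "(norm ((adj C) ?y))\<^sup>2 \<le> (K * norm ?y)\<^sup>2" by (rule power_mono) simp
    moreover have "inner x (R x) = K\<^sup>2 * inner ?y ?y -
        inner ((adj C) ?y) ((adj C) ?y)"
      unfolding R_def
      by (simp add: blinfun.diff_left blinfun.scaleR_left inner_diff_right adj_binary(3)[OF cg cC]
          inner_adj'[OF cg, symmetric] inner_adj'[OF cC, symmetric])
    ultimately show "0 \<le> inner x (R x)"
      by (simp add: power2_norm_eq_inner power_mult_distrib)
  qed
  then have R: "R \<in> vn_pos \<tau> \<eta>" unfolding vn_pos_def R_def by (simp add: ops)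
  have dual: "x o\<^sub>L adj x \<in> vn_pos \<tau> \<eta>" if "x \<in> \<M>" for x
    using vn_pos_square[OF vn_adj[OF that]] vn_complex_linear[OF that] by (simp add: adj_unary(2))
  have "\<tau>M (K\<^sup>2 *\<^sub>R (g o\<^sub>L adj g)) = \<tau>M (((g o\<^sub>L C) o\<^sub>L adj (g o\<^sub>L C)) + R)"
    by (simp add: R_def)
  also have "\<dots> = \<tau>M ((g o\<^sub>L C) o\<^sub>L adj (g o\<^sub>L C)) + \<tau>M R"
    by (intro traceM_add dual R ops)
  finally have "\<tau>M ((g o\<^sub>L C) o\<^sub>L adj (g o\<^sub>L C)) \<le> ennreal (K\<^sup>2) * \<tau>M (g o\<^sub>L adj g)"
    by (simp add: traceM_scale dual g)
  then show ?thesis by (simp add: traceM_tracial ops)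
qed

text \<open>The quantitative form of \<open>\<tau>(c h c) \<le> \<tau>(c\<^sup>2)\<close> for \<open>h \<le> 1\<close>, with \<open>h\<close> replaced by an approximant \<open>a\<close>.  Let
  \<open>C = \<pi>(c)\<close>, \<open>X = \<pi>(a) C\<close>, \<open>Z = (h - \<pi>(a)) C\<close>, and let \<open>P = C\<^sup>2 - C (h + h\<^sup>*) C / 2\<close>, which is positive.  Since
  \<open>X = h C - Z\<close>,
  \<open>\<bar>C + X\<bar>\<^sup>2 + 4 P + 2 \<bar>\<surd>s C + Z / \<surd>s\<bar>\<^sup>2 = \<bar>C - X\<bar>\<^sup>2 + (4 + 2 s) \<bar>C\<bar>\<^sup>2 + (2 / s) \<bar>Z\<bar>\<^sup>2\<close>.
  All terms are positive operators, so the trace may be applied, and \<open>\<bar>C + X\<bar>\<^sup>2 - \<bar>C - X\<bar>\<^sup>2\<close> has trace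
  \<open>4 Re (\<eta>(c), \<eta>(a c))\<close>.\<close>

lemma trace_pairing_le:
  assumes c: "star c = c" "c \<in> L2" and a: "a \<in> L2"
    and h: "h \<in> \<M>" and h_le: "\<And>x. inner x (h x) \<le> (norm x)\<^sup>2"
    and s: "0 < s" and t: "0 \<le> t" "traceM_sq (h - \<pi> a) \<le> ennreal t"
  shows "4 * inner (\<eta> c) (\<eta> (a * c)) \<le> (4 + 2 * s) * (norm (\<eta> c))\<^sup>2 + (2 / s) * ((norm c)\<^sup>2 * t)"
proof -
  define r where "r = sqrt s"
  have r: "r > 0" "r * r = s" using s by (auto simp: r_def)
  define C where "C = \<pi> c"
  define g where "g = h - \<pi> a"
  define Z where "Z = g o\<^sub>L C"
  define X where "X = \<pi> a o\<^sub>L C"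
  note ops = vn_ops vn_adj vn_left_mult h
  have M: "C \<in> \<M>" "g \<in> \<M>" "Z \<in> \<M>" "X \<in> \<M>" unfolding C_def g_def Z_def X_def by (intro ops)+
  note cl = vn_complex_linear
  have aC: "adj C = C" by (simp add: C_def adj_left_mult c)
  have aX: "adj X = C o\<^sub>L adj (\<pi> a)" and aZ: "adj Z = C o\<^sub>L adj g"
    unfolding X_def Z_def by (simp_all add: adj_binary(3) cl M ops aC)
  have ag: "adj g = adj h - adj (\<pi> a)" unfolding g_def by (simp add: adj_binary(2) cl ops)
  define P where "P = (C o\<^sub>L C) - (1/2) *\<^sub>R ((C o\<^sub>L h o\<^sub>L C) + (C o\<^sub>L adj h o\<^sub>L C))"
  define Y where "Y = r *\<^sub>R C + (1/r) *\<^sub>R Z"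
  have YM: "Y \<in> \<M>" unfolding Y_def by (intro ops M)
  have aY: "adj Y = r *\<^sub>R C + (1/r) *\<^sub>R adj Z"
    unfolding Y_def by (simp add: adj_binary(1) adj_unary(1) cl M ops aC)
  have "positive_op P"
  proof (rule positive_opI)
    show "complex_linear_op P" unfolding P_def by (intro cl ops M)
    show "adj P = P" unfolding P_def
      by (simp add: adj_binary adj_unary cl M ops aC blinfun_compose_assoc add.commute)
    fix x
    have "inner x (P x) = (norm (C x))\<^sup>2 - inner (C x) (h (C x))"
    proof -
      have C: "inner x (C y) = inner (C x) y" for y
        using inner_adj[OF cl[OF M(1)], of x y] aC by simp
      have h: "inner z ((adj h) z) = inner z (h z)" for z
        using inner_adj[OF cl[OF h], of z z] by (simp add: inner_commute)
      show ?thesis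
        unfolding P_def power2_norm_eq_inner
        by (simp add: blinfun.diff_left blinfun.scaleR_left blinfun.add_left inner_diff_right
            inner_add_right C h)
    qed
    then show "0 \<le> inner x (P x)" using h_le[of "C x"] by simp
  qed
  then have P: "P \<in> vn_pos \<tau> \<eta>" unfolding vn_pos_def P_def by (simp add: ops M)
  have r0: "r \<noteq> 0" using r by simp
  have rr: "r * (1 / r) = 1" "(1/r) * r = 1" "(1/r) * (1/r) = 1/s" using r by (simp_all flip: r(2))
  have eq: "(adj (C + X) o\<^sub>L (C + X)) + (4 *\<^sub>R P + 2 *\<^sub>R (adj Y o\<^sub>L Y)) =
      (adj (C - X) o\<^sub>L (C - X)) + ((4 + 2 * s) *\<^sub>R (adj C o\<^sub>L C) + (2 / s) *\<^sub>R (adj Z o\<^sub>L Z))"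
  proof (rule blinfun_eqI)
    fix x
    have "4 *\<^sub>R y = y + y + (y + y)" for y :: 'h
      using scaleR_add_left[of 2 2 y] by (simp add: scaleR_2)
    moreover have "(2 / s) *\<^sub>R y = (1 / s) *\<^sub>R y + (1 / s) *\<^sub>R y" "(s * 2) *\<^sub>R y = s *\<^sub>R y + s *\<^sub>R y"
      for y :: 'h by (simp_all flip: scaleR_add_left)
    ultimately show "((adj (C + X) o\<^sub>L (C + X)) + (4 *\<^sub>R P + 2 *\<^sub>R (adj Y o\<^sub>L Y))) x =
      ((adj (C - X) o\<^sub>L (C - X)) + ((4 + 2 * s) *\<^sub>R (adj C o\<^sub>L C) + (2 / s) *\<^sub>R (adj Z o\<^sub>L Z))) x"
      unfolding adj_binary(1,2)[OF cl[OF M(1)] cl[OF M(4)]] aY aC aX aZ ag unfolding P_def Y_def Z_def X_def g_def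
      by (simp add: blinfun.add_left blinfun.add_right blinfun.diff_left blinfun.diff_right
          blinfun.scaleR_left blinfun.scaleR_right scaleR_add_right scaleR_diff_right
          scaleR_add_left rr r(2) r0 scaleR_2 algebra_simps)
  qed
  have "traceM_sq (C + X) + (ennreal 4 * \<tau>M P + ennreal 2 * traceM_sq Y) =
      traceM_sq (C - X) + (ennreal (4 + 2 * s) * traceM_sq C + ennreal (2 / s) * traceM_sq Z)"
    using arg_cong[OF eq, of \<tau>M] s M YM P
    by (simp add: traceM_add traceM_scale vn_pos_square vn_pos_scaleR vn_pos_add vn_ops)
  then have "traceM_sq (C + X) \<le>
      traceM_sq (C - X) + (ennreal (4 + 2 * s) * traceM_sq C + ennreal (2 / s) * traceM_sq Z)"
    by (metis le_iff_add)
  also have "traceM_sq Z \<le> ennreal ((norm c)\<^sup>2 * t)"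
  proof -
    have "traceM_sq Z \<le> ennreal ((norm c)\<^sup>2) * traceM_sq g"
      unfolding Z_def by (rule traceM_sq_mult_right_le[OF M(2,1)]) (simp add: C_def norm_left_mult_le)
    also have "\<dots> \<le> ennreal ((norm c)\<^sup>2) * ennreal t"
      using t(2) unfolding g_def by (rule mult_left_mono) simp
    finally show ?thesis using t(1) by (simp add: ennreal_mult)
  qed
  finally have main: "traceM_sq (C + X) \<le>
      traceM_sq (C - X) + (ennreal (4 + 2 * s) * traceM_sq C + ennreal (2 / s) * ennreal ((norm c)\<^sup>2 * t))"
    by (simp add: add_left_mono mult_left_mono)
  have CX: "C + X = \<pi> (c + a * c)" "C - X = \<pi> (c - a * c)"
    by (simp_all add: C_def X_def left_mult_hom)
  have mem: "a * c \<in> L2" "c + a * c \<in> L2" "c - a * c \<in> L2"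
    using c a by (simp_all add: L2_mult_left L2_add L2_diff)
  have "ennreal ((norm (\<eta> (c + a * c)))\<^sup>2) \<le>
      ennreal ((norm (\<eta> (c - a * c)))\<^sup>2 + ((4 + 2 * s) * (norm (\<eta> c))\<^sup>2 + (2 / s) * ((norm c)\<^sup>2 * t)))"
  proof -
    have "ennreal x + (ennreal k1 * ennreal y1 + ennreal k2 * ennreal y2) = ennreal (x + (k1 * y1 + k2 * y2))"
      if "0 \<le> x" "0 \<le> k1" "0 \<le> k2" "0 \<le> y1" "0 \<le> y2" for x k1 k2 y1 y2
      using that by (simp add: ennreal_mult)
    from this[of "(norm (\<eta> (c - a * c)))\<^sup>2" "4 + 2 * s" "2 / s" "(norm (\<eta> c))\<^sup>2" "(norm c)\<^sup>2 * t"]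
    show ?thesis
      using main s t(1) unfolding CX
      unfolding C_def traceM_sq_left_mult_eta[OF mem(2)] traceM_sq_left_mult_eta[OF mem(3)]
        traceM_sq_left_mult_eta[OF c(2)]
      by (simp del: ennreal_plus)
  qed
  then have "(norm (\<eta> (c + a * c)))\<^sup>2 \<le>
      (norm (\<eta> (c - a * c)))\<^sup>2 + ((4 + 2 * s) * (norm (\<eta> c))\<^sup>2 + (2 / s) * ((norm c)\<^sup>2 * t))"
    using s t(1) by (subst (asm) ennreal_le_iff) auto
  then show ?thesis
    using c mem by (simp add: gns_add eta_diff power2_norm_eq_inner inner_simps inner_commute)
qed

text \<open>Along the approximants of \<open>h\<close> the error term is eventually at most \<open>(2 / s) \<parallel>c\<parallel>\<^sup>2 s\<^sup>2\<close>; after the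
  limit, \<open>s\<close> tends to \<open>0\<close>.\<close>

lemma op_represents_pairing_le:
  assumes c: "star c = c" "c \<in> L2" and rep: "represents h \<xi>"
    and h_le: "\<And>x. inner x (h x) \<le> (norm x)\<^sup>2"
  shows "inner (\<eta> (c * c)) \<xi> \<le> (norm (\<eta> c))\<^sup>2"
proof -
  obtain a where h: "h \<in> \<M>" and a: "\<And>k::nat. a k \<in> L2" "(\<lambda>k. \<eta> (a k)) \<longlonglongrightarrow> \<xi>"
    and lim: "(\<lambda>k. traceM_sq (h - \<pi> (a k))) \<longlonglongrightarrow> 0"
    using rep unfolding op_represents_def by blast
  define K where "K = 2 * (norm (\<eta> c))\<^sup>2 + 2 * (norm c)\<^sup>2"
  have bound: "4 * inner (\<eta> (c * c)) \<xi> \<le> 4 * (norm (\<eta> c))\<^sup>2 + s * K" if s: "0 < s" for s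
  proof (rule tendsto_upperbound)
    show "(\<lambda>k. 4 * inner (\<eta> (c * c)) (\<eta> (a k))) \<longlonglongrightarrow> 4 * inner (\<eta> (c * c)) \<xi>"
      by (intro tendsto_intros a)
    have "\<forall>\<^sub>F k in sequentially. traceM_sq (h - \<pi> (a k)) < ennreal (s * s)"
      using s by (intro order_tendstoD(2)[OF lim]) simp
    then show "\<forall>\<^sub>F k in sequentially. 4 * inner (\<eta> (c * c)) (\<eta> (a k)) \<le> 4 * (norm (\<eta> c))\<^sup>2 + s * K"
    proof eventually_elim
      case (elim k)
      have "4 * inner (\<eta> c) (\<eta> (a k * c)) \<le>
          (4 + 2 * s) * (norm (\<eta> c))\<^sup>2 + (2 / s) * ((norm c)\<^sup>2 * (s * s))"
        using elim s by (intro trace_pairing_le[OF c a(1) h h_le s]) auto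
      also have "\<dots> = 4 * (norm (\<eta> c))\<^sup>2 + s * K"
        using s by (simp add: K_def field_simps)
      finally show ?case using inner_eta_square[OF c(2) a(1) c(1)] by simp
    qed
  qed simp
  have "0 \<le> K" by (simp add: K_def)
  from le_of_le_add_scaled[OF bound this] show ?thesis by simp
qed

lemma op_represents_left_mult: "a \<in> L2 \<Longrightarrow> represents (\<pi> a) (\<eta> a)"
proof -
  assume a: "a \<in> L2"
  have "traceM_sq (\<pi> a - \<pi> a) = 0"
    using traceM_sq_left_mult[of 0] left_mult_hom(2)[of a a] by (simp add: trace_zero)
  then show ?thesis
    using a unfolding op_represents_def
    by (intro conjI exI[of _ "\<lambda>_. a"]) (simp_all add: vn_left_mult traceM_sq_left_mult_eta)
qed

text \<open>Two approximating sequences of the same operator become close for the trace norm on \<open>\<M>\<close>, which on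
  \<open>\<pi>(A)\<close> is the norm of \<open>L\<^sup>2\<close>.\<close>

lemma op_represents_unique:
  assumes "represents x \<xi>" "represents x \<zeta>"
  shows "\<xi> = \<zeta>"
proof -
  obtain a where x: "x \<in> \<M>" and a: "\<And>k::nat. a k \<in> L2" "(\<lambda>k. \<eta> (a k)) \<longlonglongrightarrow> \<xi>"
    and la: "(\<lambda>k. traceM_sq (x - \<pi> (a k))) \<longlonglongrightarrow> 0"
    using assms(1) unfolding op_represents_def by blast
  obtain b where b: "\<And>k::nat. b k \<in> L2" "(\<lambda>k. \<eta> (b k)) \<longlonglongrightarrow> \<zeta>"
    and lb: "(\<lambda>k. traceM_sq (x - \<pi> (b k))) \<longlonglongrightarrow> 0"
    using assms(2) unfolding op_represents_def by blast
  have neg: "traceM_sq (y - x) = traceM_sq (x - y)" if "y \<in> \<M>" for y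
  proof -
    have "scaleC_op (-1) (x - y) = y - x"
      by (rule blinfun_eqI) (simp add: scaleC_op_apply scaleC_minus_left blinfun.diff_left)
    then show ?thesis using traceM_sq_scaleC[of "x - y" "-1"] that x by (simp add: vn_ops)
  qed
  have le: "ennreal ((norm (\<eta> (a k) - \<eta> (b k)))\<^sup>2) \<le> 2 * traceM_sq (x - \<pi> (a k)) + 2 * traceM_sq (x - \<pi> (b k))" for k
  proof -
    have "ennreal ((norm (\<eta> (a k) - \<eta> (b k)))\<^sup>2) = traceM_sq ((\<pi> (a k) - x) + (x - \<pi> (b k)))"
      using traceM_sq_left_mult_eta[OF L2_diff[OF a(1) b(1)], of k k] a(1) b(1)
      by (simp add: eta_diff left_mult_hom)
    also have "\<dots> \<le> 2 * traceM_sq (\<pi> (a k) - x) + 2 * traceM_sq (x - \<pi> (b k))"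
      by (intro traceM_sq_add_le vn_ops vn_left_mult x)
    finally show ?thesis by (simp add: neg vn_left_mult)
  qed
  have "(\<lambda>k. 2 * traceM_sq (x - \<pi> (a k)) + 2 * traceM_sq (x - \<pi> (b k))) \<longlonglongrightarrow> 2 * 0 + 2 * 0"
    by (intro tendsto_add ennreal_tendsto_cmult la lb) auto
  then have lim: "(\<lambda>k. 2 * traceM_sq (x - \<pi> (a k)) + 2 * traceM_sq (x - \<pi> (b k))) \<longlonglongrightarrow> 0" by simp
  have "(\<lambda>k. ennreal ((norm (\<eta> (a k) - \<eta> (b k)))\<^sup>2)) \<longlonglongrightarrow> 0"
    by (rule ennreal_squeeze_zero[OF le lim])
  moreover have "(\<lambda>k. ennreal ((norm (\<eta> (a k) - \<eta> (b k)))\<^sup>2)) \<longlonglongrightarrow> ennreal ((norm (\<xi> - \<zeta>))\<^sup>2)"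
    by (intro tendsto_ennrealI tendsto_intros a b)
  ultimately have "ennreal ((norm (\<xi> - \<zeta>))\<^sup>2) = 0" by (rule LIMSEQ_unique[rotated])
  then show ?thesis by simp
qed

lemma op_vec_eq: "represents x \<xi> \<Longrightarrow> op_vec \<tau> \<eta> \<tau>M x = \<xi>"
  unfolding op_vec_def using op_represents_unique by blast

lemma op_represents_add:
  assumes "represents x \<xi>" "represents y \<zeta>"
  shows "represents (x + y) (\<xi> + \<zeta>)"
proof -
  obtain a where x: "x \<in> \<M>" "traceM_sq x < \<infinity>" and a: "\<And>k::nat. a k \<in> L2" "(\<lambda>k. \<eta> (a k)) \<longlonglongrightarrow> \<xi>"
    and la: "(\<lambda>k. traceM_sq (x - \<pi> (a k))) \<longlonglongrightarrow> 0"
    using assms(1) unfolding op_represents_def by blast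
  obtain b where y: "y \<in> \<M>" "traceM_sq y < \<infinity>" and b: "\<And>k::nat. b k \<in> L2" "(\<lambda>k. \<eta> (b k)) \<longlonglongrightarrow> \<zeta>"
    and lb: "(\<lambda>k. traceM_sq (y - \<pi> (b k))) \<longlonglongrightarrow> 0"
    using assms(2) unfolding op_represents_def by blast
  have "2 * traceM_sq x + 2 * traceM_sq y < \<infinity>" using x y by (simp add: ennreal_mult_less_top)
  then have fin: "traceM_sq (x + y) < \<infinity>" using traceM_sq_add_le[OF x(1) y(1)] by (rule le_less_trans[rotated])
  have eq: "x + y - \<pi> (a k + b k) = (x - \<pi> (a k)) + (y - \<pi> (b k))" for k
    by (simp add: left_mult_hom)
  have "(\<lambda>k. 2 * traceM_sq (x - \<pi> (a k)) + 2 * traceM_sq (y - \<pi> (b k))) \<longlonglongrightarrow> 2 * 0 + 2 * 0"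
    by (intro tendsto_add ennreal_tendsto_cmult la lb) auto
  then have lim: "(\<lambda>k. 2 * traceM_sq (x - \<pi> (a k)) + 2 * traceM_sq (y - \<pi> (b k))) \<longlonglongrightarrow> 0" by simp
  have "(\<lambda>k. traceM_sq (x + y - \<pi> (a k + b k))) \<longlonglongrightarrow> 0"
    unfolding eq
    by (rule ennreal_squeeze_zero[OF _ lim]) (intro traceM_sq_add_le vn_ops vn_left_mult x y)
  moreover have "(\<lambda>k. \<eta> (a k + b k)) \<longlonglongrightarrow> \<xi> + \<zeta>"
    using tendsto_add[OF a(2) b(2)] a(1) b(1) by (simp add: gns_add)
  ultimately show ?thesis
    unfolding op_represents_def using fin x y a(1) b(1) L2_add vn_ops(1)
    by (intro conjI exI[of _ "\<lambda>k. a k + b k"]) auto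
qed

lemma op_represents_scaleC:
  assumes "represents x \<xi>"
  shows "represents (scaleC_op c x) (c *\<^sub>C \<xi>)"
proof -
  obtain a where x: "x \<in> \<M>" "traceM_sq x < \<infinity>" and a: "\<And>k::nat. a k \<in> L2" "(\<lambda>k. \<eta> (a k)) \<longlonglongrightarrow> \<xi>"
    and la: "(\<lambda>k. traceM_sq (x - \<pi> (a k))) \<longlonglongrightarrow> 0"
    using assms unfolding op_represents_def by blast
  have eq: "scaleC_op c x - \<pi> (c *\<^sub>C a k) = scaleC_op c (x - \<pi> (a k))" for k
    by (rule blinfun_eqI) (simp add: left_mult_hom scaleC_op_apply blinfun.diff_left scaleC_diff_right)
  have "(\<lambda>k. ennreal ((cmod c)\<^sup>2) * traceM_sq (x - \<pi> (a k))) \<longlonglongrightarrow> ennreal ((cmod c)\<^sup>2) * 0"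
    by (intro ennreal_tendsto_cmult la) auto
  then have "(\<lambda>k. traceM_sq (scaleC_op c x - \<pi> (c *\<^sub>C a k))) \<longlonglongrightarrow> 0"
    unfolding eq using x(1) by (simp add: traceM_sq_scaleC vn_ops vn_left_mult)
  moreover have "(\<lambda>k. \<eta> (c *\<^sub>C a k)) \<longlonglongrightarrow> c *\<^sub>C \<xi>"
    using bounded_linear.tendsto[OF bounded_linear_scaleC a(2)] a(1) by (simp add: gns_scaleC)
  ultimately show ?thesis
    unfolding op_represents_def using x a(1)
    by (intro conjI exI[of _ "\<lambda>k. c *\<^sub>C a k"])
      (auto simp: vn_ops traceM_sq_scaleC ennreal_mult_less_top L2_scaleC)
qed

end


section \<open>Positive functionals\<close>

lemma positive_functionalD:
  assumes "positive_functional \<omega>"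
  shows "bounded_linear \<omega>" "\<omega> (c *\<^sub>C x) = c * \<omega> x" "0 \<le> Re (\<omega> (star x * x))" "Im (\<omega> (star x * x)) = 0"
proof -
  have "\<omega> (star x * x) \<in> \<real>\<^sub>\<ge>\<^sub>0" using assms by (auto simp: positive_functional_def pos_cone_def)
  then show "0 \<le> Re (\<omega> (star x * x))" "Im (\<omega> (star x * x)) = 0"
    by (simp_all add: complex_nonneg_Reals_iff)
qed (use assms in \<open>auto simp: positive_functional_def\<close>)

text \<open>A self-adjoint element is a difference of two squares.\<close>

lemma positive_functional_selfadjoint:
  assumes \<omega>: "positive_functional \<omega>" and a: "star a = a"
  shows "Im (\<omega> a) = 0"
proof -
  obtain c d where "star c = c" "star d = d" "a = c * c - d * d"
    using positive_negative_parts[OF a] by blast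
  then have "\<omega> a = \<omega> (star c * c) - \<omega> (star d * d)"
    using linear_diff[OF bounded_linear.linear[OF positive_functionalD(1)[OF \<omega>]]] by simp
  then show ?thesis by (simp add: positive_functionalD(4)[OF \<omega>])
qed

lemma positive_functional_Re_star:
  assumes \<omega>: "positive_functional \<omega>"
  shows "Re (\<omega> (star a)) = Re (\<omega> a)"
proof -
  note lin = bounded_linear.linear[OF positive_functionalD(1)[OF \<omega>]]
  have "star (\<i> *\<^sub>C (a - star a)) = \<i> *\<^sub>C (a - star a)"
    by (simp add: star_scaleC star_diff star_star scaleC_minus_left scaleC_diff_right)
  then have "Im (\<i> * (\<omega> a - \<omega> (star a))) = 0"
    using positive_functional_selfadjoint[OF \<omega>, of "\<i> *\<^sub>C (a - star a)"]
    by (simp add: positive_functionalD(2)[OF \<omega>] linear_diff[OF lin])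
  then show ?thesis by simp
qed

lemma dual_norm_bound:
  assumes "bounded_linear (\<omega> :: 'a::real_normed_vector \<Rightarrow> complex)"
  shows "cmod (\<omega> x) \<le> dual_norm UNIV \<omega> * norm x" and "0 \<le> dual_norm UNIV \<omega>"
proof -
  interpret bounded_linear \<omega> by fact
  have bdd: "bdd_above ((\<lambda>x. cmod (\<omega> x)) ` {x \<in> UNIV. norm x \<le> 1})"
  proof (rule bdd_aboveI2)
    fix x :: 'a assume "x \<in> {x \<in> UNIV. norm x \<le> 1}"
    then show "cmod (\<omega> x) \<le> onorm \<omega>"
      using onorm[OF assms, of x] mult_left_mono[of "norm x" 1 "onorm \<omega>"] onorm_pos_le[OF assms] by simp
  qed
  have up: "cmod (\<omega> y) \<le> dual_norm UNIV \<omega>" if "norm y \<le> 1" for y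
    unfolding dual_norm_def by (rule cSUP_upper[OF _ bdd]) (use that in simp)
  from up[of 0] show "0 \<le> dual_norm UNIV \<omega>" by (simp add: zero)
  show "cmod (\<omega> x) \<le> dual_norm UNIV \<omega> * norm x"
  proof (cases "x = 0")
    case False
    have "cmod (\<omega> ((1 / norm x) *\<^sub>R x)) \<le> dual_norm UNIV \<omega>" by (rule up) (use False in simp)
    then show ?thesis using False by (simp add: scaleR field_simps)
  qed (simp add: zero)
qed


section \<open>The form domain as a Hilbert space\<close>

context dirichlet_form
begin

abbreviation "\<B> \<equiv> form_algebra \<tau> \<eta> F"

text \<open>The real part of the form inner product, customarily written \<open>\<E>\<^sub>1\<close>.\<close>

definition E1 :: "'h \<Rightarrow> 'h \<Rightarrow> real" where
  "E1 \<xi> \<zeta> = Re (F_inner E \<xi> \<zeta>)"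

lemma F_zero: "0 \<in> F" and F_add: "\<xi> \<in> F \<Longrightarrow> \<zeta> \<in> F \<Longrightarrow> \<xi> + \<zeta> \<in> F"
  and F_scaleC: "\<xi> \<in> F \<Longrightarrow> c *\<^sub>C \<xi> \<in> F" and F_scaleR: "\<xi> \<in> F \<Longrightarrow> r *\<^sub>R \<xi> \<in> F"
  using domain_subspace by (auto simp: csubspace_def scaleR_eq_scaleC)

lemma F_subspace: "subspace F"
  by (simp add: subspace_def F_zero F_add F_scaleR)

lemmas F_diff = subspace_diff[OF F_subspace]

lemma F_inner_scaleC: "\<xi> \<in> F \<Longrightarrow> \<zeta> \<in> F \<Longrightarrow> F_inner E \<xi> (c *\<^sub>C \<zeta>) = c * F_inner E \<xi> \<zeta>"
  by (simp add: F_inner_def form_scaleC cinner_scaleC_right distrib_left)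

lemma F_inner_add: "\<xi> \<in> F \<Longrightarrow> \<zeta> \<in> F \<Longrightarrow> \<theta> \<in> F \<Longrightarrow> F_inner E \<xi> (\<zeta> + \<theta>) = F_inner E \<xi> \<zeta> + F_inner E \<xi> \<theta>"
  by (simp add: F_inner_def form_add cinner_add_right)

lemma E1_self: "E1 \<xi> \<xi> = Re (E \<xi> \<xi>) + (norm \<xi>)\<^sup>2"
  by (simp add: E1_def F_inner_def Re_cinner power2_norm_eq_inner)

lemma norm_le_E1: "\<xi> \<in> F \<Longrightarrow> (norm \<xi>)\<^sup>2 \<le> E1 \<xi> \<xi>"
  using form_nonneg[of \<xi>] by (simp add: E1_self)

lemma F_norm_eq: "F_norm E \<xi> = sqrt (E1 \<xi> \<xi>)"
  by (simp add: F_norm_def E1_def)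

text \<open>A closed form is complete for its form norm: a Cauchy sequence converges in \<open>L\<^sup>2\<close>, and closedness
  upgrades this to convergence of the energies.\<close>

sublocale energy: complete_form F E1
proof
  show "subspace F" by (rule F_subspace)
  show "E1 x (y + z) = E1 x y + E1 x z" if "x \<in> F" "y \<in> F" "z \<in> F" for x y z
    using that by (simp add: E1_def F_inner_add)
  show "E1 x (r *\<^sub>R y) = r * E1 x y" if "x \<in> F" "y \<in> F" for x y r
    using that by (simp add: E1_def scaleR_eq_scaleC F_inner_scaleC)
  show "E1 x y = E1 y x" if "x \<in> F" "y \<in> F" for x y
    using that form_hermitian[of x y] cinner_commute[of x y] by (simp add: E1_def F_inner_def)
  show "0 \<le> E1 x x" if "x \<in> F" for x
    using norm_le_E1[OF that] by (smt (verit) zero_le_power2)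
  fix u :: "nat \<Rightarrow> 'h"
  assume u: "\<And>n. u n \<in> F"
    and cauchy: "\<And>e. e > 0 \<Longrightarrow> \<exists>N. \<forall>m\<ge>N. \<forall>n\<ge>N. E1 (u m - u n) (u m - u n) < e"
  have d: "u m - u n \<in> F" for m n by (intro F_diff u)
  have "Cauchy u" by (rule Cauchy_of_square_le[OF norm_le_E1[OF d] cauchy])
  then obtain v where v: "u \<longlonglongrightarrow> v" using Cauchy_convergent convergent_def by blast
  have "\<forall>e>0. \<exists>N. \<forall>k\<ge>N. \<forall>l\<ge>N. Re (E (u k - u l) (u k - u l)) < e"
  proof (intro allI impI)
    fix e :: real assume "e > 0"
    then obtain N where N: "\<forall>m\<ge>N. \<forall>n\<ge>N. E1 (u m - u n) (u m - u n) < e"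
      using cauchy by blast
    have "Re (E (u m - u n) (u m - u n)) \<le> E1 (u m - u n) (u m - u n)" for m n
      by (simp add: E1_self)
    then show "\<exists>N. \<forall>k\<ge>N. \<forall>l\<ge>N. Re (E (u k - u l) (u k - u l)) < e"
      using N by (meson le_less_trans)
  qed
  then have *: "v \<in> F" "(\<lambda>k. Re (E (u k - v) (u k - v))) \<longlonglongrightarrow> 0"
    using form_closed[OF _ v] u by blast+
  have "(\<lambda>n. Re (E (u n - v) (u n - v)) + (norm (u n - v))\<^sup>2) \<longlonglongrightarrow> 0 + (norm (v - v))\<^sup>2"
    by (intro tendsto_intros * v)
  then show "\<exists>v\<in>F. (\<lambda>n. E1 (u n - v) (u n - v)) \<longlonglongrightarrow> 0"
    using *(1) by (auto simp: E1_self)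
qed

lemma E1_diff_le:
  assumes "x \<in> F" "y \<in> F"
  shows "E1 (x - y) (x - y) \<le> 2 * E1 x x + 2 * E1 y y"
    and "E1 (x + y) (x + y) \<le> 2 * E1 x x + 2 * E1 y y"
  using energy.form_pos[OF F_add[OF assms]] energy.form_pos[OF F_diff[OF assms]] assms
  by (simp_all add: energy.form_simps)

lemma J_scaleR: "J (r *\<^sub>R \<xi>) = r *\<^sub>R J \<xi>"
  by (simp add: scaleR_eq_scaleC conj_J_scaleC)

lemma J_diff: "J (\<xi> - \<zeta>) = J \<xi> - J \<zeta>"
  using conj_J_add[of \<xi> "(-1) *\<^sub>R \<zeta>"] J_scaleR[of "-1" \<zeta>] by simp

lemma inner_J: "inner (J \<xi>) (J \<zeta>) = inner \<xi> \<zeta>"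
  using conj_J_cinner[of \<xi> \<zeta>] by (simp add: Re_cinner[symmetric] cinner_commute[of \<xi> \<zeta>])

lemma norm_J: "norm (J \<xi>) = norm \<xi>"
  by (simp add: norm_eq_sqrt_inner inner_J)

lemma J_in_F: "\<xi> \<in> F \<Longrightarrow> J \<xi> \<in> F" and E1_J: "\<xi> \<in> F \<Longrightarrow> E1 (J \<xi>) (J \<xi>) = E1 \<xi> \<xi>"
  using form_real[of \<xi>] by (simp_all add: E1_self norm_J)

lemma form_algebraD:
  "b \<in> \<B> \<Longrightarrow> b \<in> L2" "b \<in> \<B> \<Longrightarrow> \<eta> b \<in> F"
  by (simp_all add: form_algebra_def)

lemma form_algebra_closed:
  "a \<in> \<B> \<Longrightarrow> b \<in> \<B> \<Longrightarrow> a + b \<in> \<B>" "a \<in> \<B> \<Longrightarrow> b \<in> \<B> \<Longrightarrow> a - b \<in> \<B>"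
  "b \<in> \<B> \<Longrightarrow> r *\<^sub>R b \<in> \<B>" "b \<in> \<B> \<Longrightarrow> c *\<^sub>C b \<in> \<B>" "b \<in> \<B> \<Longrightarrow> star b \<in> \<B>"
  using J_in_F[of "\<eta> b"]
  by (auto simp: form_algebra_def L2_add L2_diff L2_scaleR
      L2_scaleC L2_star gns_add eta_diff eta_scaleR gns_scaleC F_add F_diff
      F_scaleR F_scaleC conj_J_eta)

lemma eta_inj: "inj_on \<eta> L2"
proof (rule inj_onI)
  fix a b assume a: "a \<in> L2" and b: "b \<in> L2" and "\<eta> a = \<eta> b"
  then have "\<tau> (star (a - b) * (a - b)) = 0"
    using gns_norm[OF L2_diff[OF a b]] by (simp add: eta_diff)
  then have "star (a - b) * (a - b) = 0" by (rule faithful[OF square_in_pos_cone])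
  then have "norm (a - b) = 0" using cstar_identity[of "a - b"] by simp
  then show "a = b" by simp
qed

lemma core_sequence:
  assumes "\<xi> \<in> F"
  shows "\<exists>b. (\<forall>n::nat. b n \<in> \<B>) \<and> (\<lambda>n. E1 (\<eta> (b n) - \<xi>) (\<eta> (b n) - \<xi>)) \<longlonglongrightarrow> 0"
proof -
  have "\<exists>b\<in>\<B>. E1 (\<eta> b - \<xi>) (\<eta> b - \<xi>) \<le> 1 / real (Suc n)" for n
  proof -
    obtain b where b: "b \<in> \<B>" "F_norm E (\<xi> - \<eta> b) < sqrt (1 / real (Suc n))"
      using regular_core[OF assms, of "sqrt (1 / real (Suc n))"] by auto
    have d: "\<xi> - \<eta> b \<in> F" "\<eta> b - \<xi> \<in> F" using b assms form_algebraD F_diff by blast+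
    have "E1 (\<eta> b - \<xi>) (\<eta> b - \<xi>) = E1 (\<xi> - \<eta> b) (\<xi> - \<eta> b)"
      using assms form_algebraD(2)[OF b(1)] by (simp add: energy.form_simps)
    with b show ?thesis by (intro bexI[of _ b]) (simp_all add: F_norm_eq)
  qed
  then obtain b where b: "\<And>n. b n \<in> \<B>" "\<And>n. E1 (\<eta> (b n) - \<xi>) (\<eta> (b n) - \<xi>) \<le> 1 / real (Suc n)"
    by metis
  have "(\<lambda>n. 1 / real (Suc n)) \<longlonglongrightarrow> 0"
    using LIMSEQ_inverse_real_of_nat by (simp add: divide_inverse)
  then have "(\<lambda>n. E1 (\<eta> (b n) - \<xi>) (\<eta> (b n) - \<xi>)) \<longlonglongrightarrow> 0"
    by (rule nonneg_squeeze_zero[OF energy.form_pos[OF F_diff[OF form_algebraD(2)[OF b(1)] assms]] b(2)])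
  then show ?thesis using b(1) by blast
qed


section \<open>Truncation in the form algebra\<close>

text \<open>The hypothesis on \<open>\<zeta>\<close> says that \<open>b - q = c\<^sup>2\<close> and \<open>q - \<zeta>\<close> have nonnegative inner product, because
  \<open>q c = c\<close> makes the inner product of \<open>c\<^sup>2\<close> and \<open>q\<close> equal to \<open>\<parallel>\<eta>(c)\<parallel>\<^sup>2\<close>.\<close>

lemma truncation_pythagoras:
  assumes c: "star c = c" "c \<in> L2" and qsq: "q \<in> L2"
    and qc: "q * c = c" and b: "b = q + c * c"
    and \<zeta>: "inner (\<eta> (c * c)) \<zeta> \<le> (norm (\<eta> c))\<^sup>2"
  shows "(norm (\<eta> b - \<eta> q))\<^sup>2 + (norm (\<eta> q - \<zeta>))\<^sup>2 \<le> (norm (\<eta> b - \<zeta>))\<^sup>2"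
proof -
  have "inner (\<eta> (c * c)) (\<eta> q) = (norm (\<eta> c))\<^sup>2"
    using inner_eta_square[OF c(2) qsq c(1)] by (simp add: qc power2_norm_eq_inner)
  with \<zeta> have "0 \<le> inner (\<eta> (c * c)) (\<eta> q - \<zeta>)" by (simp add: inner_diff_right)
  moreover have "\<eta> b = \<eta> q + \<eta> (c * c)"
    unfolding b by (rule gns_add[OF qsq L2_mult_left[OF c(2)]])
  ultimately show ?thesis
    by (simp add: power2_norm_eq_inner inner_simps inner_commute)
qed

text \<open>By the Pythagorean inequality \<open>\<eta>(b - c\<^sup>2)\<close> is the nearest point to \<open>\<eta>(b)\<close> among the vectors below \<open>1\<close>,
  so it is \<open>\<eta>(b) \<and> 1\<close> and the Markov property applies.  The last conjunct, that truncation decreases the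
  distance to \<open>\<zeta>\<close>, is for vectors \<open>\<zeta>\<close> that come from \<open>\<M>\<close> and not from \<open>A\<close>.\<close>

lemma truncation_in_form_algebra:
  assumes b: "b \<in> \<B>" "star b = b"
  shows "\<exists>c k l. star c = c \<and> star k = k \<and> star l = l \<and> c \<in> L2 \<and> c * c \<in> \<B> \<and>
    b - c * c \<in> \<B> \<and> b - c * c = k * k - l * l \<and> norm (k * k) \<le> 1 \<and>
    E1 (\<eta> (b - c * c)) (\<eta> (b - c * c)) \<le> E1 (\<eta> b) (\<eta> b) \<and>
    (\<forall>\<zeta>. inner (\<eta> (c * c)) \<zeta> \<le> (norm (\<eta> c))\<^sup>2 \<longrightarrow> norm (\<eta> (b - c * c) - \<zeta>) \<le> norm (\<eta> b - \<zeta>))"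
proof -
  obtain c f k l where c: "star c = c" and f: "star f = f" and k: "star k = k" and l: "star l = l"
    and cc: "(b - c * c) * c = c" and qf: "b - c * c = f + f - f * f" and kl: "b - c * c = k * k - l * l"
    and kk: "norm (k * k) \<le> 1"
    using truncation_at_one[OF b(2)] by blast
  define q where "q = b - c * c"
  have bsq: "b \<in> L2" and bF: "\<eta> b \<in> F" using b form_algebraD by blast+
  note csq = truncation_L2[OF bsq c cc]
  have qsq: "q \<in> L2" unfolding q_def by (rule L2_diff[OF bsq csq(1)])
  have pyth: "(norm (\<eta> b - \<eta> q))\<^sup>2 + (norm (\<eta> q - \<zeta>))\<^sup>2 \<le> (norm (\<eta> b - \<zeta>))\<^sup>2"
    if "inner (\<eta> (c * c)) \<zeta> \<le> (norm (\<eta> c))\<^sup>2" for \<zeta>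
    by (rule truncation_pythagoras[OF c csq(2) qsq _ _ that]) (simp_all add: q_def cc)
  let ?K = "below_one \<tau> \<eta>"
  have "op_le (\<pi> q) id_blinfun"
    unfolding op_le_def
  proof (rule positive_opI)
    have sq: "star q = q" by (simp add: q_def star_diff star_mult c b)
    show "complex_linear_op (id_blinfun - \<pi> q)"
      by (intro complex_linear_op_simps complex_linear_left_mult)
    show "adj (id_blinfun - \<pi> q) = id_blinfun - \<pi> q"
      by (simp add: adj_binary(2) complex_linear_op_simps complex_linear_left_mult adj_left_mult sq adj_id)
    fix x
    have fa: "inner x ((\<pi> f) y) = inner ((\<pi> f) x) y" for y
      using inner_adj[OF complex_linear_left_mult, of f x y] by (simp add: adj_left_mult f)
    have "inner x ((id_blinfun - \<pi> q) x) =
        (norm (x - (\<pi> f) x))\<^sup>2"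
      using fa[of "(\<pi> f) x"] inner_commute[of x "(\<pi> f) x"]
      unfolding q_def qf power2_norm_eq_inner
      by (simp add: left_mult_hom blinfun.diff_left blinfun.add_left inner_simps)
    then show "0 \<le> inner x ((id_blinfun - \<pi> q) x)" by simp
  qed
  moreover have "star q = q" by (simp add: q_def star_diff star_mult c b)
  ultimately have qK: "\<eta> q \<in> ?K"
    unfolding below_one_def using qsq closure_subset by (intro set_mp[OF closure_subset]) auto
  have "inner (\<eta> (c * c)) \<zeta> \<le> (norm (\<eta> c))\<^sup>2" if "\<zeta> \<in> ?K" for \<zeta>
  proof -
    have "?K \<subseteq> {\<zeta>. inner (\<eta> (c * c)) \<zeta> \<le> (norm (\<eta> c))\<^sup>2}"
      unfolding below_one_def
    proof (rule closure_minimal)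
      show "closed {\<zeta>. inner (\<eta> (c * c)) \<zeta> \<le> (norm (\<eta> c))\<^sup>2}"
        by (intro closed_Collect_le continuous_intros)
      show "\<eta> ` {a \<in> L2. star a = a \<and> op_le (\<pi> a) id_blinfun} \<subseteq> {\<zeta>. inner (\<eta> (c * c)) \<zeta> \<le> (norm (\<eta> c))\<^sup>2}"
      proof clarify
        fix a assume a: "a \<in> L2" "op_le (\<pi> a) id_blinfun"
        have "inner x ((\<pi> a) x) \<le> (norm x)\<^sup>2" for x
        proof -
          have "cinner x ((id_blinfun - \<pi> a) x) \<in> \<real>\<^sub>\<ge>\<^sub>0"
            using a(2) unfolding op_le_def positive_op_def by blast
          then show ?thesis
            by (simp add: complex_nonneg_Reals_iff Re_cinner blinfun.diff_left inner_diff_right power2_norm_eq_inner)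
        qed
        then show "inner (\<eta> (c * c)) (\<eta> a) \<le> (norm (\<eta> c))\<^sup>2"
          by (rule op_represents_pairing_le[OF c csq(2) op_represents_left_mult[OF a(1)]])
      qed
    qed
    then show ?thesis using that by blast
  qed
  then have pythK: "(norm (\<eta> b - \<eta> q))\<^sup>2 + (norm (\<eta> q - \<zeta>))\<^sup>2 \<le> (norm (\<eta> b - \<zeta>))\<^sup>2" if "\<zeta> \<in> ?K" for \<zeta>
    using pyth that by blast
  have wedge: "wedge_one \<tau> \<eta> (\<eta> b) = \<eta> q"
    unfolding wedge_one_def nearest_def
  proof (rule the_equality)
    have "norm (\<eta> b - \<eta> q) \<le> norm (\<eta> b - \<zeta>)" if "\<zeta> \<in> ?K" for \<zeta>
    proof (rule power2_le_imp_le)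
      show "(norm (\<eta> b - \<eta> q))\<^sup>2 \<le> (norm (\<eta> b - \<zeta>))\<^sup>2"
        using pythK[OF that] zero_le_power2[of "norm (\<eta> q - \<zeta>)"] by linarith
    qed simp
    then show "\<eta> q \<in> ?K \<and> (\<forall>\<zeta>\<in>?K. dist (\<eta> b) (\<eta> q) \<le> dist (\<eta> b) \<zeta>)"
      using qK by (simp add: dist_norm)
    fix p assume p: "p \<in> ?K \<and> (\<forall>\<zeta>\<in>?K. dist (\<eta> b) p \<le> dist (\<eta> b) \<zeta>)"
    then have pK: "p \<in> ?K" and "norm (\<eta> b - p) \<le> norm (\<eta> b - \<eta> q)" using qK by (simp_all add: dist_norm)
    then have "(norm (\<eta> b - p))\<^sup>2 \<le> (norm (\<eta> b - \<eta> q))\<^sup>2" by (intro power_mono) simp_all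
    with pythK[OF pK] have "(norm (\<eta> q - p))\<^sup>2 \<le> 0" by linarith
    then show "p = \<eta> q" by simp
  qed
  have "J (\<eta> b) = \<eta> b" using bsq by (simp add: conj_J_eta b)
  from form_markovian[OF bF this] have q: "\<eta> q \<in> F" "Re (E (\<eta> q) (\<eta> q)) \<le> Re (E (\<eta> b) (\<eta> b))"
    unfolding wedge by blast+
  have contr: "norm (\<eta> q - \<zeta>) \<le> norm (\<eta> b - \<zeta>)" if "inner (\<eta> (c * c)) \<zeta> \<le> (norm (\<eta> c))\<^sup>2" for \<zeta>
  proof (rule power2_le_imp_le)
    show "(norm (\<eta> q - \<zeta>))\<^sup>2 \<le> (norm (\<eta> b - \<zeta>))\<^sup>2"
      using pyth[OF that] zero_le_power2[of "norm (\<eta> b - \<eta> q)"] by linarith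
  qed simp
  have "norm (\<eta> q) \<le> norm (\<eta> b)" using contr[of 0] by simp
  then have "(norm (\<eta> q))\<^sup>2 \<le> (norm (\<eta> b))\<^sup>2" by (rule power_mono) simp
  then have "E1 (\<eta> q) (\<eta> q) \<le> E1 (\<eta> b) (\<eta> b)"
    using q(2) unfolding E1_self by linarith
  moreover have qB: "q \<in> \<B>" using q qsq by (simp add: form_algebra_def)
  moreover have "c * c = b - q" by (simp add: q_def)
  then have "c * c \<in> \<B>" using form_algebra_closed(2)[OF b(1) qB] by simp
  ultimately show ?thesis
    using c k l csq(2) kl kk contr unfolding q_def by blast
qed


section \<open>Finite-energy functionals and their potentials\<close>

context
  fixes \<omega> :: "'a \<Rightarrow> complex"
  assumes fin: "finite_energy \<tau> \<eta> E F \<omega>"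
begin

lemma \<omega>_positive: "positive_functional \<omega>"
  using fin by (simp add: finite_energy_def)

lemmas \<omega>_bounded = positive_functionalD(1)[OF \<omega>_positive]
lemmas \<omega>_linear = bounded_linear.linear[OF \<omega>_bounded]
lemmas \<omega>_scaleC = positive_functionalD(2)[OF \<omega>_positive]

abbreviation "W \<equiv> dual_norm UNIV \<omega>"

lemma W_nonneg: "0 \<le> W"
  by (rule dual_norm_bound(2)[OF \<omega>_bounded])

text \<open>For \<open>q = k\<^sup>2 - l\<^sup>2\<close> the negative part lowers \<open>\<omega>(q)\<close> and the positive part is a contraction.\<close>

lemma Re_functional_le:
  assumes "star k = k" "star l = l" "norm (k * k) \<le> 1"
  shows "Re (\<omega> (k * k - l * l)) \<le> W"
proof -
  have "Re (\<omega> (k * k - l * l)) = Re (\<omega> (k * k)) - Re (\<omega> (star l * l))"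
    using assms by (simp add: linear_diff[OF \<omega>_linear])
  also have "\<dots> \<le> cmod (\<omega> (k * k))"
    using positive_functionalD(3)[OF \<omega>_positive, of l] complex_Re_le_cmod[of "\<omega> (k * k)"] by linarith
  also have "\<dots> \<le> W * norm (k * k)" by (rule dual_norm_bound(1)[OF \<omega>_bounded])
  also have "\<dots> \<le> W" using assms(3) W_nonneg by (simp add: mult_left_le)
  finally show ?thesis .
qed

text \<open>Split \<open>b = (b - e)\<^sub>+ + b \<and> e\<close> by truncating \<open>d = b / e\<close> at \<open>1\<close>.  The form norm of \<open>(b - e)\<^sub>+\<close> is at most
  twice that of \<open>b\<close>, and the value at \<open>b \<and> e\<close> is at most \<open>e W\<close>, which disappears as \<open>e \<rightarrow> 0\<close>.\<close>

lemma finite_energy_bounded_selfadjoint: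
  "\<exists>K\<ge>0. \<forall>b\<in>\<B>. star b = b \<longrightarrow> Re (\<omega> b) \<le> K * F_norm E (\<eta> b)"
proof -
  obtain c0 where c0: "c0 \<ge> 0"
    and bd: "\<And>b. b \<in> \<B> \<Longrightarrow> \<eta> b \<in> L2_pos \<tau> \<eta> \<Longrightarrow> Re (\<omega> b) \<le> c0 * F_norm E (\<eta> b)"
    using fin unfolding finite_energy_def by blast
  have "Re (\<omega> b) \<le> 2 * c0 * F_norm E (\<eta> b)" if b: "b \<in> \<B>" "star b = b" for b
  proof -
    have scaled: "Re (\<omega> b) \<le> 2 * c0 * F_norm E (\<eta> b) + e * W" if e: "0 < e" for e
    proof -
      define d where "d = (1 / e) *\<^sub>R b"
      have d: "d \<in> \<B>" "star d = d" using b by (simp_all add: d_def form_algebra_closed star_scaleR)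
      obtain c k l where c: "star c = c" "c \<in> L2" "c * c \<in> \<B>" and kl: "star k = k" "star l = l"
        "d - c * c = k * k - l * l" "norm (k * k) \<le> 1" and q: "d - c * c \<in> \<B>"
        "E1 (\<eta> (d - c * c)) (\<eta> (d - c * c)) \<le> E1 (\<eta> d) (\<eta> d)"
        using truncation_in_form_algebra[OF d] by blast
      have "\<eta> (c * c) \<in> L2_pos \<tau> \<eta>"
        unfolding L2_pos_def using c square_in_pos_cone[of c] form_algebraD(1)[OF c(3)]
        by (intro set_mp[OF closure_subset] imageI) simp
      then have "Re (\<omega> (c * c)) \<le> c0 * F_norm E (\<eta> (c * c))" by (rule bd[OF c(3)])
      also have "F_norm E (\<eta> (c * c)) \<le> 2 * F_norm E (\<eta> d)"
      proof -
        have "\<eta> (c * c) = \<eta> d - \<eta> (d - c * c)"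
          using eta_diff[OF form_algebraD(1)[OF d(1)] form_algebraD(1)[OF q(1)]] by simp
        then have "E1 (\<eta> (c * c)) (\<eta> (c * c)) \<le> 4 * E1 (\<eta> d) (\<eta> d)"
          using E1_diff_le(1)[OF form_algebraD(2)[OF d(1)] form_algebraD(2)[OF q(1)]] q(2) by simp
        then have "sqrt (E1 (\<eta> (c * c)) (\<eta> (c * c))) \<le> sqrt (4 * E1 (\<eta> d) (\<eta> d))"
          by (rule real_sqrt_le_mono)
        then show ?thesis by (simp add: F_norm_eq real_sqrt_mult)
      qed
      finally have 1: "Re (\<omega> (c * c)) \<le> c0 * (2 * F_norm E (\<eta> d))" using c0 by (simp add: mult_left_mono)
      have "\<omega> d = \<omega> (c * c) + \<omega> (d - c * c)" by (simp add: linear_diff[OF \<omega>_linear])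
      moreover have "Re (\<omega> (d - c * c)) \<le> W" unfolding kl(3) by (rule Re_functional_le[OF kl(1,2,4)])
      ultimately have "Re (\<omega> d) \<le> c0 * (2 * F_norm E (\<eta> d)) + W" using 1 by simp
      then have "e * Re (\<omega> d) \<le> e * (c0 * (2 * F_norm E (\<eta> d)) + W)"
        using e by (intro mult_left_mono) auto
      moreover have "e * Re (\<omega> d) = Re (\<omega> b)"
        using e by (simp add: d_def linear_scale[OF \<omega>_linear])
      moreover have "e * F_norm E (\<eta> d) = F_norm E (\<eta> b)"
      proof -
        have "E1 (\<eta> d) (\<eta> d) = (1 / e)\<^sup>2 * E1 (\<eta> b) (\<eta> b)"
          using form_algebraD[OF b(1)] by (simp add: d_def eta_scaleR energy.form_simps power2_eq_square)
        then show ?thesis using e by (simp add: F_norm_eq real_sqrt_mult)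
      qed
      moreover have "e * (c0 * (2 * F_norm E (\<eta> d)) + W) = 2 * c0 * (e * F_norm E (\<eta> d)) + e * W"
        by (simp add: algebra_simps)
      ultimately show ?thesis by simp
    qed
    show ?thesis by (rule le_of_le_add_scaled[OF scaled W_nonneg])
  qed
  then show ?thesis using c0 by (intro exI[of _ "2 * c0"]) auto
qed

text \<open>\<open>Re \<omega>\<close> sees the self-adjoint part \<open>x\<close> of \<open>b\<close> alone, whose form norm is at most that of \<open>b\<close>; the
  preceding bound is applied to \<open>x\<close> and \<open>- x\<close>.\<close>

lemma finite_energy_bounded:
  "\<exists>K\<ge>0. \<forall>b\<in>\<B>. (Re (\<omega> b))\<^sup>2 \<le> K * E1 (\<eta> b) (\<eta> b)"
proof -
  obtain K where K: "K \<ge> 0" and bd: "\<And>b. b \<in> \<B> \<Longrightarrow> star b = b \<Longrightarrow> Re (\<omega> b) \<le> K * F_norm E (\<eta> b)"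
    using finite_energy_bounded_selfadjoint by blast
  have "(Re (\<omega> b))\<^sup>2 \<le> K\<^sup>2 * E1 (\<eta> b) (\<eta> b)" if b: "b \<in> \<B>" for b
  proof -
    define x where "x = (1/2) *\<^sub>R (b + star b)"
    have x: "x \<in> \<B>" "star x = x" "- x \<in> \<B>" "star (- x) = - x"
      using b form_algebra_closed(3)[of x "-1"]
      by (simp_all add: x_def form_algebra_closed star_scaleR star_add star_star add.commute star_minus)
    have "\<eta> x = (1/2) *\<^sub>R (\<eta> b + J (\<eta> b))"
      using form_algebraD(1)[OF b] form_algebraD(1)[OF form_algebra_closed(5)[OF b]]
      by (simp add: x_def eta_scaleR L2_add gns_add conj_J_eta)
    then have le: "E1 (\<eta> x) (\<eta> x) \<le> E1 (\<eta> b) (\<eta> b)"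
      using E1_diff_le(2)[OF form_algebraD(2)[OF b] J_in_F[OF form_algebraD(2)[OF b]]]
        form_algebraD(2)[OF b] J_in_F[OF form_algebraD(2)[OF b]]
      by (simp add: energy.form_scaleR_left energy.form_scaleR_right F_add F_scaleR E1_J)
    have "\<eta> (- x) = (-1) *\<^sub>R \<eta> x" using eta_scaleR[OF form_algebraD(1)[OF x(1)], of "-1"] by simp
    then have "E1 (\<eta> (- x)) (\<eta> (- x)) = E1 (\<eta> x) (\<eta> x)"
      using form_algebraD(2)[OF x(1)] by (simp only: energy.form_scaleR_left energy.form_scaleR_right F_scaleR)
    then have "\<bar>Re (\<omega> x)\<bar> \<le> K * sqrt (E1 (\<eta> x) (\<eta> x))"
      using bd[OF x(1,2)] bd[OF x(3,4)] by (auto simp: F_norm_eq linear_neg[OF \<omega>_linear])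
    then have "\<bar>Re (\<omega> x)\<bar>\<^sup>2 \<le> (K * sqrt (E1 (\<eta> x) (\<eta> x)))\<^sup>2" by (rule power_mono) simp
    then have "(Re (\<omega> x))\<^sup>2 \<le> K\<^sup>2 * E1 (\<eta> x) (\<eta> x)"
      using energy.form_pos[OF form_algebraD(2)[OF x(1)]] by (simp add: power_mult_distrib)
    also have "\<dots> \<le> K\<^sup>2 * E1 (\<eta> b) (\<eta> b)" using le by (rule mult_left_mono) simp
    also have "Re (\<omega> x) = Re (\<omega> b)"
      by (simp add: x_def linear_scale[OF \<omega>_linear] linear_add[OF \<omega>_linear] positive_functional_Re_star[OF \<omega>_positive])
    finally show ?thesis .
  qed
  then show ?thesis by (intro exI[of _ "K\<^sup>2"]) simp
qed

abbreviation "G \<equiv> potential \<tau> \<eta> E F \<omega>"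

text \<open>The Riesz theorem represents \<open>Re \<omega>\<close>, transported to \<open>\<eta>(\<B>)\<close> along the injective \<open>\<eta>\<close>; imaginary parts
  follow by evaluation at \<open>- i b\<close>.  Uniqueness holds because \<open>\<B>\<close> is a core.\<close>

lemma potential_spec: "G \<in> F \<and> (\<forall>b\<in>\<B>. \<omega> b = F_inner E G (\<eta> b))"
proof -
  obtain K where K: "\<And>b. b \<in> \<B> \<Longrightarrow> (Re (\<omega> b))\<^sup>2 \<le> K * E1 (\<eta> b) (\<eta> b)"
    using finite_energy_bounded by blast
  define f where "f x = Re (\<omega> (inv_into \<B> \<eta> x))" for x
  have inj: "inj_on \<eta> \<B>" by (rule inj_on_subset[OF eta_inj]) (auto simp: form_algebra_def)
  have f: "f (\<eta> b) = Re (\<omega> b)" if "b \<in> \<B>" for b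
    by (simp add: f_def inv_into_f_f[OF inj that])
  have z: "0 \<in> \<B>" using form_algebra_closed(3) regular_core[OF F_zero zero_less_one] by (metis scaleR_zero_left)
  have "\<exists>g\<in>F. \<forall>x\<in>\<eta> ` \<B>. E1 g x = f x"
  proof (rule energy.riesz_representation)
    show "subspace (\<eta> ` \<B>)"
      unfolding subspace_def
    proof (intro conjI ballI allI)
      show "0 \<in> \<eta> ` \<B>" using z eta_zero by (metis imageI)
      show "x + y \<in> \<eta> ` \<B>" if "x \<in> \<eta> ` \<B>" "y \<in> \<eta> ` \<B>" for x y
        using that form_algebra_closed(1) by (auto simp: gns_add[symmetric] form_algebraD)
      show "r *\<^sub>R x \<in> \<eta> ` \<B>" if "x \<in> \<eta> ` \<B>" for r x
        using that form_algebra_closed(3) by (auto simp: eta_scaleR[symmetric] form_algebraD)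
    qed
    show "f (x + y) = f x + f y" if "x \<in> \<eta> ` \<B>" "y \<in> \<eta> ` \<B>" for x y
      using that by (auto simp: gns_add[symmetric] form_algebraD f form_algebra_closed linear_add[OF \<omega>_linear])
    show "f (r *\<^sub>R x) = r * f x" if "x \<in> \<eta> ` \<B>" for r x
      using that by (auto simp: eta_scaleR[symmetric] form_algebraD f form_algebra_closed linear_scale[OF \<omega>_linear])
    show "(f x)\<^sup>2 \<le> K * E1 x x" if "x \<in> \<eta> ` \<B>" for x
      using that K f by auto
  qed (use form_algebraD in auto)
  then obtain g where g: "g \<in> F" "\<And>b. b \<in> \<B> \<Longrightarrow> E1 g (\<eta> b) = Re (\<omega> b)" using f by auto
  have "\<omega> b = F_inner E g (\<eta> b)" if b: "b \<in> \<B>" for b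
  proof (rule complex_eqI)
    show "Re (\<omega> b) = Re (F_inner E g (\<eta> b))" using g(2)[OF b] by (simp add: E1_def)
    have "E1 g (\<eta> ((- \<i>) *\<^sub>C b)) = Re (\<omega> ((- \<i>) *\<^sub>C b))"
      by (intro g(2) form_algebra_closed b)
    then show "Im (\<omega> b) = Im (F_inner E g (\<eta> b))"
      using form_algebraD[OF b] g(1) by (simp add: E1_def gns_scaleC F_inner_scaleC \<omega>_scaleC)
  qed
  then have ex: "g \<in> F \<and> (\<forall>b\<in>\<B>. \<omega> b = F_inner E g (\<eta> b))" using g(1) by blast
  have unique: "g' = g" if g': "g' \<in> F \<and> (\<forall>b\<in>\<B>. \<omega> b = F_inner E g' (\<eta> b))" for g'
  proof -
    define d where "d = g' - g"
    have dF: "d \<in> F" using g' g(1) by (simp add: d_def F_diff)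
    have orth: "E1 d (\<eta> b) = 0" if b: "b \<in> \<B>" for b
    proof -
      have "E1 g' (\<eta> b) = E1 g (\<eta> b)"
        using g' ex b unfolding E1_def by metis
      then show ?thesis using g' g(1) form_algebraD(2)[OF b] by (simp add: d_def energy.form_diff_left)
    qed
    obtain b where b: "\<And>n::nat. b n \<in> \<B>" "(\<lambda>n. E1 (\<eta> (b n) - d) (\<eta> (b n) - d)) \<longlonglongrightarrow> 0"
      using core_sequence[OF dF] by blast
    have "(\<lambda>n. E1 d (\<eta> (b n))) \<longlonglongrightarrow> E1 d d"
      by (rule energy.form_tendsto(1)[OF form_algebraD(2)[OF b(1)] dF b(2) dF])
    then have "E1 d d = 0" using orth[OF b(1)] by (simp add: LIMSEQ_const_iff)
    then have "(norm d)\<^sup>2 \<le> 0" using norm_le_E1[OF dF] by simp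
    then show ?thesis by (simp add: d_def)
  qed
  show ?thesis unfolding potential_def by (rule theI[of _ g]) (fact ex, fact unique)
qed

lemma G_in_F: "G \<in> F" and potential_eq: "b \<in> \<B> \<Longrightarrow> F_inner E G (\<eta> b) = \<omega> b"
  using potential_spec by auto

text \<open>The elements \<open>b n \<in> \<B>\<close> converge to \<open>\<xi>\<close> in the form norm, so their self-adjoint parts \<open>a n\<close> converge to
  \<open>\<zeta> = (\<xi> + J \<xi>) / 2\<close>, at which \<open>G\<close> has the same real pairing as at \<open>\<xi>\<close>.  The truncations \<open>q n\<close> of \<open>a n\<close> are
  bounded in the form norm, converge to \<open>\<zeta>\<close> in \<open>L\<^sup>2\<close>, and satisfy \<open>Re \<omega>(q n) \<le> W\<close>.\<close>

lemma potential_pairing_le: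
  fixes x :: "'h \<Rightarrow>\<^sub>L 'h"
  assumes rep: "represents x \<xi>" and \<xi>: "\<xi> \<in> F"
    and x_le: "\<And>z. inner z (x z) \<le> (norm z)\<^sup>2"
  shows "E1 G \<xi> \<le> W"
proof -
  obtain b where b: "\<And>n::nat. b n \<in> \<B>" and blim: "(\<lambda>n. E1 (\<eta> (b n) - \<xi>) (\<eta> (b n) - \<xi>)) \<longlonglongrightarrow> 0"
    using core_sequence[OF \<xi>] by blast
  define a where "a n = (1/2) *\<^sub>R (b n + star (b n))" for n
  define \<zeta> where "\<zeta> = (1/2) *\<^sub>R (\<xi> + J \<xi>)"
  have a: "a n \<in> \<B>" "star (a n) = a n" for n
    using b by (simp_all add: a_def form_algebra_closed star_scaleR star_add star_star add.commute)
  have aF: "\<eta> (a n) \<in> F" and bF: "\<eta> (b n) \<in> F" for n using a b form_algebraD by blast+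
  have JF: "J \<xi> \<in> F" by (rule J_in_F[OF \<xi>])
  have \<zeta>F: "\<zeta> \<in> F" unfolding \<zeta>_def by (intro F_scaleR F_add \<xi> JF)
  have ale: "E1 (\<eta> (a n) - \<zeta>) (\<eta> (a n) - \<zeta>) \<le> E1 (\<eta> (b n) - \<xi>) (\<eta> (b n) - \<xi>)" for n
  proof -
    let ?d = "\<eta> (b n) - \<xi>"
    have dF: "?d \<in> F" "J ?d \<in> F" using bF \<xi> F_diff J_in_F by blast+
    have "\<eta> (a n) = (1/2) *\<^sub>R (\<eta> (b n) + J (\<eta> (b n)))"
      using form_algebraD(1)[OF b] form_algebraD(1)[OF form_algebra_closed(5)[OF b]]
      by (simp add: a_def eta_scaleR L2_add gns_add conj_J_eta)
    then have "\<eta> (a n) - \<zeta> = (1/2) *\<^sub>R (?d + J ?d)"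
      by (simp add: \<zeta>_def J_diff algebra_simps)
    then show ?thesis
      using E1_diff_le(2)[OF dF] dF
      by (simp add: energy.form_scaleR_left energy.form_scaleR_right F_add F_scaleR E1_J[OF dF(1)])
  qed
  have alim: "(\<lambda>n. E1 (\<eta> (a n) - \<zeta>) (\<eta> (a n) - \<zeta>)) \<longlonglongrightarrow> 0"
    by (rule nonneg_squeeze_zero[OF energy.form_pos[OF F_diff[OF aF \<zeta>F]] ale blim])
  have same: "E1 G \<zeta> = E1 G \<xi>"
  proof (rule LIMSEQ_unique)
    show "(\<lambda>n. E1 G (\<eta> (a n))) \<longlonglongrightarrow> E1 G \<zeta>"
      by (rule energy.form_tendsto(1)[OF aF \<zeta>F alim G_in_F])
    have "(\<lambda>n. E1 G (\<eta> (b n))) \<longlonglongrightarrow> E1 G \<xi>"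
      by (rule energy.form_tendsto(1)[OF bF \<xi> blim G_in_F])
    moreover have "E1 G (\<eta> (b n)) = E1 G (\<eta> (a n))" for n
    proof -
      have "Re (\<omega> (b n)) = Re (\<omega> (a n))"
        by (simp add: a_def linear_scale[OF \<omega>_linear] linear_add[OF \<omega>_linear]
            positive_functional_Re_star[OF \<omega>_positive])
      then show ?thesis by (simp add: E1_def potential_eq b a)
    qed
    ultimately show "(\<lambda>n. E1 G (\<eta> (a n))) \<longlonglongrightarrow> E1 G \<xi>" by simp
  qed
  have "\<exists>q. q \<in> \<B> \<and> Re (\<omega> q) \<le> W \<and> E1 (\<eta> q) (\<eta> q) \<le> E1 (\<eta> (a n)) (\<eta> (a n)) \<and>
      norm (\<eta> q - \<zeta>) \<le> norm (\<eta> (a n) - \<zeta>)" for n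
  proof -
    obtain c k l where c: "star c = c" "c \<in> L2" "c * c \<in> \<B>" and kl: "star k = k" "star l = l"
        "a n - c * c = k * k - l * l" "norm (k * k) \<le> 1" and q: "a n - c * c \<in> \<B>"
        "E1 (\<eta> (a n - c * c)) (\<eta> (a n - c * c)) \<le> E1 (\<eta> (a n)) (\<eta> (a n))"
      and contr: "\<And>\<zeta>. inner (\<eta> (c * c)) \<zeta> \<le> (norm (\<eta> c))\<^sup>2 \<Longrightarrow> norm (\<eta> (a n - c * c) - \<zeta>) \<le> norm (\<eta> (a n) - \<zeta>)"
      using truncation_in_form_algebra[OF a] by blast
    \<comment> \<open>so \<open>\<zeta>\<close> and \<open>\<xi>\<close> have the same inner product with \<open>\<eta>(c\<^sup>2)\<close>\<close>
    have "J (\<eta> (c * c)) = \<eta> (c * c)"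
      using form_algebraD(1)[OF c(3)] by (simp add: conj_J_eta star_mult c)
    then have "inner (\<eta> (c * c)) (J \<xi>) = inner (\<eta> (c * c)) \<xi>" by (metis inner_J)
    then have "inner (\<eta> (c * c)) \<zeta> \<le> (norm (\<eta> c))\<^sup>2"
      using op_represents_pairing_le[OF c(1,2) rep x_le] by (simp add: \<zeta>_def inner_add_right)
    from contr[OF this] show ?thesis
      using q Re_functional_le[OF kl(1,2,4)] unfolding kl(3)[symmetric] by blast
  qed
  then obtain q where q: "\<And>n. q n \<in> \<B>" "\<And>n. Re (\<omega> (q n)) \<le> W"
    "\<And>n. E1 (\<eta> (q n)) (\<eta> (q n)) \<le> E1 (\<eta> (a n)) (\<eta> (a n))"
    "\<And>n. norm (\<eta> (q n) - \<zeta>) \<le> norm (\<eta> (a n) - \<zeta>)"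
    by metis
  have "(\<lambda>n. E1 (\<eta> (a n)) (\<eta> (a n))) \<longlonglongrightarrow> E1 \<zeta> \<zeta>"
    by (rule energy.form_tendsto(2)[OF aF \<zeta>F alim])
  then have "Bseq (\<lambda>n. E1 (\<eta> (a n)) (\<eta> (a n)))" by (rule convergent_imp_Bseq[OF convergentI])
  then obtain R where R: "\<And>n. norm (E1 (\<eta> (a n)) (\<eta> (a n))) \<le> R" unfolding Bseq_def by blast
  have "E1 G \<zeta> \<le> W"
  proof (rule energy.half_space_closed_under_bounded_limits[where u = "\<lambda>n. \<eta> (q n)" and R = R])
    show "(norm x)\<^sup>2 \<le> E1 x x" if "x \<in> F" for x by (rule norm_le_E1[OF that])
    show "G \<in> F" by (rule G_in_F)
    show "\<zeta> \<in> F" by (rule \<zeta>F)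
    show "\<eta> (q n) \<in> F" for n by (rule form_algebraD(2)[OF q(1)])
    show "E1 (\<eta> (q n)) (\<eta> (q n)) \<le> R" for n
      using q(3)[of n] R[of n] by simp
    show "E1 G (\<eta> (q n)) \<le> W" for n
      using q(2)[of n] potential_eq[OF q(1)] by (simp add: E1_def)
    show "(\<lambda>n. \<eta> (q n)) \<longlonglongrightarrow> \<zeta>"
    proof (rule LIM_zero_cancel, rule tendsto_norm_zero_cancel)
      have "(\<lambda>n. sqrt (E1 (\<eta> (a n) - \<zeta>) (\<eta> (a n) - \<zeta>))) \<longlonglongrightarrow> sqrt 0"
        by (intro tendsto_intros alim)
      then have lim: "(\<lambda>n. sqrt (E1 (\<eta> (a n) - \<zeta>) (\<eta> (a n) - \<zeta>))) \<longlonglongrightarrow> 0" by simp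
      have "norm (\<eta> (q n) - \<zeta>) \<le> sqrt (E1 (\<eta> (a n) - \<zeta>) (\<eta> (a n) - \<zeta>))" for n
        using q(4)[of n] norm_le_E1[OF F_diff[OF aF \<zeta>F], of n] by (meson order_trans real_le_rsqrt)
      then show "(\<lambda>n. norm (\<eta> (q n) - \<zeta>)) \<longlonglongrightarrow> 0"
        by (rule nonneg_squeeze_zero[OF norm_ge_zero _ lim])
    qed
  qed
  then show ?thesis using same by simp
qed

lemma potential_pairing_le_scaled:
  fixes x :: "'h \<Rightarrow>\<^sub>L 'h"
  assumes rep: "represents x \<xi>" and \<xi>: "\<xi> \<in> F" and t: "0 < t"
    and x_le: "\<And>z. inner z (x z) \<le> t * (norm z)\<^sup>2"
  shows "E1 G \<xi> \<le> t * W"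
proof -
  have "E1 G ((1 / t) *\<^sub>R \<xi>) \<le> W"
  proof (rule potential_pairing_le)
    show "represents ((1 / t) *\<^sub>R x) ((1 / t) *\<^sub>R \<xi>)"
      using op_represents_scaleC[OF rep, of "complex_of_real (1 / t)"]
      unfolding scaleC_op_of_real scaleC_of_real .
    show "(1 / t) *\<^sub>R \<xi> \<in> F" by (rule F_scaleR[OF \<xi>])
    show "inner z (((1 / t) *\<^sub>R x) z) \<le> (norm z)\<^sup>2" for z
      using x_le[of z] t by (simp add: blinfun.scaleR_left field_simps)
  qed
  then show ?thesis
    using t \<xi> G_in_F by (simp add: energy.form_scaleR_right field_simps)
qed


section \<open>Extension to the fine C*-algebra\<close>

abbreviation "\<B>M \<equiv> ext_form_algebra \<tau> \<eta> \<tau>M F"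
abbreviation "\<Omega> \<equiv> omega_tilde \<tau> \<eta> \<tau>M E F \<omega>"

lemma omega_tilde_eq: "represents x \<xi> \<Longrightarrow> \<Omega> x = F_inner E G \<xi>"
  by (simp add: omega_tilde_def op_vec_eq)

lemma ext_form_algebra_add:
  assumes "x \<in> \<B>M" "y \<in> \<B>M"
  shows "x + y \<in> \<B>M" and "\<Omega> (x + y) = \<Omega> x + \<Omega> y"
proof -
  obtain \<xi> \<zeta> where \<xi>: "\<xi> \<in> F" "represents x \<xi>" and \<zeta>: "\<zeta> \<in> F" "represents y \<zeta>"
    using assms unfolding ext_form_algebra_def by blast
  note rep = op_represents_add[OF \<xi>(2) \<zeta>(2)]
  show "x + y \<in> \<B>M" using rep F_add[OF \<xi>(1) \<zeta>(1)] unfolding ext_form_algebra_def by blast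
  show "\<Omega> (x + y) = \<Omega> x + \<Omega> y"
    using \<xi> \<zeta> by (simp add: omega_tilde_eq[OF rep] omega_tilde_eq[OF \<xi>(2)] omega_tilde_eq[OF \<zeta>(2)] F_inner_add G_in_F)
qed

lemma ext_form_algebra_scaleC:
  assumes "x \<in> \<B>M"
  shows "scaleC_op c x \<in> \<B>M" and "\<Omega> (scaleC_op c x) = c * \<Omega> x"
proof -
  obtain \<xi> where \<xi>: "\<xi> \<in> F" "represents x \<xi>" using assms unfolding ext_form_algebra_def by blast
  note rep = op_represents_scaleC[OF \<xi>(2), of c]
  show "scaleC_op c x \<in> \<B>M" using rep F_scaleC[OF \<xi>(1)] unfolding ext_form_algebra_def by blast
  show "\<Omega> (scaleC_op c x) = c * \<Omega> x"
    using \<xi> by (simp add: omega_tilde_eq[OF rep] omega_tilde_eq[OF \<xi>(2)] F_inner_scaleC G_in_F)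
qed

lemma left_mult_in_ext:
  assumes "b \<in> \<B>"
  shows "\<pi> b \<in> \<B>M" and "\<Omega> (\<pi> b) = \<omega> b"
proof -
  note rep = op_represents_left_mult[OF form_algebraD(1)[OF assms]]
  show "\<pi> b \<in> \<B>M" using rep form_algebraD(2)[OF assms] unfolding ext_form_algebra_def by blast
  show "\<Omega> (\<pi> b) = \<omega> b" using omega_tilde_eq[OF rep] potential_eq[OF assms] by simp
qed

lemma Re_omega_tilde_le:
  fixes x :: "'h \<Rightarrow>\<^sub>L 'h"
  assumes x: "x \<in> \<B>M" and t: "0 < t" and x_le: "\<And>z. inner z (x z) \<le> t * (norm z)\<^sup>2"
  shows "Re (\<Omega> x) \<le> t * W"
proof -
  obtain \<xi> where \<xi>: "\<xi> \<in> F" "represents x \<xi>" using x unfolding ext_form_algebra_def by blast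
  show ?thesis
    using potential_pairing_le_scaled[OF \<xi>(2,1) t x_le] by (simp add: omega_tilde_eq[OF \<xi>(2)] E1_def)
qed

text \<open>Rotate \<open>x\<close> by a phase \<open>u\<close> that makes the value nonnegative.  The dissipativity bound needs a strictly
  positive constant, whence \<open>\<parallel>x\<parallel> + e\<close>.\<close>

lemma cmod_omega_tilde_le:
  assumes x: "x \<in> \<B>M"
  shows "cmod (\<Omega> x) \<le> W * norm x"
proof -
  define u where "u = (if \<Omega> x = 0 then 1 else cnj (\<Omega> x) / of_real (cmod (\<Omega> x)))"
  have u: "cmod u = 1" "u * \<Omega> x = of_real (cmod (\<Omega> x))"
  proof -
    have "\<Omega> x * cnj (\<Omega> x) = of_real (cmod (\<Omega> x)) * of_real (cmod (\<Omega> x))"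
      by (metis complex_norm_square of_real_power power2_eq_square)
    then show "cmod u = 1" "u * \<Omega> x = of_real (cmod (\<Omega> x))"
      by (auto simp: u_def norm_divide field_simps)
  qed
  have "cmod (\<Omega> x) \<le> W * norm x + e * W" if e: "0 < e" for e
  proof -
    have "Re (\<Omega> (scaleC_op u x)) \<le> (norm x + e) * W"
    proof (rule Re_omega_tilde_le[OF ext_form_algebra_scaleC(1)[OF x]])
      show "0 < norm x + e" using e by (simp add: add_nonneg_pos)
      have "norm (scaleC_op u x) \<le> norm x + e" using norm_scaleC_op_le[of u x] u e by simp
      then show "inner z ((scaleC_op u x) z) \<le> (norm x + e) * (norm z)\<^sup>2" for z
        using inner_blinfun_le[of z "scaleC_op u x"] by (meson mult_right_mono order_trans zero_le_power2)
    qed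
    then show ?thesis using u by (simp add: ext_form_algebra_scaleC(2)[OF x] algebra_simps)
  qed
  then show ?thesis by (rule le_of_le_add_scaled[OF _ W_nonneg])
qed

text \<open>The bound on \<open>\<B>M\<close> gives the extension to the closure and one half of the norm equality; the other half
  comes from the elements \<open>\<pi>(b)\<close>.\<close>

lemma finite_energy_extension:
  "\<exists>\<phi>. positive_functional_on (fine_algebra \<tau> \<eta> \<tau>M F) \<phi> \<and> (\<forall>b\<in>\<B>M. \<phi> b = \<Omega> b) \<and>
    dual_norm (fine_algebra \<tau> \<eta> \<tau>M F) \<phi> = W"
proof -
  let ?C = "fine_algebra \<tau> \<eta> \<tau>M F"
  have C: "?C = closure ((\<lambda>x. x) ` \<B>M)" by (simp add: fine_algebra_def)
  note scaleR = scaleC_op_of_real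
  have zB: "0 \<in> \<B>M"
  proof -
    obtain b where "b \<in> \<B>" using regular_core[OF F_zero zero_less_one] by blast
    then have "scaleC_op (of_real 0) (\<pi> b) \<in> \<B>M" by (intro ext_form_algebra_scaleC left_mult_in_ext)
    then show ?thesis unfolding scaleR by simp
  qed
  have ne: "\<B>M \<noteq> {}" using zB by blast
  have add: "\<exists>z\<in>\<B>M. z = x + y \<and> \<Omega> z = \<Omega> x + \<Omega> y" if "x \<in> \<B>M" "y \<in> \<B>M" for x y
    using ext_form_algebra_add[OF that] by blast
  have scale: "\<exists>z\<in>\<B>M. z = r *\<^sub>R x \<and> \<Omega> z = r *\<^sub>R \<Omega> x" if "x \<in> \<B>M" for x r
    using ext_form_algebra_scaleC[OF that, of "of_real r"] unfolding scaleR
    by (simp add: scaleR_conv_of_real)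
  from bounded_linear_extension[where p = "\<lambda>x. x", OF ne add scale cmod_omega_tilde_le]
  obtain \<phi> where \<phi>: "\<And>x. x \<in> \<B>M \<Longrightarrow> \<phi> x = \<Omega> x" and cont: "continuous_on ?C \<phi>"
    and add: "\<And>x y. x \<in> ?C \<Longrightarrow> y \<in> ?C \<Longrightarrow> \<phi> (x + y) = \<phi> x + \<phi> y"
    and bound: "\<And>x. x \<in> ?C \<Longrightarrow> cmod (\<phi> x) \<le> W * norm x"
    unfolding C[symmetric] by blast
  have BC: "\<B>M \<subseteq> ?C" unfolding fine_algebra_def by (rule closure_subset)
  have lim: "(\<lambda>n. \<Omega> (u n)) \<longlonglongrightarrow> \<phi> x" if u: "\<And>n::nat. u n \<in> \<B>M" "u \<longlonglongrightarrow> x" for u x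
  proof -
    have "x \<in> ?C" unfolding fine_algebra_def closure_sequential using u by blast
    then have "(\<lambda>n. \<phi> (u n)) \<longlonglongrightarrow> \<phi> x"
      by (rule continuous_on_tendsto_compose[OF cont u(2)]) (use u(1) BC in \<open>auto intro: always_eventually\<close>)
    then show ?thesis using \<phi>[OF u(1)] by simp
  qed
  have appr: "\<exists>u. (\<forall>n::nat. u n \<in> \<B>M) \<and> u \<longlonglongrightarrow> x" if "x \<in> ?C" for x
    using that unfolding fine_algebra_def by (rule closure_sequence)
  have diff: "scaleC_op c x - scaleC_op c y = scaleC_op c (x - y)" for c and x y :: "'h \<Rightarrow>\<^sub>L 'h"
    by (rule blinfun_eqI) (simp add: scaleC_op_apply blinfun.diff_left scaleC_diff_right)
  have sc: "\<phi> (scaleC_op c x) = c * \<phi> x" if x: "x \<in> ?C" for c x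
  proof -
    obtain u where u: "\<And>n::nat. u n \<in> \<B>M" "u \<longlonglongrightarrow> x" using appr[OF x] by blast
    have "(\<lambda>n. cmod c * norm (u n - x)) \<longlonglongrightarrow> cmod c * 0"
      by (intro tendsto_intros tendsto_norm_zero LIM_zero u)
    then have "(\<lambda>n. cmod c * norm (u n - x)) \<longlonglongrightarrow> 0" by simp
    moreover have "norm (scaleC_op c (u n) - scaleC_op c x) \<le> cmod c * norm (u n - x)" for n
      unfolding diff by (rule norm_scaleC_op_le)
    ultimately have "(\<lambda>n. norm (scaleC_op c (u n) - scaleC_op c x)) \<longlonglongrightarrow> 0"
      by (intro nonneg_squeeze_zero[of "\<lambda>n. norm (scaleC_op c (u n) - scaleC_op c x)" "\<lambda>n. cmod c * norm (u n - x)"] norm_ge_zero)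
    then have "(\<lambda>n. scaleC_op c (u n)) \<longlonglongrightarrow> scaleC_op c x"
      by (rule LIM_zero_cancel[OF tendsto_norm_zero_cancel])
    from lim[OF ext_form_algebra_scaleC(1)[OF u(1)] this]
    have "(\<lambda>n. c * \<Omega> (u n)) \<longlonglongrightarrow> \<phi> (scaleC_op c x)"
      by (simp add: ext_form_algebra_scaleC(2)[OF u(1)])
    moreover have "(\<lambda>n. c * \<Omega> (u n)) \<longlonglongrightarrow> c * \<phi> x" by (intro tendsto_intros lim u)
    ultimately show ?thesis by (rule LIMSEQ_unique)
  qed
  \<comment> \<open>approximants of \<open>w x\<close> are dissipative up to an arbitrarily small multiple of the identity\<close>
  have dissipative: "Re (w * \<phi> x) \<le> 0"
    if x: "x \<in> ?C" and w: "\<And>z. inner z (w *\<^sub>C x z) \<le> 0" for w x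
  proof -
    obtain u where u: "\<And>n::nat. u n \<in> \<B>M" "u \<longlonglongrightarrow> x" using appr[OF x] by blast
    define t where "t n = cmod w * norm (u n - x) + inverse (real (Suc n))" for n
    have "t \<longlonglongrightarrow> cmod w * 0 + 0"
      unfolding t_def by (intro tendsto_intros tendsto_norm_zero LIM_zero u LIMSEQ_inverse_real_of_nat)
    then have tlim: "(\<lambda>n. t n * W) \<longlonglongrightarrow> 0 * W" by (intro tendsto_intros) simp
    have "Re (w * \<Omega> (u n)) \<le> t n * W" for n
    proof -
      have "Re (\<Omega> (scaleC_op w (u n))) \<le> t n * W"
      proof (rule Re_omega_tilde_le[OF ext_form_algebra_scaleC(1)[OF u(1)]])
        show "0 < t n" unfolding t_def by (intro add_nonneg_pos) auto
        fix z
        have "(scaleC_op w (u n)) z = w *\<^sub>C x z + (scaleC_op w (u n - x)) z"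
          by (simp add: scaleC_op_apply blinfun.diff_left scaleC_diff_right)
        then have "inner z ((scaleC_op w (u n)) z) \<le> inner z ((scaleC_op w (u n - x)) z)"
          using w[of z] by (simp add: inner_add_right)
        also have "\<dots> \<le> norm (scaleC_op w (u n - x)) * (norm z)\<^sup>2" by (rule inner_blinfun_le)
        also have "\<dots> \<le> t n * (norm z)\<^sup>2"
          using norm_scaleC_op_le[of w "u n - x"] unfolding t_def by (intro mult_right_mono) (auto intro: add_increasing2)
        finally show "inner z ((scaleC_op w (u n)) z) \<le> t n * (norm z)\<^sup>2" .
      qed
      then show ?thesis by (simp add: ext_form_algebra_scaleC(2)[OF u(1)])
    qed
    moreover have "(\<lambda>n. Re (w * \<Omega> (u n))) \<longlonglongrightarrow> Re (w * \<phi> x)" by (intro tendsto_intros lim u)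
    ultimately have "Re (w * \<phi> x) \<le> 0 * W" by (intro LIMSEQ_le[OF _ tlim]) auto
    then show ?thesis by simp
  qed
  \<comment> \<open>for positive \<open>x\<close> this applies to \<open>w = -1\<close> and to \<open>w = \<plusminus> i\<close>, which settles real and imaginary part\<close>
  have positive: "\<phi> x \<in> \<real>\<^sub>\<ge>\<^sub>0" if x: "x \<in> ?C" "positive_op x" for x
  proof -
    have p: "0 \<le> Re (cinner z (x z))" "Im (cinner z (x z)) = 0" for z
      using x(2) unfolding positive_op_def complex_nonneg_Reals_iff by blast+
    have w: "inner z (w *\<^sub>C x z) = Re w * Re (cinner z (x z))" for z w
      by (simp add: Re_cinner[symmetric] cinner_scaleC_right p)
    have "Re (w * \<phi> x) \<le> 0" if "Re w \<le> 0" for w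
      by (rule dissipative[OF x(1)]) (simp add: w p that mult_nonpos_nonneg)
    from this[of "-1"] this[of "\<i>"] this[of "-\<i>"] show ?thesis
      by (simp add: complex_nonneg_Reals_iff)
  qed
  have pf: "positive_functional_on ?C \<phi>"
    unfolding positive_functional_on_def using add sc bound positive by blast
  have bdd: "bdd_above ((\<lambda>x. cmod (\<phi> x)) ` {x \<in> ?C. norm x \<le> 1})"
  proof (rule bdd_aboveI2)
    fix x assume x: "x \<in> {x \<in> ?C. norm x \<le> 1}"
    have "W * norm x \<le> W" using x W_nonneg by (simp add: mult_left_le)
    then show "cmod (\<phi> x) \<le> W" using bound[of x] x by simp
  qed
  have "dual_norm ?C \<phi> \<le> W"
    unfolding dual_norm_def[of ?C]
  proof (rule cSUP_least)
    show "{x \<in> ?C. norm x \<le> 1} \<noteq> {}" using zB BC by (auto intro!: exI[of _ 0])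
    fix x assume x: "x \<in> {x \<in> ?C. norm x \<le> 1}"
    have "W * norm x \<le> W" using x W_nonneg by (simp add: mult_left_le)
    then show "cmod (\<phi> x) \<le> W" using bound[of x] x by simp
  qed
  moreover have "W \<le> dual_norm ?C \<phi>"
  proof -
    let ?D = "dual_norm ?C \<phi>"
    have up: "cmod (\<phi> y) \<le> ?D" if "y \<in> ?C" "norm y \<le> 1" for y
      unfolding dual_norm_def by (rule cSUP_upper[OF _ bdd]) (use that in simp)
    have D0: "0 \<le> ?D" using order_trans[OF norm_ge_zero up[of 0]] zB BC by auto
    have hom: "cmod (\<Omega> y) \<le> ?D * norm y" if y: "y \<in> \<B>M" for y
    proof (cases "y = 0")
      case True
      then show ?thesis using cmod_omega_tilde_le[OF y] by simp
    next
      case False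
      let ?y = "scaleC_op (of_real (1 / norm y)) y"
      have "?y \<in> \<B>M" by (rule ext_form_algebra_scaleC(1)[OF y])
      moreover have "norm ?y \<le> 1" unfolding scaleR using False by simp
      ultimately have "cmod (\<Omega> ?y) \<le> ?D" using up[of ?y] BC \<phi> by auto
      then show ?thesis using False by (simp add: ext_form_algebra_scaleC(2)[OF y] norm_mult norm_divide field_simps)
    qed
    have dense: "cmod (\<omega> a) \<le> ?D * norm a" for a
    proof -
      have "a \<in> closure \<B>" using regular_dense by simp
      then obtain b where b: "\<forall>n::nat. b n \<in> \<B>" "b \<longlonglongrightarrow> a" using closure_sequence by blast
      have "cmod (\<omega> (b n)) \<le> ?D * norm (b n)" for n
      proof -
        have "cmod (\<omega> (b n)) \<le> ?D * norm (\<pi> (b n))"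
          using hom[OF left_mult_in_ext(1)] left_mult_in_ext(2) b(1) by metis
        also have "\<dots> \<le> ?D * norm (b n)" by (rule mult_left_mono[OF norm_left_mult_le D0])
        finally show ?thesis .
      qed
      moreover have "(\<lambda>n. cmod (\<omega> (b n))) \<longlonglongrightarrow> cmod (\<omega> a)"
        by (intro tendsto_norm bounded_linear.tendsto[OF \<omega>_bounded] b)
      moreover have "(\<lambda>n. ?D * norm (b n)) \<longlonglongrightarrow> ?D * norm a" by (intro tendsto_intros b)
      ultimately show ?thesis by (intro LIMSEQ_le) auto
    qed
    show ?thesis
      unfolding dual_norm_def[of UNIV]
    proof (rule cSUP_least)
      show "{x \<in> UNIV. norm x \<le> 1} \<noteq> {}" by (auto intro!: exI[of _ 0])
      fix a :: 'a assume "a \<in> {x \<in> UNIV. norm x \<le> 1}"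
      then have "?D * norm a \<le> ?D" using D0 by (simp add: mult_left_le)
      then show "cmod (\<omega> a) \<le> ?D" using dense[of a] by simp
    qed
  qed
  ultimately show ?thesis using pf \<phi> by (intro exI[of _ \<phi>]) auto
qed

end

end

theorem proposition3p5:
  fixes \<tau> :: "'a::cstar_algebra \<Rightarrow> ennreal"
    and \<eta> :: "'a \<Rightarrow> 'h::complex_hilbert_space"
    and \<tau>M :: "('h \<Rightarrow>\<^sub>L 'h) \<Rightarrow> ennreal"
    and E :: "'h \<Rightarrow> 'h \<Rightarrow> complex"
    and F :: "'h set"
    and \<omega> :: "'a \<Rightarrow> complex"
  assumes "dirichlet_form \<tau> \<eta> \<tau>M E F"
    and "finite_energy \<tau> \<eta> E F \<omega>"
  shows "\<exists>\<phi>. positive_functional_on (fine_algebra \<tau> \<eta> \<tau>M F) \<phi> \<and>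
    (\<forall>b\<in>ext_form_algebra \<tau> \<eta> \<tau>M F. \<phi> b = omega_tilde \<tau> \<eta> \<tau>M E F \<omega> b) \<and>
    dual_norm (fine_algebra \<tau> \<eta> \<tau>M F) \<phi> = dual_norm UNIV \<omega>"
  by (rule dirichlet_form.finite_energy_extension[OF assms])

end
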